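(* Consider the viscous-capillary $p$-system $$v_t-u_x=\varepsilon_1v_{xx},\qquad u_t+p(v)_x=\varepsilon_2u_{xx},$$ with constants $\varepsilon_1,\varepsilon_2>0$ and $p=-W'$ for the double-well potential $W(v)=\tfrac12(1-v^2)^2$, i.e. $p(v)=2v(1-v^2)$. Then $dT/da>0$ holds for all nonconstant periodic orbits of its stationary-wave system $$\varepsilon_1v'=-(u-u_-),\qquad \varepsilon_2u'=p(v)-p(v_-),$$ where $(v_-,u_-)$ is a rest point. Consequently all nonconstant periodic traveling-wave solutions of the system are spectrally unstable.
   Context: Amplitude and period: with $(v_-,u_-)$ fixed, the stationary-wave system is planar Hamiltonian and each nonconstant periodic orbit lies in a one-parameter family of nearby periodic orbits, parametrized by amplitude $a$, measured along a curve in the direction of the outward normal to the orbit (increasing outward); $T(a)$ is the period of the orbit of amplitude $a$, and $dT/da$ is evaluated at the given orbit. Periodic traveling-wave solutions of this $p$-system are necessarily stationary, so are periodic orbits of the stationary-wave system. With $U=(v,u)$, $f(U)=(-u,p(v))$, $B=\operatorname{diag}(\varepsilon_1,\varepsilon_2)$, a periodic stationary solution $\bar U$ is spectrally unstable if the linearized operator $LV=BV_{xx}-(df(\bar U(x))V)_x$, acting on $L^p(\mathbb R)$, has spectrum meeting $\{\operatorname{Re}\lambda>0\}$. *)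

theory Defs
  imports "HOL-Analysis.Analysis" "HOL-Probability.Essential_Supremum"
begin

section \<open>The viscous-capillary p-system\<close>

definition double_well :: "real \<Rightarrow> real" where
  "double_well v = (1 - v\<^sup>2)\<^sup>2 / 2"

definition pressure :: "real \<Rightarrow> real" where
  "pressure v = - deriv double_well v"

lemma pressure_eq: "pressure v = 2 * v * (1 - v\<^sup>2)"
proof -
  have "(double_well has_real_derivative - (2 * v * (1 - v\<^sup>2))) (at v)"
    unfolding double_well_def by (auto intro!: derivative_eq_intros simp: field_simps)
  then show ?thesis
    by (simp add: pressure_def DERIV_imp_deriv)
qed

text \<open>Classical solutions; \<open>v t x\<close> and \<open>u t x\<close> are the values at time \<open>t\<close> and position \<open>x\<close>.\<close>

definition p_system_solution ::
    "real \<Rightarrow> real \<Rightarrow> (real \<Rightarrow> real \<Rightarrow> real) \<Rightarrow> (real \<Rightarrow> real \<Rightarrow> real) \<Rightarrow> bool" where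
  "p_system_solution e1 e2 v u \<longleftrightarrow>
    (\<forall>t x.
      (\<lambda>\<tau>. v \<tau> x) differentiable at t \<and> v t differentiable at x \<and> deriv (v t) differentiable at x \<and>
      (\<lambda>\<tau>. u \<tau> x) differentiable at t \<and> u t differentiable at x \<and> deriv (u t) differentiable at x \<and>
      deriv (\<lambda>\<tau>. v \<tau> x) t - deriv (u t) x = e1 * deriv (deriv (v t)) x \<and>
      deriv (\<lambda>\<tau>. u \<tau> x) t + deriv (\<lambda>y. pressure (v t y)) x = e2 * deriv (deriv (u t)) x)"

definition periodic_with :: "real \<Rightarrow> (real \<Rightarrow> 'a) \<Rightarrow> bool" where
  "periodic_with T w \<longleftrightarrow> T > 0 \<and> (\<forall>x. w (x + T) = w x)"

definition nonconstant_periodic :: "(real \<Rightarrow> 'a) \<Rightarrow> bool" where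
  "nonconstant_periodic w \<longleftrightarrow> (\<exists>T. periodic_with T w) \<and> \<not> w constant_on UNIV"

definition fundamental_period :: "(real \<Rightarrow> 'a) \<Rightarrow> real \<Rightarrow> bool" where
  "fundamental_period w T \<longleftrightarrow> periodic_with T w \<and> (\<forall>S. periodic_with S w \<longrightarrow> T \<le> S)"

text \<open>\<open>U = (v, u)\<close> is the profile and \<open>s\<close> the speed of the wave.\<close>

definition periodic_traveling_wave ::
    "real \<Rightarrow> real \<Rightarrow> real \<Rightarrow> (real \<Rightarrow> real \<times> real) \<Rightarrow> bool" where
  "periodic_traveling_wave e1 e2 s U \<longleftrightarrow>
    nonconstant_periodic U \<and>
    p_system_solution e1 e2 (\<lambda>t x. fst (U (x - s * t))) (\<lambda>t x. snd (U (x - s * t)))"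

section \<open>The stationary-wave system, amplitude and period\<close>

fun stationary_field :: "real \<Rightarrow> real \<Rightarrow> real \<times> real \<Rightarrow> real \<times> real \<Rightarrow> real \<times> real" where
  "stationary_field e1 e2 (vm, um) (v, u) = (- (u - um) / e1, (pressure v - pressure vm) / e2)"

text \<open>Every base state \<open>Um = (v\<^sub>-, u\<^sub>-)\<close> is a rest point of its own system.\<close>

lemma stationary_field_rest_point: "stationary_field e1 e2 Um Um = (0, 0)"
  by (cases Um) simp

definition stationary_solution ::
    "real \<Rightarrow> real \<Rightarrow> real \<times> real \<Rightarrow> (real \<Rightarrow> real \<times> real) \<Rightarrow> bool" where
  "stationary_solution e1 e2 Um w \<longleftrightarrow>
    (\<forall>x. (w has_vector_derivative stationary_field e1 e2 Um (w x)) (at x))"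

definition outward_unit_normal ::
    "(real \<Rightarrow> real \<times> real) \<Rightarrow> real \<Rightarrow> real \<times> real \<Rightarrow> bool" where
  "outward_unit_normal w x n \<longleftrightarrow>
    norm n = 1 \<and> n \<bullet> vector_derivative w (at x) = 0 \<and>
    (\<forall>\<^sub>F h in at_right 0. w x + h *\<^sub>R n \<in> outside (range w))"

text \<open>A curve \<open>c\<close> in the phase plane, with parameter the amplitude, that meets the orbit of \<open>w\<close>
  at amplitude \<open>a0\<close> and has there the direction of the outward normal. Neither \<open>c\<close> being a straight
  line nor its parametrization by arc length is required.\<close>

definition amplitude_curve ::
    "(real \<Rightarrow> real \<times> real) \<Rightarrow> (real \<Rightarrow> real \<times> real) \<Rightarrow> real \<Rightarrow> bool" where
  "amplitude_curve w c a0 \<longleftrightarrow>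
    (\<exists>x n r. outward_unit_normal w x n \<and> c a0 = w x \<and> r > 0 \<and>
      (c has_vector_derivative r *\<^sub>R n) (at a0))"

definition periodic_orbit_through ::
    "real \<Rightarrow> real \<Rightarrow> real \<times> real \<Rightarrow> real \<times> real \<Rightarrow> real \<Rightarrow> bool" where
  "periodic_orbit_through e1 e2 Um P T \<longleftrightarrow>
    (\<exists>w. stationary_solution e1 e2 Um w \<and> P \<in> range w \<and> nonconstant_periodic w \<and>
      fundamental_period w T)"

text \<open>The orbits near that of \<open>w\<close> are periodic, and \<open>dT/da > 0\<close> at \<open>w\<close>. Solutions of the
  stationary-wave system being unique, \<open>T a\<close> is determined by \<open>c a\<close> for \<open>a\<close> near \<open>a0\<close>.\<close>

definition period_increasing_at ::
    "real \<Rightarrow> real \<Rightarrow> real \<times> real \<Rightarrow> (real \<Rightarrow> real \<times> real) \<Rightarrow> real \<Rightarrow> bool" where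
  "period_increasing_at e1 e2 Um c a0 \<longleftrightarrow>
    (\<exists>T T'. (\<forall>\<^sub>F a in nhds a0. periodic_orbit_through e1 e2 Um (c a) (T a)) \<and>
      (T has_real_derivative T') (at a0) \<and> T' > 0)"

section \<open>Lebesgue spaces and weak derivatives on the line\<close>

text \<open>Elements of \<open>L\<^sup>p\<close> are represented by Borel functions; equality is equality almost
  everywhere. The exponent may be \<open>\<infinity>\<close>.\<close>

definition ess_norm :: "(real \<Rightarrow> 'a::real_normed_vector) \<Rightarrow> ereal" where
  "ess_norm f = esssup lborel (\<lambda>x. ereal (norm (f x)))"

definition Lp_space :: "ennreal \<Rightarrow> (real \<Rightarrow> 'a::real_normed_vector) set" where
  "Lp_space p = {f \<in> borel_measurable lborel.
    if p = \<infinity> then ess_norm f < \<infinity>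
    else integrable lborel (\<lambda>x. norm (f x) powr enn2real p)}"

definition Lp_norm :: "ennreal \<Rightarrow> (real \<Rightarrow> 'a::real_normed_vector) \<Rightarrow> real" where
  "Lp_norm p f =
    (if p = \<infinity> then real_of_ereal (ess_norm f)
     else (LINT x|lborel. norm (f x) powr enn2real p) powr (1 / enn2real p))"

definition test_function :: "(real \<Rightarrow> real) \<Rightarrow> bool" where
  "test_function \<phi> \<longleftrightarrow>
    (\<forall>k x. (deriv ^^ k) \<phi> differentiable at x) \<and> (\<exists>R. \<forall>x. \<bar>x\<bar> > R \<longrightarrow> \<phi> x = 0)"

definition locally_integrable :: "(real \<Rightarrow> 'a::euclidean_space) \<Rightarrow> bool" where
  "locally_integrable f \<longleftrightarrow> (\<forall>a b. set_integrable lborel {a..b} f)"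

definition weak_derivative ::
    "(real \<Rightarrow> 'a::euclidean_space) \<Rightarrow> (real \<Rightarrow> 'a) \<Rightarrow> bool" where
  "weak_derivative f g \<longleftrightarrow>
    locally_integrable f \<and> locally_integrable g \<and>
    (\<forall>\<phi>. test_function \<phi> \<longrightarrow>
      (LINT x|lborel. deriv \<phi> x *\<^sub>R f x) = - (LINT x|lborel. \<phi> x *\<^sub>R g x))"

section \<open>The linearized operator and its spectrum\<close>

fun flux :: "real \<times> real \<Rightarrow> real \<times> real" where
  "flux (v, u) = (- u, pressure v)"

text \<open>Complexification of \<open>df(U)\<close>; the lemma below is the real version.\<close>

fun dflux :: "real \<times> real \<Rightarrow> complex \<times> complex \<Rightarrow> complex \<times> complex" where
  "dflux (v, u) (a, b) = (- b, of_real (deriv pressure v) * a)"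

lemma flux_has_derivative:
  "(flux has_derivative (\<lambda>(a, b). (- b, deriv pressure v * a))) (at (v, u))"
proof -
  have *: "pressure = (\<lambda>v. 2 * v * (1 - v\<^sup>2))"
    by (simp add: fun_eq_iff pressure_eq)
  have "pressure field_differentiable at v"
    unfolding * by (intro derivative_intros)
  then have p: "(pressure has_derivative (\<lambda>a. deriv pressure v * a)) (at (fst (v, u)))"
    by (simp add: field_differentiable_derivI has_field_derivative_imp_has_derivative)
  have eq: "flux = (\<lambda>U. (- snd U, pressure (fst U)))"
    by (auto simp: fun_eq_iff)
  have "((\<lambda>U. pressure (fst U)) has_derivative (\<lambda>h. deriv pressure v * fst h)) (at (v, u))"
    by (rule has_derivative_compose[where f = fst and g = pressure, OF _ p])
      (auto intro!: derivative_eq_intros)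
  then show ?thesis
    unfolding eq case_prod_beta by (auto intro!: derivative_eq_intros)
qed

fun viscosity :: "real \<Rightarrow> real \<Rightarrow> complex \<times> complex \<Rightarrow> complex \<times> complex" where
  "viscosity e1 e2 (a, b) = (of_real e1 * a, of_real e2 * b)"

fun cscale :: "complex \<Rightarrow> complex \<times> complex \<Rightarrow> complex \<times> complex" where
  "cscale z (a, b) = (z * a, z * b)"

text \<open>The graph of \<open>L V = B V\<^sub>x\<^sub>x - (df(U) V)\<^sub>x\<close> on \<open>L\<^sup>p\<close>, with domain the Sobolev space \<open>W\<^sup>2\<^sup>,\<^sup>p\<close>:
  \<open>(V, G)\<close> with \<open>V\<close> in the domain and \<open>L V = G\<close>.\<close>

definition linearized_op ::
    "ennreal \<Rightarrow> real \<Rightarrow> real \<Rightarrow> (real \<Rightarrow> real \<times> real) \<Rightarrow>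
     (real \<Rightarrow> complex \<times> complex) \<Rightarrow> (real \<Rightarrow> complex \<times> complex) \<Rightarrow> bool" where
  "linearized_op p e1 e2 U V G \<longleftrightarrow>
    V \<in> Lp_space p \<and> G \<in> Lp_space p \<and>
    (\<exists>V1 V2 W. V1 \<in> Lp_space p \<and> V2 \<in> Lp_space p \<and>
      weak_derivative V V1 \<and> weak_derivative V1 V2 \<and>
      weak_derivative (\<lambda>x. dflux (U x) (V x)) W \<and>
      (AE x in lborel. G x = viscosity e1 e2 (V2 x) - W x))"

text \<open>\<open>\<lambda> - L\<close> maps the domain bijectively onto \<open>L\<^sup>p\<close> with bounded inverse; the estimate contains
  injectivity (modulo null sets).\<close>

definition resolvent_set ::
    "ennreal \<Rightarrow> real \<Rightarrow> real \<Rightarrow> (real \<Rightarrow> real \<times> real) \<Rightarrow> complex set" where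
  "resolvent_set p e1 e2 U = {z.
    (\<forall>F \<in> Lp_space p. \<exists>V G. linearized_op p e1 e2 U V G \<and>
      (AE x in lborel. cscale z (V x) - G x = F x)) \<and>
    (\<exists>C. \<forall>V G. linearized_op p e1 e2 U V G \<longrightarrow>
      Lp_norm p V \<le> C * Lp_norm p (\<lambda>x. cscale z (V x) - G x))}"

definition spectrum ::
    "ennreal \<Rightarrow> real \<Rightarrow> real \<Rightarrow> (real \<Rightarrow> real \<times> real) \<Rightarrow> complex set" where
  "spectrum p e1 e2 U = - resolvent_set p e1 e2 U"

definition spectrally_unstable ::
    "ennreal \<Rightarrow> real \<Rightarrow> real \<Rightarrow> (real \<Rightarrow> real \<times> real) \<Rightarrow> bool" where
  "spectrally_unstable p e1 e2 U \<longleftrightarrow> spectrum p e1 e2 U \<inter> {z. Re z > 0} \<noteq> {}"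

end

theory Submission
  imports Defs "HOL-Probability.Sinc_Integral"
begin

text \<open>Period: on an orbit with turning points \<open>\<mu> - \<delta>\<close>, \<open>\<mu> + \<delta>\<close> the equation for \<open>v\<close> reads
  \<open>e (v')\<^sup>2 = quartic\<close> with \<open>e = e1 e2\<close>, and the standard reduction of the elliptic integral turns the
  period into \<open>\<surd>e\<close> times the integral of \<open>1 / \<surd>(s + d cos \<theta>)\<close> over \<open>[0, 2 \<pi>]\<close>, where \<open>s = 2 - 6 \<mu>\<^sup>2\<close> and
  \<open>d = 2 \<rho> \<delta>\<close>. This decreases in \<open>s\<close> and increases in \<open>d / s\<close>; along the family of orbits \<open>s\<close> does not
  increase with the energy, while \<open>d\<close> increases strictly.

  Instability: for \<open>V = (A', l A - e1 A'')\<close> the eigenvalue equation \<open>L V = l V\<close> is the self-adjoint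
  quadratic pencil \<open>l\<^sup>2 A - l (e1 + e2) A'' + (e A''' + q A')' = 0\<close> with \<open>q = p'(v)\<close>. Its quadratic form is
  positive for large \<open>l\<close>. At \<open>l = 0\<close> it is the form of \<open>- e \<partial>\<^sup>2 - q\<close> at \<open>A'\<close>; the kernel of this operator
  contains \<open>v'\<close>, which changes sign, so there is a negative direction among the functions that are
  antiperiodic over a large multiple of the period. Hence the pencil is singular for some \<open>l > 0\<close>, and
  cutting off the periodic eigenfunction shows that \<open>l\<close> is in the \<open>L\<^sup>p\<close> spectrum for every \<open>p\<close>. This
  argument does not go through the sign of \<open>dT/da\<close>.\<close>

section \<open>Ordinary differential equations\<close>

text \<open>Antiperiodicity bridges the gap between \<open>A\<close> and \<open>A'\<close>: the
  pencil acts on \<open>A\<close>, whereas the negative direction is found for the derivative, which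
  must therefore have a primitive in the same class. A periodic function has a periodic primitive
  only if its mean vanishes, and the function of negative energy at hand, a smoothed modulus of
  \<open>v'\<close>, is positive. An antiperiodic function always has an antiperiodic primitive;
  modulation by a long wave makes the positive function antiperiodic at an energy cost that tends to
  zero. Doubling the interval turns the eigenfunction into a periodic one. The passage from an
  indefinite form to a kernel uses no spectral theorem: a non-negative form whose equation has only
  the zero solution has a bounded solution operator, which makes it coercive, and coercivity
  survives a small change of \<open>l\<close>. For the period, a Moebius substitution sends one
  outer root of the quartic to infinity and the turning points to \<open>cos \<theta> = 1\<close>
  and \<open>cos \<theta> = -1\<close>. The resulting integrand is smooth up to the turning points,
  so the period can be differentiated under the integral sign, which the singular integral over
  \<open>v\<close> does not allow.\<close>

lemma inner_self_derivative:
  fixes y :: "real \<Rightarrow> 'a::real_inner"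
  assumes "(y has_vector_derivative y') (at x)"
  shows "((\<lambda>x. y x \<bullet> y x) has_real_derivative 2 * (y x \<bullet> y')) (at x)"
  using has_derivative_inner[OF assms[unfolded has_vector_derivative_def] assms[unfolded has_vector_derivative_def]]
  unfolding has_field_derivative_def
  by (auto simp: inner_commute algebra_simps elim!: has_derivative_eq_rhs)

lemma differentiable_real_continuous_on:
  fixes f :: "real \<Rightarrow> real"
  assumes "\<And>x. (f has_real_derivative f' x) (at x)"
  shows "continuous_on S f"
  by (rule DERIV_continuous_on[OF has_field_derivative_at_within[OF assms]])

text \<open>Gronwall's inequality for the squared norm \<open>D\<close> in both time directions:
  \<open>exp (- (2 * K * x)) * D x\<close> cannot increase and \<open>exp (2 * K * x) * D x\<close>
  cannot decrease. All uniqueness statements below rest on it.\<close>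

lemma vanishing_of_linear_growth:
  fixes y y' :: "real \<Rightarrow> 'a::real_inner"
  assumes y: "\<And>x. (y has_vector_derivative y' x) (at x)"
    and growth: "\<And>x. norm (y' x) \<le> K * norm (y x)"
    and "y x0 = 0"
  shows "y x = 0"
proof -
  define D where "D x = y x \<bullet> y x" for x
  have D: "(D has_real_derivative 2 * (y x \<bullet> y' x)) (at x)" for x
    unfolding D_def by (rule inner_self_derivative[OF y])
  have bd: "\<bar>2 * (y x \<bullet> y' x)\<bar> \<le> 2 * K * D x" for x
  proof -
    have "\<bar>y x \<bullet> y' x\<bar> \<le> norm (y x) * norm (y' x)"
      by (rule Cauchy_Schwarz_ineq2)
    also have "\<dots> \<le> norm (y x) * (K * norm (y x))"
      by (intro mult_left_mono growth) auto
    also have "\<dots> = K * D x"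
      by (simp add: D_def power2_norm_eq_inner[symmetric] power2_eq_square)
    finally show ?thesis by (simp add: abs_mult)
  qed
  have D0: "D x0 = 0" by (simp add: D_def assms)
  have "D x \<le> 0"
  proof (cases "x0 \<le> x")
    case True
    have "exp (- (2 * K * x)) * D x \<le> exp (- (2 * K * x0)) * D x0"
    proof (rule DERIV_nonpos_imp_nonincreasing[OF True])
      fix t
      have "((\<lambda>t. exp (- (2 * K * t)) * D t) has_real_derivative
          exp (- (2 * K * t)) * (2 * (y t \<bullet> y' t) - 2 * K * D t)) (at t)"
        by (rule derivative_eq_intros D refl)+ (simp add: algebra_simps)
      moreover have "exp (- (2 * K * t)) * (2 * (y t \<bullet> y' t) - 2 * K * D t) \<le> 0"
        using bd[of t] by (intro mult_nonneg_nonpos) auto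
      ultimately show "\<exists>z. ((\<lambda>t. exp (- (2 * K * t)) * D t) has_real_derivative z) (at t) \<and> z \<le> 0"
        by blast
    qed
    then show ?thesis by (simp add: D0 mult_le_0_iff)
  next
    case False
    then have "x \<le> x0" by simp
    have "exp (2 * K * x) * D x \<le> exp (2 * K * x0) * D x0"
    proof (rule DERIV_nonneg_imp_nondecreasing[OF \<open>x \<le> x0\<close>])
      fix t
      have "((\<lambda>t. exp (2 * K * t) * D t) has_real_derivative
          exp (2 * K * t) * (2 * (y t \<bullet> y' t) + 2 * K * D t)) (at t)"
        by (rule derivative_eq_intros D refl)+ (simp add: algebra_simps)
      moreover have "exp (2 * K * t) * (2 * (y t \<bullet> y' t) + 2 * K * D t) \<ge> 0"
        using bd[of t] by (intro mult_nonneg_nonneg) auto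
      ultimately show "\<exists>z. ((\<lambda>t. exp (2 * K * t) * D t) has_real_derivative z) (at t) \<and> z \<ge> 0"
        by blast
    qed
    then show ?thesis by (simp add: D0 mult_le_0_iff)
  qed
  then show ?thesis
    by (metis D_def inner_eq_zero_iff inner_ge_zero order_antisym)
qed

text \<open>Gronwall with forcing. The cross term is split by
  \<open>2 |y| |F| <= |y|^2 + F^2\<close>, which is the origin of the \<open>+ 1\<close> in the
  exponent; the forcing then enters through the integral of its square, as the quadratic forms below
  require.\<close>

lemma square_norm_growth_bound:
  fixes y y' :: "real \<Rightarrow> 'a::real_inner"
  assumes y: "\<And>x. (y has_vector_derivative y' x) (at x)"
    and growth: "\<And>x. norm (y' x) \<le> K * norm (y x) + \<bar>F x\<bar>"
    and F: "continuous_on UNIV F" and K: "0 \<le> K" and x: "0 \<le> x"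
  shows "(norm (y x))\<^sup>2 \<le> exp ((2 * K + 1) * x) * ((norm (y 0))\<^sup>2 + integral {0..x} (\<lambda>t. (F t)\<^sup>2))"
proof -
  define D where "D x = y x \<bullet> y x" for x
  have D: "(D has_real_derivative 2 * (y x \<bullet> y' x)) (at x)" for x
    unfolding D_def by (rule inner_self_derivative[OF y])
  have bd: "2 * (y x \<bullet> y' x) \<le> (2 * K + 1) * D x + (F x)\<^sup>2" for x
  proof -
    have "y x \<bullet> y' x \<le> norm (y x) * norm (y' x)"
      by (rule norm_cauchy_schwarz)
    also have "\<dots> \<le> norm (y x) * (K * norm (y x) + \<bar>F x\<bar>)"
      by (intro mult_left_mono growth) auto
    finally have 1: "2 * (y x \<bullet> y' x) \<le> 2 * K * (norm (y x))\<^sup>2 + 2 * norm (y x) * \<bar>F x\<bar>"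
      by (simp add: algebra_simps power2_eq_square)
    have "2 * norm (y x) * \<bar>F x\<bar> \<le> (norm (y x))\<^sup>2 + (F x)\<^sup>2"
      using zero_le_power2[of "norm (y x) - \<bar>F x\<bar>"] by (simp add: power2_diff)
    with 1 show ?thesis
      by (simp add: D_def power2_norm_eq_inner[symmetric] algebra_simps)
  qed
  have F2: "continuous_on {0..x} (\<lambda>t. (F t)\<^sup>2)"
    using F by (intro continuous_intros) (auto intro: continuous_on_subset)
  define I where "I t = integral {0..t} (\<lambda>t. (F t)\<^sup>2)" for t
  have I: "(I has_real_derivative (F t)\<^sup>2) (at t within {0..x})" if "t \<in> {0..x}" for t
    unfolding I_def by (rule integral_has_real_derivative[OF F2 that])
  define J where "J t = exp (- ((2 * K + 1) * t)) * D t - I t" for t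
  have "J x \<le> J 0"
  proof (rule DERIV_nonpos_imp_decreasing_open[OF x])
    fix t assume t: "0 < t" "t < x"
    then have "(I has_real_derivative (F t)\<^sup>2) (at t)"
      using I[of t] by (simp add: at_within_Icc_at)
    moreover have "((\<lambda>t. exp (- ((2 * K + 1) * t)) * D t) has_real_derivative
        exp (- ((2 * K + 1) * t)) * (2 * (y t \<bullet> y' t) - (2 * K + 1) * D t)) (at t)"
      by (rule derivative_eq_intros D refl)+ (simp add: algebra_simps)
    ultimately have J': "(J has_real_derivative
        exp (- ((2 * K + 1) * t)) * (2 * (y t \<bullet> y' t) - (2 * K + 1) * D t) - (F t)\<^sup>2) (at t)"
      unfolding J_def by (intro DERIV_diff)
    have "exp (- ((2 * K + 1) * t)) * (2 * (y t \<bullet> y' t) - (2 * K + 1) * D t) \<le>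
        exp (- ((2 * K + 1) * t)) * (F t)\<^sup>2"
      using bd[of t] by (intro mult_left_mono) auto
    moreover have "exp (- ((2 * K + 1) * t)) * (F t)\<^sup>2 \<le> 1 * (F t)\<^sup>2"
      using t K by (intro mult_right_mono) auto
    ultimately have "exp (- ((2 * K + 1) * t)) * (2 * (y t \<bullet> y' t) - (2 * K + 1) * D t) - (F t)\<^sup>2 \<le> 0"
      by linarith
    with J' show "\<exists>z. (J has_real_derivative z) (at t) \<and> z \<le> 0"
      by blast
  next
    have "continuous_on {0..x} D"
      by (rule DERIV_continuous_on[OF has_field_derivative_at_within[OF D]])
    moreover have "continuous_on {0..x} I"
      by (rule DERIV_continuous_on[OF I])
    ultimately show "continuous_on {0..x} J"
      unfolding J_def by (intro continuous_intros)
  qed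
  then have "exp (- ((2 * K + 1) * x)) * D x \<le> D 0 + I x"
    by (simp add: J_def I_def)
  then have "exp ((2 * K + 1) * x) * (exp (- ((2 * K + 1) * x)) * D x) \<le> exp ((2 * K + 1) * x) * (D 0 + I x)"
    by (intro mult_left_mono) auto
  then have "D x \<le> exp ((2 * K + 1) * x) * (D 0 + I x)"
    by (simp only: mult.assoc[symmetric] mult_exp_exp) simp
  then show ?thesis
    by (simp add: D_def I_def power2_norm_eq_inner)
qed

lemma primitive_exists:
  fixes f :: "real \<Rightarrow> 'a::euclidean_space"
  assumes f: "continuous_on UNIV f"
  shows "\<exists>F. F 0 = 0 \<and> (\<forall>x. (F has_vector_derivative f x) (at x))"
proof (intro exI conjI allI)
  let ?F = "\<lambda>x::real. LBINT t=0..x. f t"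
  show "?F 0 = 0"
    by (simp add: zero_ereal_def)
  fix x :: real
  have "((\<lambda>u. LBINT y=ereal 0..ereal u. f y) has_vector_derivative f x)
      (at x within {- \<bar>x\<bar> - 1..\<bar>x\<bar> + 1})"
    by (rule interval_integral_FTC2) (auto intro: continuous_on_subset[OF f])
  moreover have "at x within {- \<bar>x\<bar> - 1..\<bar>x\<bar> + 1} = at x"
    by (rule at_within_Icc_at) auto
  ultimately show "(?F has_vector_derivative f x) (at x)"
    by (simp add: zero_ereal_def)
qed

text \<open>Integrating the weight \<open>exp (2 L |x|)\<close> gains the factor
  \<open>1 / (2 L)\<close>. Against a Lipschitz constant \<open>L\<close> this is the contraction
  factor one half.\<close>

lemma primitive_exp_bound:
  fixes F f :: "real \<Rightarrow> 'a::euclidean_space"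
  assumes F: "\<And>x. (F has_vector_derivative f x) (at x)" and "F 0 = 0" and L: "L > 0"
    and f: "\<And>x. norm (f x) \<le> C + M * exp (2 * L * \<bar>x\<bar>)" and "M \<ge> 0"
  shows "norm (F x) \<le> C * \<bar>x\<bar> + M / (2 * L) * exp (2 * L * \<bar>x\<bar>)"
proof -
  have pos: "norm (H x) \<le> C * x + M / (2 * L) * exp (2 * L * x)"
    if x: "x > 0" and H: "\<And>x. (H has_vector_derivative h x) (at x)" and "H 0 = 0"
      and h: "\<And>x. norm (h x) \<le> C + M * exp (2 * L * \<bar>x\<bar>)"
    for H h :: "real \<Rightarrow> 'a" and x
  proof -
    let ?g = "\<lambda>x. C * x + M / (2 * L) * exp (2 * L * x)"
    have g: "(?g has_vector_derivative C + M * exp (2 * L * t)) (at t)" for t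
      unfolding has_real_derivative_iff_has_vector_derivative[symmetric]
      using L by (auto intro!: derivative_eq_intros)
    have "norm (H x - H 0) \<le> ?g x - ?g 0"
    proof (rule differentiable_bound_general[where f' = h and \<phi>' = "\<lambda>t. C + M * exp (2 * L * t)"])
      show "continuous_on {0..x} H"
        using H by (meson continuous_at_imp_continuous_on has_vector_derivative_continuous)
      show "continuous_on {0..x} ?g"
        by (intro continuous_intros)
      show "norm (h t) \<le> C + M * exp (2 * L * t)" if "0 < t" for t
        using h[of t] that by simp
    qed (use x H g in auto)
    moreover have "?g 0 \<ge> 0" using L \<open>M \<ge> 0\<close> by simp
    ultimately show ?thesis by (simp add: \<open>H 0 = 0\<close>)
  qed
  consider "x > 0" | "x = 0" | "x < 0" by linarith
  then show ?thesis
  proof cases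
    case 1
    then show ?thesis using pos[OF 1 F \<open>F 0 = 0\<close> f] by simp
  next
    case 2
    then show ?thesis using L \<open>M \<ge> 0\<close> \<open>F 0 = 0\<close> by simp
  next
    case 3
    have "((\<lambda>x. F (- x)) has_vector_derivative - f (- x)) (at x)" for x
    proof -
      have "(uminus has_vector_derivative (- 1::real)) (at x)"
        by (auto intro!: derivative_eq_intros)
      from vector_diff_chain_at[OF this F] show ?thesis by (simp add: o_def)
    qed
    from pos[of "- x", OF _ this] 3 f[of "- _"] \<open>F 0 = 0\<close> show ?thesis
      by (simp)
  qed
qed

text \<open>Picard iteration on the whole line at once: in the supremum norm weighted by
  \<open>exp (- 2 L |x|)\<close> the integral operator contracts by one half, so Banach's theorem
  gives a global solution without gluing local ones. The bound on \<open>G x 0\<close> keeps the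
  iterates in the weighted space.\<close>

theorem global_lipschitz_solution:
  fixes G :: "real \<Rightarrow> 'a::euclidean_space \<Rightarrow> 'a"
  assumes L: "L > 0" and lip: "\<And>x y z. norm (G x y - G x z) \<le> L * norm (y - z)"
    and cont: "\<And>y. continuous_on UNIV y \<Longrightarrow> continuous_on UNIV (\<lambda>x. G x (y x))"
    and bound: "\<And>x. norm (G x 0) \<le> C"
  shows "\<exists>y. y 0 = y0 \<and> (\<forall>x. (y has_vector_derivative G x (y x)) (at x))"
proof -
  define k where "k x = exp (2 * L * \<bar>x\<bar>)" for x :: real
  have kpos: "k x > 0" for x by (simp add: k_def)
  have kcont: "continuous_on UNIV k" unfolding k_def by (intro continuous_intros)
  define prim where "prim f = (SOME F::real \<Rightarrow> 'a. F 0 = 0 \<and> (\<forall>x. (F has_vector_derivative f x) (at x)))" for f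
  have prim: "prim f 0 = 0" "\<And>x. (prim f has_vector_derivative f x) (at x)"
    if "continuous_on UNIV f" for f
    using someI_ex[OF primitive_exists[OF that]] unfolding prim_def by auto
  \<comment> \<open>The iteration variable is \<open>z = y / k\<close>, a bounded continuous
    function, so the weighted norm of \<open>y\<close> is the ordinary supremum norm of
    \<open>z\<close>.\<close>
  define f where "f z = (\<lambda>t. G t (k t *\<^sub>R apply_bcontfun z t))" for z :: "real \<Rightarrow>\<^sub>C 'a"
  have fcont: "continuous_on UNIV (f z)" for z
    unfolding f_def by (intro cont continuous_intros kcont continuous_on_apply_bcontfun)
  have C0: "0 \<le> C" using bound[of 0] norm_ge_zero order_trans by blast
  have fbd: "norm (f z x) \<le> C + (L * norm z) * exp (2 * L * \<bar>x\<bar>)" for z x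
  proof -
    have "norm (f z x) \<le> norm (G x (k x *\<^sub>R apply_bcontfun z x) - G x 0) + norm (G x 0)"
      unfolding f_def by (metis diff_add_cancel norm_triangle_ineq)
    also have "\<dots> \<le> L * norm (k x *\<^sub>R apply_bcontfun z x) + C"
      using lip[of x "k x *\<^sub>R apply_bcontfun z x" 0] bound[of x] by simp
    also have "\<dots> \<le> L * (k x * norm z) + C"
      using L kpos[of x] norm_bounded[of z x] by (auto intro!: mult_left_mono)
    finally show ?thesis by (simp add: k_def algebra_simps)
  qed
  define S where "S z = (\<lambda>x. (1 / k x) *\<^sub>R (y0 + prim (f z) x))" for z
  have Scont: "continuous_on UNIV (S z)" for z
  proof -
    have "continuous_on UNIV (prim (f z))"
      using prim(2)[OF fcont] by (meson continuous_at_imp_continuous_on has_vector_derivative_continuous)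
    then show ?thesis unfolding S_def
      by (intro continuous_intros kcont) (use kpos in \<open>auto simp: less_imp_neq[symmetric]\<close>)
  qed
  have kge: "k x \<ge> 1" "2 * L * \<bar>x\<bar> \<le> k x" for x
    using L exp_ge_add_one_self[of "2 * L * \<bar>x\<bar>"] unfolding k_def by (simp, linarith)
  have Sbd: "norm (S z x) \<le> norm y0 + C / (2 * L) + norm z / 2" for z x
  proof -
    have "norm (prim (f z) x) \<le> C * \<bar>x\<bar> + (L * norm z) / (2 * L) * exp (2 * L * \<bar>x\<bar>)"
      by (rule primitive_exp_bound[OF prim(2) prim(1) L fbd]) (use L in \<open>auto simp: fcont\<close>)
    also have "\<dots> = C / (2 * L) * (2 * L * \<bar>x\<bar>) + norm z / 2 * k x"
      using L by (simp add: k_def)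
    also have "\<dots> \<le> C / (2 * L) * k x + norm z / 2 * k x"
      using C0 L kge(2)[of x] by (intro add_right_mono mult_left_mono) auto
    finally have 1: "norm (prim (f z) x) \<le> C / (2 * L) * k x + norm z / 2 * k x" .
    have "norm (y0 + prim (f z) x) \<le> norm y0 * 1 + norm (prim (f z) x)"
      by (simp add: norm_triangle_ineq)
    also have "norm y0 * 1 \<le> norm y0 * k x"
      using kge(1) by (intro mult_left_mono) auto
    also note 1
    finally have 2: "norm (y0 + prim (f z) x) \<le> (norm y0 + C / (2 * L) + norm z / 2) * k x"
      by (simp add: algebra_simps)
    have "norm (S z x) = norm (y0 + prim (f z) x) / k x"
      using kpos[of x] by (simp add: S_def divide_inverse mult.commute)
    then show ?thesis using 2 kpos[of x] by (simp add: pos_divide_le_eq)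
  qed
  define \<Phi> where "\<Phi> z = Bcontfun (S z)" for z
  have \<Phi>: "apply_bcontfun (\<Phi> z) = S z" for z
    unfolding \<Phi>_def
    by (rule Bcontfun_inverse) (auto simp: bcontfun_def Scont bounded_iff intro!: exI Sbd)
  have "dist (\<Phi> z1) (\<Phi> z2) \<le> (1/2) * dist z1 z2" for z1 z2
  proof (rule dist_bound)
    fix x
    let ?F = "\<lambda>x. prim (f z1) x - prim (f z2) x"
    have "norm (?F x) \<le> 0 * \<bar>x\<bar> + (L * dist z1 z2) / (2 * L) * exp (2 * L * \<bar>x\<bar>)"
    proof (rule primitive_exp_bound[OF _ _ L])
      show "(?F has_vector_derivative f z1 x - f z2 x) (at x)" for x
        by (intro derivative_intros prim fcont)
      show "norm (f z1 x - f z2 x) \<le> 0 + L * dist z1 z2 * exp (2 * L * \<bar>x\<bar>)" for x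
      proof -
        have "norm (f z1 x - f z2 x) \<le> L * norm (k x *\<^sub>R apply_bcontfun z1 x - k x *\<^sub>R apply_bcontfun z2 x)"
          unfolding f_def by (rule lip)
        also have "\<dots> = L * (k x * dist (apply_bcontfun z1 x) (apply_bcontfun z2 x))"
          using kpos[of x] by (simp add: dist_norm scaleR_diff_right[symmetric])
        also have "\<dots> \<le> L * (k x * dist z1 z2)"
          using L kpos[of x] dist_bounded[of z1 x z2] by (intro mult_left_mono) auto
        finally show ?thesis by (simp add: k_def algebra_simps)
      qed
    qed (use L prim(1) fcont in auto)
    then have 1: "norm (?F x) \<le> dist z1 z2 / 2 * k x"
      using L by (simp add: k_def)
    have "dist (S z1 x) (S z2 x) = norm (?F x) / k x"
      using kpos[of x]
      by (simp add: S_def dist_norm scaleR_diff_right[symmetric] divide_inverse mult.commute)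
    then show "dist (apply_bcontfun (\<Phi> z1) x) (apply_bcontfun (\<Phi> z2) x) \<le> 1 / 2 * dist z1 z2"
      using 1 kpos[of x] by (simp add: \<Phi> pos_divide_le_eq)
  qed
  then obtain z where z: "\<Phi> z = z"
    using banach_fix_type[of "1/2" \<Phi>] by auto
  define y where "y x = y0 + prim (f z) x" for x
  have yz: "k x *\<^sub>R apply_bcontfun z x = y x" for x
  proof -
    have "apply_bcontfun z x = S z x" using \<Phi>[of z] z by simp
    then show ?thesis using kpos[of x] by (simp add: S_def y_def)
  qed
  have "(y has_vector_derivative f z x) (at x)" for x
    unfolding y_def by (auto intro!: derivative_eq_intros prim fcont)
  moreover have "f z x = G x (y x)" for x
    by (simp add: f_def yz)
  moreover have "y 0 = y0" by (simp add: y_def prim fcont)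
  ultimately show ?thesis by metis
qed

section \<open>Periodic functions, shifts and antiperiodic solutions of linear systems\<close>

lemma periodic_int_shift:
  fixes f :: "real \<Rightarrow> 'a"
  assumes "\<And>x. f (x + T) = f x"
  shows "f (x + of_int k * T) = f x"
proof -
  have nat: "f (x + real n * T) = f x" for n x
  proof (induction n)
    case (Suc n)
    have "f (x + real (Suc n) * T) = f ((x + real n * T) + T)" by (simp add: algebra_simps)
    then show ?case using Suc assms by simp
  qed simp
  show ?thesis
  proof (cases "k \<ge> 0")
    case True
    then show ?thesis using nat[of x "nat k"] by simp
  next
    case False
    then show ?thesis using nat[of "x + of_int k * T" "nat (- k)"] by simp
  qed
qed

lemma periodic_representative:
  fixes f :: "real \<Rightarrow> 'a"
  assumes "\<And>x. f (x + T) = f x" and T: "T > 0"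
  obtains t where "t \<in> {0..<T}" "f x = f t"
proof
  let ?t = "x + of_int (- \<lfloor>x / T\<rfloor>) * T"
  show "?t \<in> {0..<T}"
    using T floor_divide_lower[OF T, of x] floor_divide_upper[OF T, of x]
    by (auto simp: algebra_simps)
  show "f x = f ?t"
    using periodic_int_shift[of f, OF assms(1)] by metis
qed

lemma periodic_derivative:
  assumes "\<And>x. (f has_real_derivative f1 x) (at x)" "\<And>x. f (x + T) = f x"
  shows "f1 (x + T) = f1 x"
  using DERIV_unique[of f "f1 (x + T)" x "f1 x"] assms(1)[of x]
    assms(1)[of "x + T", THEN DERIV_shift[THEN iffD1]] by (simp add: assms(2))

lemma periodic_bounded:
  fixes f :: "real \<Rightarrow> 'a::real_normed_vector"
  assumes "\<And>x. norm (f (x + T)) = norm (f x)" and T: "T > 0" and "continuous_on UNIV f"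
  obtains C where "C > 0" "\<And>x. norm (f x) \<le> C"
proof -
  have "compact (f ` {0..T})"
    using assms(3) by (intro compact_continuous_image) (auto intro: continuous_on_subset)
  then obtain C where C: "C > 0" "\<forall>x\<in>f ` {0..T}. norm x \<le> C"
    using compact_imp_bounded bounded_pos by blast
  have "norm (f x) \<le> C" for x
  proof -
    obtain t where "t \<in> {0..<T}" "norm (f x) = norm (f t)"
      using periodic_representative[of "\<lambda>x. norm (f x)" T x] assms by blast
    then show ?thesis using C(2) by auto
  qed
  then show ?thesis using that C by blast
qed

lemma has_vector_derivative_shift:
  fixes f :: "real \<Rightarrow> 'a::real_normed_vector"
  assumes "(f has_vector_derivative f') (at (x + c))"
  shows "((\<lambda>x. f (x + c)) has_vector_derivative f') (at x)"
proof -
  have "((\<lambda>x. x + c) has_vector_derivative 1) (at x)"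
    by (auto intro!: derivative_eq_intros)
  from vector_diff_chain_at[OF this, of f f'] assms show ?thesis by (simp add: o_def)
qed

lemma vector_derivative_continuous_on:
  fixes f :: "real \<Rightarrow> 'a::real_normed_vector"
  assumes "\<And>x. (f has_vector_derivative f' x) (at x)"
  shows "continuous_on S f"
  using assms by (meson continuous_at_imp_continuous_on has_vector_derivative_continuous)

text \<open>The Fredholm alternative: the map taking an initial value to the sum of the initial value
  and the value one period later is injective, hence invertible.\<close>

theorem antiperiodic_solution_exists:
  fixes M :: "real \<Rightarrow> 'a::euclidean_space \<Rightarrow> 'a"
  assumes lin: "\<And>x. linear (M x)" and bnd: "\<And>x y. norm (M x y) \<le> K * norm y" and K: "K > 0"
    and cont: "\<And>y. continuous_on UNIV y \<Longrightarrow> continuous_on UNIV (\<lambda>x. M x (y x))"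
    and per: "\<And>x. M (x + P) = M x" and P: "P > 0"
    and noker: "\<And>y. (\<And>x. (y has_vector_derivative M x (y x)) (at x)) \<Longrightarrow>
      (\<And>x. y (x + P) = - y x) \<Longrightarrow> y 0 = 0"
  shows "\<exists>C>0. \<forall>F. continuous_on UNIV F \<longrightarrow> (\<forall>x. F (x + P) = - F x) \<longrightarrow>
    (\<exists>y. (\<forall>x. (y has_vector_derivative M x (y x) + F x) (at x)) \<and> (\<forall>x. y (x + P) = - y x) \<and>
      (\<forall>x\<in>{0..P}. (norm (y x))\<^sup>2 \<le> C * integral {0..P} (\<lambda>t. (norm (F t))\<^sup>2)))"
proof -
  have ex: "\<exists>y. y 0 = z \<and> (\<forall>x. (y has_vector_derivative M x (y x) + F x) (at x))"
    if F: "continuous_on UNIV F" and FP: "\<forall>x. F (x + P) = - F x" for z F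
  proof -
    obtain C where C: "\<And>x. norm (F x) \<le> C"
      by (rule periodic_bounded[of F P]) (use F FP P in auto)
    show ?thesis
    proof (rule global_lipschitz_solution[where G = "\<lambda>x y. M x y + F x", OF K])
      show "norm (M x y + F x - (M x w + F x)) \<le> K * norm (y - w)" for x y w
        using bnd[of x "y - w"] linear_diff[OF lin] by simp
      show "norm (M x 0 + F x) \<le> C" for x
        using C linear_0[OF lin] by simp
      show "continuous_on UNIV (\<lambda>x. M x (y x) + F x)" if "continuous_on UNIV y" for y
        by (rule continuous_on_add[OF cont[OF that] F])
    qed
  qed
  have unique: "y1 x = y2 x"
    if "\<And>x. (y1 has_vector_derivative M x (y1 x) + F x) (at x)"
      "\<And>x. (y2 has_vector_derivative M x (y2 x) + F x) (at x)" "y1 0 = y2 0" for y1 y2 F x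
  proof -
    have "y1 x - y2 x = 0"
    proof (rule vanishing_of_linear_growth[of "\<lambda>x. y1 x - y2 x" "\<lambda>x. M x (y1 x - y2 x)" K 0 x])
      show "((\<lambda>x. y1 x - y2 x) has_vector_derivative M x (y1 x - y2 x)) (at x)" for x
        using has_vector_derivative_diff[OF that(1,2)] linear_diff[OF lin] by simp
    qed (simp_all add: bnd that(3))
    then show ?thesis by simp
  qed
  have anti: "y (x + P) = - y x"
    if y: "\<And>x. (y has_vector_derivative M x (y x) + F x) (at x)" and "y P = - y 0"
      and FP: "\<And>x. F (x + P) = - F x" for y F x
  proof -
    have "- y (x + P) = y x"
    proof (rule unique[of "\<lambda>x. - y (x + P)" F])
      show "((\<lambda>x. - y (x + P)) has_vector_derivative M x (- y (x + P)) + F x) (at x)" for x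
      proof -
        have "- (M (x + P) (y (x + P)) + F (x + P)) = M x (- y (x + P)) + F x"
          by (simp add: FP per linear_neg[OF lin])
        then show ?thesis
          using has_vector_derivative_minus[OF has_vector_derivative_shift[OF y, of P x]] by simp
      qed
    qed (use that(2) y in simp_all)
    then show ?thesis by (metis minus_minus)
  qed
  define sol where "sol z = (SOME y. y 0 = z \<and> (\<forall>x. (y has_vector_derivative M x (y x)) (at x)))" for z
  have sol: "sol z 0 = z" "\<And>x. (sol z has_vector_derivative M x (sol z x)) (at x)" for z
    using someI_ex[OF ex[of "\<lambda>_. 0" z, simplified]] unfolding sol_def by auto
  define \<Phi> where "\<Phi> z = z + sol z P" for z
  have "linear \<Phi>"
  proof (rule linearI)
    fix z w
    have "sol (z + w) P = sol z P + sol w P"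
    proof (rule unique[of _ "\<lambda>_. 0"])
      show "((\<lambda>x. sol z x + sol w x) has_vector_derivative M x (sol z x + sol w x) + 0) (at x)" for x
        using has_vector_derivative_add[OF sol(2) sol(2)] linear_add[OF lin] by simp
    qed (use sol in auto)
    then show "\<Phi> (z + w) = \<Phi> z + \<Phi> w" by (simp add: \<Phi>_def)
  next
    fix r z
    have "sol (r *\<^sub>R z) P = r *\<^sub>R sol z P"
    proof (rule unique[of _ "\<lambda>_. 0"])
      have "((\<lambda>x. r *\<^sub>R sol z x) has_vector_derivative r *\<^sub>R M x (sol z x)) (at x)" for x
        using bounded_linear.has_vector_derivative[OF bounded_linear_scaleR_right sol(2)] by blast
      then show "((\<lambda>x. r *\<^sub>R sol z x) has_vector_derivative M x (r *\<^sub>R sol z x) + 0) (at x)" for x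
        using linear_scale[OF lin] by simp
    qed (use sol in auto)
    then show "\<Phi> (r *\<^sub>R z) = r *\<^sub>R \<Phi> z" by (simp add: \<Phi>_def scaleR_add_right)
  qed
  moreover have "inj \<Phi>"
  proof (subst linear_inj_iff_eq_0[OF \<open>linear \<Phi>\<close>], intro allI impI)
    fix z assume "\<Phi> z = 0"
    then have "sol z P = - sol z 0"
      by (simp add: \<Phi>_def sol eq_neg_iff_add_eq_0 add.commute)
    then have "sol z (x + P) = - sol z x" for x
      using anti[of "sol z" "\<lambda>_. 0" x] sol by simp
    then have "sol z 0 = 0" using noker sol by blast
    then show "z = 0" by (simp add: sol)
  qed
  \<comment> \<open>In finite dimension injectivity is quantitative. \<open>B\<close> controls the
    initial value by \<open>\<Phi> z\<close> and makes the final constant independent of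
    \<open>F\<close>.\<close>
  ultimately obtain B where B: "B > 0" "\<And>z. B * norm z \<le> norm (\<Phi> z)"
    using linear_inj_bounded_below_pos by blast
  have surj: "\<exists>z. \<Phi> z = w" for w
    using linear_injective_imp_surjective[OF \<open>linear \<Phi>\<close> \<open>inj \<Phi>\<close>] by (metis surjD)
  define E where "E = exp ((2 * K + 1) * P)"
  have E: "E > 0" by (simp add: E_def)
  show ?thesis
  proof (intro exI[of _ "E * (E / B\<^sup>2 + 1)"] conjI allI impI)
    show "E * (E / B\<^sup>2 + 1) > 0" using E B by (intro mult_pos_pos add_nonneg_pos) auto
    fix F :: "real \<Rightarrow> 'a"
    assume F: "continuous_on UNIV F" and FP: "\<forall>x. F (x + P) = - F x"
    define I where "I = integral {0..P} (\<lambda>t. (norm (F t))\<^sup>2)"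
    have growth: "(norm (y x))\<^sup>2 \<le> E * ((norm (y 0))\<^sup>2 + I)"
      if y: "\<And>x. (y has_vector_derivative M x (y x) + F x) (at x)" and x: "x \<in> {0..P}" for y x
    proof -
      have "(norm (y x))\<^sup>2 \<le> exp ((2 * K + 1) * x) * ((norm (y 0))\<^sup>2 + integral {0..x} (\<lambda>t. (norm (F t))\<^sup>2))"
      proof (rule square_norm_growth_bound[OF y])
        show "norm (M t (y t) + F t) \<le> K * norm (y t) + \<bar>norm (F t)\<bar>" for t
          using norm_triangle_ineq[of "M t (y t)" "F t"] bnd[of t "y t"] by simp
        show "continuous_on UNIV (\<lambda>x. norm (F x))" using F by (intro continuous_intros)
      qed (use K x in auto)
      also have "\<dots> \<le> E * ((norm (y 0))\<^sup>2 + I)"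
      proof (rule mult_mono)
        show "exp ((2 * K + 1) * x) \<le> E" using K x by (auto simp: E_def)
        have "integral {0..x} (\<lambda>t. (norm (F t))\<^sup>2) \<le> I"
          unfolding I_def using x
          by (intro integral_subset_le integrable_continuous_interval continuous_intros
              continuous_on_subset[OF F]) auto
        then show "(norm (y 0))\<^sup>2 + integral {0..x} (\<lambda>t. (norm (F t))\<^sup>2) \<le> (norm (y 0))\<^sup>2 + I" by simp
        show "0 \<le> (norm (y 0))\<^sup>2 + integral {0..x} (\<lambda>t. (norm (F t))\<^sup>2)"
          by (intro add_nonneg_nonneg Henstock_Kurzweil_Integration.integral_nonneg
              integrable_continuous_interval continuous_intros continuous_on_subset[OF F]) auto
      qed (use E in auto)
      finally show ?thesis .
    qed
    obtain yp where yp: "yp 0 = 0" "\<And>x. (yp has_vector_derivative M x (yp x) + F x) (at x)"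
      using ex[OF F FP] by blast
    \<comment> \<open>The homogeneous solution starting at \<open>z\<close> corrects the particular
      one: \<open>z + sol z P = - yp P\<close> says exactly that the sum of the two changes sign
      between \<open>0\<close> and \<open>P\<close>.\<close>
    obtain z where z: "\<Phi> z = - yp P" using surj by blast
    define y where "y x = sol z x + yp x" for x
    have y: "(y has_vector_derivative M x (y x) + F x) (at x)" for x
      unfolding y_def using has_vector_derivative_add[OF sol(2)[of z] yp(2)] linear_add[OF lin]
      by (simp add: algebra_simps)
    have "y 0 = z" by (simp add: y_def sol yp)
    have "y P = - y 0"
      using z by (simp add: y_def \<Phi>_def sol yp) (metis add.commute add_diff_cancel_left' diff_add_eq minus_diff_eq uminus_add_conv_diff add.inverse_inverse)
    have "B * norm z \<le> norm (yp P)" using B(2)[of z] z by simp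
    then have "(B * norm z)\<^sup>2 \<le> (norm (yp P))\<^sup>2" using B by (intro power_mono) auto
    also have "\<dots> \<le> E * I" using growth[OF yp(2), of P] P yp(1) by simp
    finally have zI: "(norm z)\<^sup>2 \<le> E / B\<^sup>2 * I"
      using B by (simp add: power_mult_distrib field_simps)
    show "\<exists>y. (\<forall>x. (y has_vector_derivative M x (y x) + F x) (at x)) \<and> (\<forall>x. y (x + P) = - y x) \<and>
      (\<forall>x\<in>{0..P}. (norm (y x))\<^sup>2 \<le> E * (E / B\<^sup>2 + 1) * integral {0..P} (\<lambda>t. (norm (F t))\<^sup>2))"
    proof (intro exI[of _ y] conjI allI ballI y)
      show "y (x + P) = - y x" for x
        using anti[OF y \<open>y P = - y 0\<close>] FP by blast
      fix x assume "x \<in> {0..P}"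
      from growth[OF y this] have "(norm (y x))\<^sup>2 \<le> E * ((norm z)\<^sup>2 + I)"
        by (simp add: \<open>y 0 = z\<close>)
      also have "\<dots> \<le> E * (E / B\<^sup>2 * I + I)"
        using zI E by (intro mult_left_mono) auto
      finally show "(norm (y x))\<^sup>2 \<le> E * (E / B\<^sup>2 + 1) * integral {0..P} (\<lambda>t. (norm (F t))\<^sup>2)"
        by (simp add: I_def algebra_simps)
    qed
  qed
qed

section \<open>The antiperiodic quadratic pencil\<close>

definition antiperiodic_C2 :: "real \<Rightarrow> (real \<Rightarrow> real) \<Rightarrow> (real \<Rightarrow> real) \<Rightarrow> (real \<Rightarrow> real) \<Rightarrow> bool" where
  "antiperiodic_C2 P A A1 A2 \<longleftrightarrow>
    (\<forall>x. (A has_real_derivative A1 x) (at x)) \<and> (\<forall>x. (A1 has_real_derivative A2 x) (at x)) \<and>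
    continuous_on UNIV A2 \<and> (\<forall>x. A (x + P) = - A x)"

lemma antiperiodic_derivative:
  assumes "\<And>x. (A has_real_derivative A1 x) (at x)" "\<And>x. A (x + P) = - A x"
  shows "A1 (x + P) = - A1 x"
proof -
  have "((\<lambda>x. A (x + P)) has_real_derivative A1 (x + P)) (at x)"
    using DERIV_shift assms(1) by blast
  moreover have "((\<lambda>x. A (x + P)) has_real_derivative - A1 x) (at x)"
    unfolding assms(2) by (intro derivative_intros assms)
  ultimately show ?thesis by (rule DERIV_unique)
qed

lemma antiperiodic_C2D:
  assumes "antiperiodic_C2 P A A1 A2"
  shows "(A has_real_derivative A1 x) (at x)" "(A1 has_real_derivative A2 x) (at x)"
    "A (x + P) = - A x" "A1 (x + P) = - A1 x" "A2 (x + P) = - A2 x"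
    "continuous_on S A" "continuous_on S A1" "continuous_on S A2"
proof -
  show 1: "(A has_real_derivative A1 x) (at x)" "(A1 has_real_derivative A2 x) (at x)"
    "A (x + P) = - A x" for x
    using assms by (auto simp: antiperiodic_C2_def)
  show 2: "A1 (x + P) = - A1 x" for x by (rule antiperiodic_derivative[OF 1(1,3)])
  show "A2 (x + P) = - A2 x" by (rule antiperiodic_derivative[OF 1(2) 2])
  show "continuous_on S A" "continuous_on S A1"
    using 1(1,2) by (meson DERIV_continuous_on has_field_derivative_at_within)+
  show "continuous_on S A2"
    using assms by (auto simp: antiperiodic_C2_def intro: continuous_on_subset)
qed

definition sq_int :: "real \<Rightarrow> (real \<Rightarrow> real) \<Rightarrow> real" where
  "sq_int P f = integral {0..P} (\<lambda>x. (f x)\<^sup>2)"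

definition base_form :: "real \<Rightarrow> real \<Rightarrow> (real \<Rightarrow> real) \<Rightarrow> (real \<Rightarrow> real) \<Rightarrow> (real \<Rightarrow> real) \<Rightarrow> real" where
  "base_form P e q A1 A2 = integral {0..P} (\<lambda>x. e * (A2 x)\<^sup>2 - q x * (A1 x)\<^sup>2)"

lemma sq_int_nonneg: "continuous_on {0..P} f \<Longrightarrow> 0 \<le> sq_int P f"
  unfolding sq_int_def
  by (intro Henstock_Kurzweil_Integration.integral_nonneg integrable_continuous_interval continuous_intros) auto

lemma has_integral_real_FTC:
  fixes F f :: "real \<Rightarrow> real"
  assumes "\<And>x. (F has_real_derivative f x) (at x)" "a \<le> b"
  shows "(f has_integral F b - F a) {a..b}"
  using assms
  by (intro fundamental_theorem_of_calculus)
     (auto simp: has_real_derivative_iff_has_vector_derivative[symmetric] intro: has_field_derivative_at_within)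

text \<open>Integration by parts replaces \<open>A1^2\<close> by \<open>- A A2\<close>; the boundary
  terms cancel because a product of two antiperiodic functions is periodic. Young's inequality with
  weight \<open>t\<close> then splits the product.\<close>

lemma antiperiodic_interpolation:
  assumes A: "antiperiodic_C2 P A A1 A2" and "P > 0" "t > 0"
  shows "sq_int P A1 \<le> (t * sq_int P A2 + sq_int P A / t) / 2"
proof -
  note D = antiperiodic_C2D[OF A]
  have "((\<lambda>x. (A1 x)\<^sup>2 + A x * A2 x) has_integral A P * A1 P - A 0 * A1 0) {0..P}"
    by (rule has_integral_real_FTC[of "\<lambda>x. A x * A1 x"])
       (use \<open>P > 0\<close> in \<open>auto intro!: derivative_eq_intros D simp: power2_eq_square\<close>)
  moreover have "A P * A1 P - A 0 * A1 0 = 0" using D(3,4)[of 0] by simp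
  ultimately have 1: "((\<lambda>x. (A1 x)\<^sup>2 + A x * A2 x) has_integral 0) {0..P}" by simp
  have sq: "((\<lambda>x. (f x)\<^sup>2) has_integral sq_int P f) {0..P}" if "continuous_on {0..P} f" for f
    unfolding sq_int_def using that
    by (intro integrable_integral integrable_continuous_interval continuous_intros)
  have "sq_int P A1 - 0 \<le> (t * sq_int P A2 + sq_int P A / t) / 2"
  proof (rule has_integral_le)
    show "((\<lambda>x. (A1 x)\<^sup>2 - ((A1 x)\<^sup>2 + A x * A2 x)) has_integral sq_int P A1 - 0) {0..P}"
      by (intro has_integral_diff sq D 1)
    show "((\<lambda>x. (t * (A2 x)\<^sup>2 + (A x)\<^sup>2 / t) / 2) has_integral (t * sq_int P A2 + sq_int P A / t) / 2) {0..P}"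
      by (intro has_integral_divide has_integral_add has_integral_mult_right sq D)
    show "(A1 x)\<^sup>2 - ((A1 x)\<^sup>2 + A x * A2 x) \<le> (t * (A2 x)\<^sup>2 + (A x)\<^sup>2 / t) / 2" for x
    proof -
      have "0 \<le> (t * A2 x + A x)\<^sup>2 / t" using \<open>t > 0\<close> by simp
      also have "(t * A2 x + A x)\<^sup>2 / t = t * (A2 x)\<^sup>2 + (A x)\<^sup>2 / t + 2 * A x * A2 x"
        using \<open>t > 0\<close> by (simp add: field_simps power2_eq_square)
      finally show ?thesis by simp
    qed
  qed
  then show ?thesis by simp
qed

text \<open>The symmetric form of the quadratic pencil \<open>l\<^sup>2 A - l k A'' + (e A''' + q A')'\<close>.\<close>

definition pencil_form ::
    "real \<Rightarrow> real \<Rightarrow> real \<Rightarrow> (real \<Rightarrow> real) \<Rightarrow> real \<Rightarrow> (real \<Rightarrow> real) \<Rightarrow> (real \<Rightarrow> real) \<Rightarrow> (real \<Rightarrow> real) \<Rightarrow> real" where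
  "pencil_form P e k q l A A1 A2 = base_form P e q A1 A2 + l * k * sq_int P A1 + l\<^sup>2 * sq_int P A"

lemma pencil_form_has_integral:
  assumes "continuous_on {0..P} q" "antiperiodic_C2 P A A1 A2"
  shows "((\<lambda>x. e * (A2 x)\<^sup>2 + (l * k - q x) * (A1 x)\<^sup>2 + l\<^sup>2 * (A x)\<^sup>2) has_integral
    pencil_form P e k q l A A1 A2) {0..P}"
proof -
  note D = antiperiodic_C2D[OF assms(2)]
  have sq: "((\<lambda>x. (f x)\<^sup>2) has_integral sq_int P f) {0..P}" if "continuous_on {0..P} f" for f
    unfolding sq_int_def using that
    by (intro integrable_integral integrable_continuous_interval continuous_intros)
  have b: "((\<lambda>x. e * (A2 x)\<^sup>2 - q x * (A1 x)\<^sup>2) has_integral base_form P e q A1 A2) {0..P}"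
    unfolding base_form_def
    by (intro integrable_integral integrable_continuous_interval continuous_intros D assms)
  have "((\<lambda>x. (e * (A2 x)\<^sup>2 - q x * (A1 x)\<^sup>2) + l * k * (A1 x)\<^sup>2 + l\<^sup>2 * (A x)\<^sup>2) has_integral
    pencil_form P e k q l A A1 A2) {0..P}"
    unfolding pencil_form_def
    by (intro has_integral_add has_integral_mult_right sq b D)
  then show ?thesis by (simp add: algebra_simps)
qed

text \<open>First-order form of \<open>e u'''' + (q u')' - l k u'' + l^2 u = f\<close>, with the
  quasi-derivative \<open>Y = e u''' + q u'\<close> as last unknown.\<close>

definition antiperiodic_pencil_solution ::
    "real \<Rightarrow> real \<Rightarrow> real \<Rightarrow> (real \<Rightarrow> real) \<Rightarrow> real \<Rightarrow> (real \<Rightarrow> real) \<Rightarrow>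
      (real \<Rightarrow> real) \<Rightarrow> (real \<Rightarrow> real) \<Rightarrow> (real \<Rightarrow> real) \<Rightarrow> (real \<Rightarrow> real) \<Rightarrow> bool" where
  "antiperiodic_pencil_solution P e k q l f u u1 u2 Y \<longleftrightarrow>
    (\<forall>x. (u has_real_derivative u1 x) (at x) \<and> (u1 has_real_derivative u2 x) (at x) \<and>
      (u2 has_real_derivative (Y x - q x * u1 x) / e) (at x) \<and>
      (Y has_real_derivative l * k * u2 x - l\<^sup>2 * u x + f x) (at x) \<and>
      u (x + P) = - u x \<and> Y (x + P) = - Y x)"

text \<open>The weak form of the equation. \<open>\<Psi>\<close> collects the boundary terms of the
  integrations by parts; each of them is a product of two antiperiodic functions, so
  \<open>\<Psi>\<close> takes the same value at \<open>0\<close> and \<open>P\<close>.\<close>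

lemma pencil_weak_identity:
  assumes sol: "antiperiodic_pencil_solution P e k q l f u u1 u2 Y"
    and h: "antiperiodic_C2 P h h1 h2" and "e > 0" "P > 0"
    and int: "((\<lambda>x. f x * h x) has_integral I) {0..P}"
  shows "((\<lambda>x. e * (u2 x * h2 x) + (l * k - q x) * (u1 x * h1 x) + l\<^sup>2 * (u x * h x)) has_integral I) {0..P}"
proof -
  have u: "(u has_real_derivative u1 x) (at x)" "(u1 has_real_derivative u2 x) (at x)"
      "(u2 has_real_derivative (Y x - q x * u1 x) / e) (at x)"
      "(Y has_real_derivative l * k * u2 x - l\<^sup>2 * u x + f x) (at x)"
    and anti: "u (x + P) = - u x" "Y (x + P) = - Y x" for x
    using sol by (auto simp: antiperiodic_pencil_solution_def)
  note D = antiperiodic_C2D[OF h]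
  define \<Psi> where "\<Psi> x = e * u2 x * h1 x - Y x * h x + l * k * u1 x * h x" for x
  define g where "g x = e * (u2 x * h2 x) + (l * k - q x) * (u1 x * h1 x) + l\<^sup>2 * (u x * h x)" for x
  have "(\<Psi> has_real_derivative g x - f x * h x) (at x)" for x
    unfolding \<Psi>_def g_def using \<open>e > 0\<close>
    by (auto intro!: derivative_eq_intros u D simp: field_simps)
  then have "((\<lambda>x. g x - f x * h x) has_integral \<Psi> P - \<Psi> 0) {0..P}"
    using has_integral_real_FTC \<open>P > 0\<close> by simp
  moreover have "\<Psi> P - \<Psi> 0 = 0"
  proof -
    have a1: "u1 (x + P) = - u1 x" for x by (rule antiperiodic_derivative[OF u(1) anti(1)])
    have a2: "u2 (x + P) = - u2 x" for x by (rule antiperiodic_derivative[OF u(2) a1])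
    show ?thesis unfolding \<Psi>_def
      using anti(2)[of 0] a1[of 0] a2[of 0] D(3,4)[of 0] by simp
  qed
  ultimately have "((\<lambda>x. (g x - f x * h x) + f x * h x) has_integral 0 + I) {0..P}"
    using int by (intro has_integral_add) auto
  then show ?thesis by (simp add: g_def)
qed

lemma norm_prod4_le: "norm (a::real, b::real, c::real, d::real) \<le> \<bar>a\<bar> + \<bar>b\<bar> + \<bar>c\<bar> + \<bar>d\<bar>"
  using norm_Pair_le[of a "(b, c, d)"] norm_Pair_le[of b "(c, d)"] norm_Pair_le[of c d] by simp

lemma prod4_le_norm:
  "\<bar>a\<bar> \<le> norm (a::real, b::real, c::real, d::real)" "\<bar>b\<bar> \<le> norm (a, b, c, d)"
  "\<bar>c\<bar> \<le> norm (a, b, c, d)" "\<bar>d\<bar> \<le> norm (a, b, c, d)"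
proof -
  show "\<bar>a\<bar> \<le> norm (a, b, c, d)" by (metis norm_fst_le real_norm_def)
  have 1: "norm (b, c, d) \<le> norm (a, b, c, d)" by (rule norm_snd_le)
  have 2: "norm (c, d) \<le> norm (b, c, d)" by (rule norm_snd_le)
  have "\<bar>b\<bar> \<le> norm (b, c, d)" by (metis norm_fst_le real_norm_def)
  with 1 show "\<bar>b\<bar> \<le> norm (a, b, c, d)" by simp
  have "\<bar>c\<bar> \<le> norm (c, d)" "\<bar>d\<bar> \<le> norm (c, d)"
    by (metis norm_fst_le real_norm_def, metis norm_snd_le real_norm_def)
  with 1 2 show "\<bar>c\<bar> \<le> norm (a, b, c, d)" "\<bar>d\<bar> \<le> norm (a, b, c, d)" by linarith+
qed

text \<open>The fourth-order equation as a first-order system for \<open>(A, A', A'', e A''' + q A')\<close>; with the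
  quasi-derivative as last component, \<open>q\<close> need not be differentiable.\<close>

lemma pencil_antiperiodic_solution:
  fixes q :: "real \<Rightarrow> real"
  assumes e: "e > 0" and P: "P > 0" and q: "continuous_on UNIV q" "\<And>x. q (x + P) = q x"
    and noker: "\<forall>A A1 A2 Y. antiperiodic_pencil_solution P e k q l (\<lambda>_. 0) A A1 A2 Y \<longrightarrow> (\<forall>x. A x = 0)"
  shows "\<exists>C>0. \<forall>f. continuous_on UNIV f \<longrightarrow> (\<forall>x. f (x + P) = - f x) \<longrightarrow>
    (\<exists>u u1 u2 Y. antiperiodic_pencil_solution P e k q l f u u1 u2 Y \<and>
      (\<forall>x\<in>{0..P}. (u x)\<^sup>2 \<le> C * sq_int P f))"
proof -
  define M where "M x Z = (fst (snd Z), fst (snd (snd Z)),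
    (snd (snd (snd Z)) - q x * fst (snd Z)) / e, l * k * fst (snd (snd Z)) - l\<^sup>2 * fst Z)"
    for x and Z :: "real \<times> real \<times> real \<times> real"
  obtain Q where Q: "Q > 0" "\<And>x. \<bar>q x\<bar> \<le> Q"
    using periodic_bounded[of q P] q P by (metis real_norm_def)
  define K where "K = 2 + (1 + Q) / e + \<bar>l * k\<bar> + l\<^sup>2"
  have comp: "((\<lambda>x. fst (z x)) has_real_derivative fst z') (at x)"
      "((\<lambda>x. fst (snd (z x))) has_real_derivative fst (snd z')) (at x)"
      "((\<lambda>x. fst (snd (snd (z x)))) has_real_derivative fst (snd (snd z'))) (at x)"
      "((\<lambda>x. snd (snd (snd (z x)))) has_real_derivative snd (snd (snd z'))) (at x)"
    if "(z has_vector_derivative z') (at x)" for z z' and x :: real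
    using that unfolding has_real_derivative_iff_has_vector_derivative
    by (auto intro!: bounded_linear.has_vector_derivative[OF bounded_linear_fst]
        bounded_linear.has_vector_derivative[OF bounded_linear_snd])
  have "\<exists>C>0. \<forall>F. continuous_on UNIV F \<longrightarrow> (\<forall>x. F (x + P) = - F x) \<longrightarrow>
    (\<exists>y. (\<forall>x. (y has_vector_derivative M x (y x) + F x) (at x)) \<and> (\<forall>x. y (x + P) = - y x) \<and>
      (\<forall>x\<in>{0..P}. (norm (y x))\<^sup>2 \<le> C * integral {0..P} (\<lambda>t. (norm (F t))\<^sup>2)))"
  proof (rule antiperiodic_solution_exists)
    show "linear (M x)" for x
      unfolding M_def by (rule linearI) (auto simp: algebra_simps add_divide_distrib diff_divide_distrib)
    show "K > 0" unfolding K_def using e Q by (intro add_pos_nonneg) auto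
    show "norm (M x y) \<le> K * norm y" for x y
    proof -
      obtain a b c d where y: "y = (a, b, c, d)" by (metis prod.exhaust)
      let ?n = "norm y"
      have "\<bar>d - q x * b\<bar> \<le> \<bar>d\<bar> + \<bar>q x\<bar> * \<bar>b\<bar>"
        by (metis abs_mult abs_triangle_ineq4)
      also have "\<dots> \<le> ?n + Q * ?n"
        using prod4_le_norm[where a=a and b=b and c=c and d=d] Q by (auto simp: y intro!: add_mono mult_mono)
      finally have 1: "\<bar>(d - q x * b) / e\<bar> \<le> (1 + Q) / e * ?n"
        using e by (simp add: abs_divide field_simps)
      have "\<bar>l * k * c - l\<^sup>2 * a\<bar> \<le> \<bar>l * k\<bar> * \<bar>c\<bar> + l\<^sup>2 * \<bar>a\<bar>"
        using abs_triangle_ineq4[of "l * k * c" "l\<^sup>2 * a"] by (simp add: abs_mult)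
      also have "\<dots> \<le> \<bar>l * k\<bar> * ?n + l\<^sup>2 * ?n"
        using prod4_le_norm[where a=a and b=b and c=c and d=d] by (auto simp: y intro!: add_mono mult_mono)
      finally have 2: "\<bar>l * k * c - l\<^sup>2 * a\<bar> \<le> \<bar>l * k\<bar> * ?n + l\<^sup>2 * ?n" .
      have "norm (M x y) \<le> \<bar>b\<bar> + \<bar>c\<bar> + \<bar>(d - q x * b) / e\<bar> + \<bar>l * k * c - l\<^sup>2 * a\<bar>"
        unfolding M_def y fst_conv snd_conv by (rule norm_prod4_le)
      also have "\<dots> \<le> ?n + ?n + (1 + Q) / e * ?n + (\<bar>l * k\<bar> * ?n + l\<^sup>2 * ?n)"
        using 1 2 prod4_le_norm[where a=a and b=b and c=c and d=d] by (intro add_mono) (auto simp: y)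
      also have "\<dots> = K * ?n" by (simp add: K_def algebra_simps)
      finally show ?thesis .
    qed
    show "continuous_on UNIV (\<lambda>x. M x (y x))" if "continuous_on UNIV y" for y
      unfolding M_def using that e by (intro continuous_intros q(1)) auto
    show "M (x + P) = M x" for x
      by (auto simp: M_def fun_eq_iff q)
    \<comment> \<open>The kernel hypothesis speaks of the first component only; the equations of the
      system make the other three vanish in turn.\<close>
    show "y 0 = 0" if y: "\<And>x. (y has_vector_derivative M x (y x)) (at x)" "\<And>x. y (x + P) = - y x" for y
    proof -
      let ?A = "\<lambda>x. fst (y x)" and ?A1 = "\<lambda>x. fst (snd (y x))" and ?A2 = "\<lambda>x. fst (snd (snd (y x)))"
        and ?Y = "\<lambda>x. snd (snd (snd (y x)))"
      note c = comp[OF y(1), unfolded M_def fst_conv snd_conv]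
      have "antiperiodic_pencil_solution P e k q l (\<lambda>_. 0) ?A ?A1 ?A2 ?Y"
        unfolding antiperiodic_pencil_solution_def using c y(2) by simp
      then have A: "?A x = 0" for x using noker by blast
      have A1: "?A1 x = 0" for x
        using c(1)[of x] unfolding A by (metis DERIV_const DERIV_unique)
      have A2: "?A2 x = 0" for x
        using c(2)[of x] unfolding A1 by (metis DERIV_const DERIV_unique)
      have "(?Y x - q x * ?A1 x) / e = 0" for x
        using c(3)[of x] unfolding A2 by (metis DERIV_const DERIV_unique)
      then have "?Y x = 0" for x using A1 e by simp
      with A A1 A2 show ?thesis by (simp add: prod_eq_iff)
    qed
  qed fact
  then obtain C where C: "C > 0" and sol: "\<And>F. continuous_on UNIV F \<Longrightarrow> (\<And>x. F (x + P) = - F x) \<Longrightarrow>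
    (\<exists>y. (\<forall>x. (y has_vector_derivative M x (y x) + F x) (at x)) \<and> (\<forall>x. y (x + P) = - y x) \<and>
      (\<forall>x\<in>{0..P}. (norm (y x))\<^sup>2 \<le> C * integral {0..P} (\<lambda>t. (norm (F t))\<^sup>2)))"
    by blast
  show ?thesis
  proof (intro exI[of _ C] conjI allI impI C)
    fix f :: "real \<Rightarrow> real" assume f: "continuous_on UNIV f" "\<forall>x. f (x + P) = - f x"
    have F: "continuous_on UNIV (\<lambda>x. (0::real, 0::real, 0::real, f x))"
      by (intro continuous_intros f)
    have FP: "(0::real, 0::real, 0::real, f (x + P)) = - (0, 0, 0, f x)" for x
      using f(2) by simp
    obtain y where y: "\<And>x. (y has_vector_derivative M x (y x) + (0, 0, 0, f x)) (at x)"
      and anti: "\<And>x. y (x + P) = - y x"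
      and bd: "\<And>x. x \<in> {0..P} \<Longrightarrow> (norm (y x))\<^sup>2 \<le> C * integral {0..P} (\<lambda>t. (norm (0::real, 0::real, 0::real, f t))\<^sup>2)"
      using sol[OF F FP] by blast
    note c = comp[OF y, unfolded M_def fst_conv snd_conv fst_add snd_add add_0_right]
    show "\<exists>u u1 u2 Y. antiperiodic_pencil_solution P e k q l f u u1 u2 Y \<and>
      (\<forall>x\<in>{0..P}. (u x)\<^sup>2 \<le> C * sq_int P f)"
    proof (rule exI[of _ "\<lambda>x. fst (y x)"], rule exI[of _ "\<lambda>x. fst (snd (y x))"],
        rule exI[of _ "\<lambda>x. fst (snd (snd (y x)))"], rule exI[of _ "\<lambda>x. snd (snd (snd (y x)))"],
        intro conjI ballI)
      show "antiperiodic_pencil_solution P e k q l f (\<lambda>x. fst (y x)) (\<lambda>x. fst (snd (y x)))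
        (\<lambda>x. fst (snd (snd (y x)))) (\<lambda>x. snd (snd (snd (y x))))"
        unfolding antiperiodic_pencil_solution_def using c anti by simp
      fix x assume "x \<in> {0..P}"
      have "(fst (y x))\<^sup>2 \<le> (norm (y x))\<^sup>2"
        using norm_fst_le[of "fst (y x)" "snd (y x)"] by (simp add: abs_le_square_iff[symmetric])
      also have "\<dots> \<le> C * sq_int P f"
        using bd[OF \<open>x \<in> {0..P}\<close>] by (simp add: sq_int_def norm_Pair)
      finally show "(fst (y x))\<^sup>2 \<le> C * sq_int P f" .
    qed
  qed
qed

text \<open>If \<open>u\<close> solves the equation with right-hand side \<open>f\<close>, the form
  at \<open>f - c u\<close> expands to the form at \<open>f\<close>, minus \<open>2 c |f|^2\<close>,
  plus \<open>c^2 <f, u>\<close>. This is non-negative, and \<open><f, u>\<close> is bounded by a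
  multiple of \<open>|f|^2\<close>, so a small \<open>c\<close> leaves a positive multiple of
  \<open>|f|^2\<close> below the form at \<open>f\<close>.\<close>

lemma pencil_form_coercive:
  fixes q :: "real \<Rightarrow> real"
  assumes e: "e > 0" and P: "P > 0" and q: "continuous_on UNIV q" "\<And>x. q (x + P) = q x"
    and nonneg: "\<And>A A1 A2. antiperiodic_C2 P A A1 A2 \<Longrightarrow> 0 \<le> pencil_form P e k q l A A1 A2"
    and noker: "\<forall>A A1 A2 Y. antiperiodic_pencil_solution P e k q l (\<lambda>_. 0) A A1 A2 Y \<longrightarrow> (\<forall>x. A x = 0)"
  obtains c where "c > 0"
    "\<And>A A1 A2. antiperiodic_C2 P A A1 A2 \<Longrightarrow> c * sq_int P A \<le> pencil_form P e k q l A A1 A2"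
proof -
  obtain C where C: "C > 0" and sol: "\<And>f. continuous_on UNIV f \<Longrightarrow> (\<And>x. f (x + P) = - f x) \<Longrightarrow>
    (\<exists>u u1 u2 Y. antiperiodic_pencil_solution P e k q l f u u1 u2 Y \<and> (\<forall>x\<in>{0..P}. (u x)\<^sup>2 \<le> C * sq_int P f))"
    using pencil_antiperiodic_solution[OF e P q noker] by blast
  \<comment> \<open>Here \<open><f, u> <= (1 + C P) / 2 * |f|^2\<close>. With this \<open>c\<close>
    the quadratic term is at most \<open>c |f|^2\<close>, and \<open>c |f|^2\<close> remains of the
    linear term \<open>2 c |f|^2\<close>.\<close>
  define c where "c = 1 / ((1 + C * P) / 2)"
  have c: "c > 0" unfolding c_def using C P by (intro divide_pos_pos add_pos_pos) auto
  have "c * sq_int P f \<le> pencil_form P e k q l f f1 f2" if f: "antiperiodic_C2 P f f1 f2" for f f1 f2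
  proof -
    note D = antiperiodic_C2D[OF f]
    obtain u u1 u2 Y where u: "antiperiodic_pencil_solution P e k q l f u u1 u2 Y"
      and bd: "\<And>x. x \<in> {0..P} \<Longrightarrow> (u x)\<^sup>2 \<le> C * sq_int P f"
      using sol[OF D(6) D(3)] by blast
    have U: "antiperiodic_C2 P u u1 u2"
    proof -
      have "(u2 has_real_derivative (Y x - q x * u1 x) / e) (at x)" for x
        using u by (simp add: antiperiodic_pencil_solution_def)
      from differentiable_real_continuous_on[OF this] u show ?thesis
        unfolding antiperiodic_C2_def antiperiodic_pencil_solution_def by blast
    qed
    note U' = antiperiodic_C2D[OF U]
    let ?I = "integral {0..P} (\<lambda>x. f x * u x)"
    have fu: "((\<lambda>x. f x * u x) has_integral ?I) {0..P}"
      by (intro integrable_integral integrable_continuous_interval continuous_intros D U')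
    have ff: "((\<lambda>x. f x * f x) has_integral sq_int P f) {0..P}"
      unfolding sq_int_def power2_eq_square
      by (intro integrable_integral integrable_continuous_interval continuous_intros D)
    note B1 = pencil_weak_identity[OF u f e P ff]
    note B2 = pencil_weak_identity[OF u U e P fu]
    have B3: "((\<lambda>x. e * (f2 x)\<^sup>2 + (l * k - q x) * (f1 x)\<^sup>2 + l\<^sup>2 * (f x)\<^sup>2) has_integral
      pencil_form P e k q l f f1 f2) {0..P}"
      by (rule pencil_form_has_integral[OF continuous_on_subset[OF q(1)] f]) simp
    have W: "antiperiodic_C2 P (\<lambda>x. f x - c * u x) (\<lambda>x. f1 x - c * u1 x) (\<lambda>x. f2 x - c * u2 x)"
      unfolding antiperiodic_C2_def
      by (auto intro!: derivative_eq_intros continuous_intros D U' simp: D(3) U'(3) right_diff_distrib)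
    have "0 \<le> pencil_form P e k q l f f1 f2 - 2 * c * sq_int P f + c\<^sup>2 * ?I"
    proof -
      have "((\<lambda>x. (e * (f2 x)\<^sup>2 + (l * k - q x) * (f1 x)\<^sup>2 + l\<^sup>2 * (f x)\<^sup>2)
        - 2 * c * (e * (u2 x * f2 x) + (l * k - q x) * (u1 x * f1 x) + l\<^sup>2 * (u x * f x))
        + c\<^sup>2 * (e * (u2 x * u2 x) + (l * k - q x) * (u1 x * u1 x) + l\<^sup>2 * (u x * u x))) has_integral
        pencil_form P e k q l f f1 f2 - 2 * c * sq_int P f + c\<^sup>2 * ?I) {0..P}"
        by (intro has_integral_add has_integral_diff has_integral_mult_right B1 B2 B3)
      moreover have "((\<lambda>x. (e * (f2 x)\<^sup>2 + (l * k - q x) * (f1 x)\<^sup>2 + l\<^sup>2 * (f x)\<^sup>2)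
        - 2 * c * (e * (u2 x * f2 x) + (l * k - q x) * (u1 x * f1 x) + l\<^sup>2 * (u x * f x))
        + c\<^sup>2 * (e * (u2 x * u2 x) + (l * k - q x) * (u1 x * u1 x) + l\<^sup>2 * (u x * u x))) has_integral
        pencil_form P e k q l (\<lambda>x. f x - c * u x) (\<lambda>x. f1 x - c * u1 x) (\<lambda>x. f2 x - c * u2 x)) {0..P}"
        by (rule has_integral_eq[OF _ pencil_form_has_integral[OF continuous_on_subset[OF q(1)] W]])
           (auto simp: algebra_simps power2_eq_square)
      ultimately show ?thesis
        using nonneg[OF W] by (subst has_integral_unique)
    qed
    moreover have "?I \<le> (1 + C * P) / 2 * sq_int P f"
    proof (rule has_integral_le[OF fu])
      have "((\<lambda>x. (f x * f x + C * sq_int P f) / 2) has_integral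
        (sq_int P f + (P - 0) * (C * sq_int P f)) / 2) {0..P}"
        using P has_integral_const_real[of "C * sq_int P f" 0 P]
        by (intro has_integral_divide has_integral_add ff) auto
      then show "((\<lambda>x. (f x * f x + C * sq_int P f) / 2) has_integral
        (1 + C * P) / 2 * sq_int P f) {0..P}"
        by (simp add: field_simps)
      fix x assume "x \<in> {0..P}"
      have "2 * (f x * u x) \<le> (f x)\<^sup>2 + (u x)\<^sup>2"
        using zero_le_power2[of "f x - u x"] by (simp add: power2_diff)
      with bd[OF \<open>x \<in> {0..P}\<close>] show "f x * u x \<le> (f x * f x + C * sq_int P f) / 2"
        by (simp add: power2_eq_square)
    qed
    then have "c\<^sup>2 * ?I \<le> c\<^sup>2 * ((1 + C * P) / 2 * sq_int P f)"
      by (intro mult_left_mono) auto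
    moreover have "c\<^sup>2 * ((1 + C * P) / 2 * sq_int P f) = c * sq_int P f"
    proof -
      have "(1 + C * P) / 2 \<noteq> 0" using C P by (simp add: add_pos_pos less_imp_neq[symmetric])
      then have "c * ((1 + C * P) / 2) = 1" by (simp only: c_def) simp
      then show ?thesis by (metis (no_types, opaque_lifting) mult.assoc mult.right_neutral power2_eq_square)
    qed
    ultimately show ?thesis by linarith
  qed
  with c that show ?thesis by blast
qed

text \<open>Lowering \<open>l\<close> costs a multiple of \<open>sq_int P A1\<close>, which
  coercivity in \<open>A\<close> alone does not bound. The form bounds
  \<open>e * sq_int P A2\<close> up to \<open>Q * sq_int P A1\<close>; interpolation with
  \<open>t = e / Q\<close> then returns only half of \<open>sq_int P A1\<close>, which is absorbed
  on the left.\<close>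

lemma pencil_form_controls_derivative:
  assumes e: "e > 0" and P: "P > 0" and q: "continuous_on UNIV q" "\<And>x. q x \<le> Q" and "Q > 0"
    and A: "antiperiodic_C2 P A A1 A2" and l: "0 \<le> l * k"
  shows "sq_int P A1 \<le> pencil_form P e k q l A A1 A2 / Q + Q / e * sq_int P A"
proof -
  note D = antiperiodic_C2D[OF A]
  have I: "0 \<le> sq_int P A" "0 \<le> sq_int P A1"
    by (intro sq_int_nonneg D)+
  have sq: "((\<lambda>x. (f x)\<^sup>2) has_integral sq_int P f) {0..P}" if "continuous_on {0..P} f" for f
    unfolding sq_int_def using that
    by (intro integrable_integral integrable_continuous_interval continuous_intros)
  have "e * sq_int P A2 - Q * sq_int P A1 \<le> base_form P e q A1 A2"
  proof (rule has_integral_le)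
    show "((\<lambda>x. e * (A2 x)\<^sup>2 - Q * (A1 x)\<^sup>2) has_integral e * sq_int P A2 - Q * sq_int P A1) {0..P}"
      by (intro has_integral_diff has_integral_mult_right sq D)
    show "((\<lambda>x. e * (A2 x)\<^sup>2 - q x * (A1 x)\<^sup>2) has_integral base_form P e q A1 A2) {0..P}"
      unfolding base_form_def
      by (intro integrable_integral integrable_continuous_interval continuous_intros D
          continuous_on_subset[OF q(1)]) auto
    show "e * (A2 x)\<^sup>2 - Q * (A1 x)\<^sup>2 \<le> e * (A2 x)\<^sup>2 - q x * (A1 x)\<^sup>2" for x
      using q(2)[of x] by (simp add: mult_right_mono)
  qed
  moreover have "base_form P e q A1 A2 \<le> pencil_form P e k q l A A1 A2"
    unfolding pencil_form_def using I l by simp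
  ultimately have 1: "e * sq_int P A2 \<le> pencil_form P e k q l A A1 A2 + Q * sq_int P A1"
    by linarith
  have "sq_int P A1 \<le> (e / Q * sq_int P A2 + sq_int P A / (e / Q)) / 2"
    using e \<open>Q > 0\<close> by (intro antiperiodic_interpolation[OF A P]) auto
  also have "e / Q * sq_int P A2 \<le> (pencil_form P e k q l A A1 A2 + Q * sq_int P A1) / Q"
    using 1 \<open>Q > 0\<close> by (simp add: divide_right_mono)
  also have "\<dots> = pencil_form P e k q l A A1 A2 / Q + sq_int P A1"
    using \<open>Q > 0\<close> by (simp add: add_divide_distrib)
  finally have "sq_int P A1 \<le> (pencil_form P e k q l A A1 A2 / Q + sq_int P A1 + sq_int P A / (e / Q)) / 2"
    by (simp add: field_simps)
  then show ?thesis by (simp add: field_simps)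
qed

text \<open>At the infimum of the parameters \<open>l\<close> with non-negative form the form is still non-negative, so it
  would be coercive if the operator were invertible; the form would then remain non-negative for
  slightly smaller \<open>l\<close>.\<close>

theorem antiperiodic_eigenfunction_exists:
  fixes q :: "real \<Rightarrow> real"
  assumes e: "e > 0" and k: "k > 0" and P: "P > 0" and q: "continuous_on UNIV q" "\<And>x. q (x + P) = q x"
    and B: "antiperiodic_C2 P B B1 B2" and neg: "base_form P e q B1 B2 < 0"
  shows "\<exists>l>0. \<exists>A A1 A2 Y. antiperiodic_pencil_solution P e k q l (\<lambda>_. 0) A A1 A2 Y \<and> (\<exists>x. A x \<noteq> 0)"
proof (rule ccontr)
  assume contr: "\<not> ?thesis"
  let ?form = "pencil_form P e k q"
  note I0 = sq_int_nonneg[OF antiperiodic_C2D(6)] and I1 = sq_int_nonneg[OF antiperiodic_C2D(7)]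
  obtain Q where Q: "Q > 0" "\<And>x. q x \<le> Q"
    using periodic_bounded[of q P] q P by (metis abs_le_D1 real_norm_def)
  define S where "S = {l. l > 0 \<and> (\<forall>A A1 A2. antiperiodic_C2 P A A1 A2 \<longrightarrow> 0 \<le> ?form l A A1 A2)}"
  have mono: "?form l A A1 A2 \<le> ?form m A A1 A2"
    if "antiperiodic_C2 P A A1 A2" "0 \<le> l" "l \<le> m" for l m A A1 A2
    unfolding pencil_form_def using that k I0[OF that(1)] I1[OF that(1)]
    by (intro add_mono mult_right_mono power_mono) auto
  \<comment> \<open>At \<open>l = Q / k\<close> the coefficient \<open>l k - q\<close> is
    non-negative, so the integrand of the form is a sum of non-negative terms.\<close>
  have "Q / k \<in> S"
  proof -
    have "0 \<le> ?form (Q / k) A A1 A2" if A: "antiperiodic_C2 P A A1 A2" for A A1 A2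
    proof (rule has_integral_nonneg[OF pencil_form_has_integral[OF continuous_on_subset[OF q(1)] A]])
      show "0 \<le> e * (A2 x)\<^sup>2 + (Q / k * k - q x) * (A1 x)\<^sup>2 + (Q / k)\<^sup>2 * (A x)\<^sup>2" for x
        using e k Q by (intro add_nonneg_nonneg mult_nonneg_nonneg) auto
    qed simp
    then show ?thesis using Q k by (simp add: S_def)
  qed
  have cont: "((\<lambda>m. ?form m A A1 A2) \<longlongrightarrow> ?form l A A1 A2) (at l within T)" for l T A A1 A2
    unfolding pencil_form_def by (intro tendsto_intros)
  \<comment> \<open>The negative direction at \<open>l = 0\<close> persists for small positive
    \<open>l\<close> by continuity. Together with monotonicity in \<open>l\<close> this keeps the
    infimum of \<open>S\<close> away from \<open>0\<close>.\<close>
  obtain d where d: "d > 0" "?form d B B1 B2 < 0"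
  proof -
    have "?form 0 B B1 B2 < 0" using neg by (simp add: pencil_form_def)
    then have "\<forall>\<^sub>F m in at_right 0. ?form m B B1 B2 < 0"
      using order_tendstoD(2)[OF cont] by blast
    then have "\<forall>\<^sub>F m in at_right 0. m > 0 \<and> ?form m B B1 B2 < 0"
      using eventually_at_right_less by (rule eventually_elim2) auto
    from eventually_happens'[OF trivial_limit_at_right_real this] that show ?thesis
      by blast
  qed
  have lower: "d \<le> s" if "s \<in> S" for s
  proof (rule ccontr)
    assume "\<not> d \<le> s"
    with that mono[OF B, of s d] have "?form s B B1 B2 < 0" using d by (simp add: S_def)
    with that B show False by (force simp: S_def)
  qed
  define l where "l = Inf S"
  have bdd: "bdd_below S" using lower by (auto simp: bdd_below_def)
  have ld: "d \<le> l" unfolding l_def using lower \<open>Q / k \<in> S\<close> by (intro cInf_greatest) auto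
  have nonneg: "0 \<le> ?form l A A1 A2" if A: "antiperiodic_C2 P A A1 A2" for A A1 A2
  proof (rule tendsto_lowerbound[OF cont])
    have "0 \<le> ?form m A A1 A2" if "m > l" for m
    proof -
      obtain s where "s \<in> S" "s < m"
        using \<open>m > l\<close> \<open>Q / k \<in> S\<close> bdd unfolding l_def by (metis cInf_less_iff empty_iff)
      then show ?thesis using mono[OF A, of s m] A by (force simp: S_def)
    qed
    then show "\<forall>\<^sub>F m in at l within {l<..}. 0 \<le> ?form m A A1 A2"
      by (auto simp: eventually_at_filter)
  qed simp
  have "l > 0" using ld d by simp
  obtain c where c: "c > 0"
    "\<And>A A1 A2. antiperiodic_C2 P A A1 A2 \<Longrightarrow> c * sq_int P A \<le> ?form l A A1 A2"
    using pencil_form_coercive[OF e P q nonneg] contr \<open>l > 0\<close> by blast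
  \<comment> \<open>\<open>G\<close> times the form at \<open>l\<close> bounds
    \<open>sq_int P A1\<close>, by coercivity and the derivative estimate. The second entry of
    \<open>r\<close> is chosen so that lowering \<open>l\<close> by \<open>r\<close> costs at most
    the whole form at \<open>l\<close>.\<close>
  define G where "G = 1 / Q + Q / (e * c)"
  define r where "r = min (l / 2) (1 / (k * G + 2 * l / c))"
  have G: "G > 0" unfolding G_def using Q e c by (intro add_pos_pos) auto
  have den: "k * G + 2 * l / c > 0" using k G \<open>l > 0\<close> c by (intro add_pos_pos) auto
  have r: "r > 0" "r < l" "r * (k * G + 2 * l / c) \<le> 1"
  proof -
    show "r > 0" "r < l" unfolding r_def using \<open>l > 0\<close> den by auto
    have "r * (k * G + 2 * l / c) \<le> 1 / (k * G + 2 * l / c) * (k * G + 2 * l / c)"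
      unfolding r_def using den by (intro mult_right_mono) auto
    then show "r * (k * G + 2 * l / c) \<le> 1" using den by simp
  qed
  have "0 \<le> ?form (l - r) A A1 A2" if A: "antiperiodic_C2 P A A1 A2" for A A1 A2
  proof -
    let ?f = "?form l A A1 A2"
    have a0: "sq_int P A \<le> ?f / c" using c(2)[OF A] c(1) by (simp add: field_simps)
    have "sq_int P A1 \<le> ?f / Q + Q / e * sq_int P A"
      using pencil_form_controls_derivative[OF e P q(1) Q(2,1) A] k \<open>l > 0\<close> by simp
    also have "\<dots> \<le> ?f / Q + Q / e * (?f / c)"
      using a0 Q e by (intro add_left_mono mult_left_mono) auto
    also have "\<dots> = ?f * G" by (simp add: G_def field_simps)
    finally have a1: "sq_int P A1 \<le> ?f * G" .
    have "?form (l - r) A A1 A2 = ?f - r * k * sq_int P A1 - r * (2 * l) * sq_int P A + r\<^sup>2 * sq_int P A"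
      by (simp add: pencil_form_def power2_eq_square algebra_simps)
    also have "\<dots> \<ge> ?f - r * k * (?f * G) - r * (2 * l) * (?f / c) + 0"
      using a0 a1 r k \<open>l > 0\<close> I0[OF A] by (intro add_mono diff_mono mult_left_mono) auto
    moreover have "?f - r * k * (?f * G) - r * (2 * l) * (?f / c) + 0 = ?f * (1 - r * (k * G + 2 * l / c))"
      by (simp add: algebra_simps)
    moreover have "\<dots> \<ge> 0"
      using r nonneg[OF A] by (intro mult_nonneg_nonneg) auto
    ultimately show ?thesis by linarith
  qed
  then have "l - r \<in> S" using r by (simp add: S_def)
  then have "l \<le> l - r" unfolding l_def using bdd by (rule cInf_lower)
  then show False using r by simp
qed

section \<open>Negative directions of Hill's operator\<close>

lemma periodic_integral_multiple:
  fixes h :: "real \<Rightarrow> real"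
  assumes h: "continuous_on UNIV h" "\<And>x. h (x + T) = h x" and T: "T > 0"
  shows "integral {0..real N * T} h = real N * integral {0..T} h"
proof -
  obtain H where H: "H 0 = 0" "\<And>x. (H has_real_derivative h x) (at x)"
    using primitive_exists[OF h(1)] by (auto simp: has_real_derivative_iff_has_vector_derivative)
  have int: "integral {0..a} h = H a" if "a \<ge> 0" for a
    using has_integral_real_FTC[OF H(2) that] H(1) by (simp add: integral_unique)
  have "((\<lambda>x. H (x + T) - H x) has_real_derivative 0) (at x)" for x
    using DERIV_diff[OF H(2)[of "x + T", THEN DERIV_shift[THEN iffD1]] H(2)[of x]] h(2)[of x] by simp
  then have const: "H (x + T) - H x = H (0 + T) - H 0" for x
    using DERIV_isconst_all[of "\<lambda>x. H (x + T) - H x" x 0] by blast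
  have step: "H (x + T) = H x + H T" for x
    using const[of x] H(1) by simp
  have "H (real N * T) = real N * H T"
  proof (induction N)
    case (Suc N)
    have "H (real (Suc N) * T) = H (real N * T + T)" by (simp add: algebra_simps)
    also have "\<dots> = H (real N * T) + H T" by (rule step)
    finally show ?case using Suc by (simp add: distrib_right)
  qed (simp add: H)
  then show ?thesis using int T by simp
qed

text \<open>For any primitive \<open>H\<close> the sum \<open>H (x + P) + H x\<close> is constant;
  subtracting half of that constant makes \<open>H\<close> antiperiodic. No condition on the mean
  arises.\<close>

lemma antiperiodic_primitive:
  fixes f f1 :: "real \<Rightarrow> real"
  assumes f: "\<And>x. (f has_real_derivative f1 x) (at x)" "continuous_on UNIV f1"
    and anti: "\<And>x. f (x + P) = - f x"
  shows "\<exists>B. antiperiodic_C2 P B f f1"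
proof -
  have "continuous_on UNIV f"
    by (rule differentiable_real_continuous_on[OF f(1)])
  then obtain H where H: "H 0 = 0" "\<And>x. (H has_real_derivative f x) (at x)"
    using primitive_exists[of f] by (auto simp: has_real_derivative_iff_has_vector_derivative)
  have "((\<lambda>x. H (x + P) + H x) has_real_derivative 0) (at x)" for x
    using DERIV_add[OF H(2)[of "x + P", THEN DERIV_shift[THEN iffD1]] H(2)[of x]] anti[of x] by simp
  then have "H (x + P) + H x = H (0 + P) + H 0" for x
    using DERIV_isconst_all[of "\<lambda>x. H (x + P) + H x" x 0] by blast
  then have "H (x + P) + H x = H P" for x by (simp add: H)
  then have "antiperiodic_C2 P (\<lambda>x. H x - H P / 2) f f1"
    unfolding antiperiodic_C2_def using f H by (auto intro!: derivative_eq_intros simp: algebra_simps)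
  then show ?thesis by blast
qed

text \<open>A solution \<open>g\<close> of \<open>e g'' + q g = 0\<close> that changes sign is not a ground state: the smoothed
  modulus \<open>\<surd>(g\<^sup>2 + \<eta>\<^sup>2)\<close> has negative energy for small \<open>\<eta>\<close>.\<close>

lemma smoothed_modulus_negative:
  fixes q g g1 :: "real \<Rightarrow> real"
  assumes e: "e > 0" and T: "T > 0" and q: "continuous_on UNIV q"
    and g: "\<And>x. (g has_real_derivative g1 x) (at x)" "\<And>x. (g1 has_real_derivative - (q x * g x) / e) (at x)"
    and per: "\<And>x. g (x + T) = g x" and z: "g z = 0" "g1 z \<noteq> 0"
  shows "\<exists>\<eta>>0. integral {0..T} (\<lambda>x. e * (g x * g1 x / sqrt ((g x)\<^sup>2 + \<eta>\<^sup>2))\<^sup>2 - q x * ((g x)\<^sup>2 + \<eta>\<^sup>2)) < 0"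
proof -
  have cg: "continuous_on S g" and cg1: "continuous_on S g1" for S
    by (rule differentiable_real_continuous_on[OF g(1)],
        rule differentiable_real_continuous_on[OF g(2)])
  have per1: "g1 (x + T) = g1 x" for x
    by (rule periodic_derivative[OF g(1) per])
  obtain w where w: "w \<in> {0..<T}" "g w = 0" "g1 w \<noteq> 0"
  proof (rule periodic_representative[of "\<lambda>x. (g x, g1 x)" T z])
    show "(g (x + T), g1 (x + T)) = (g x, g1 x)" for x by (simp add: per per1)
  qed (use T z that in auto)
  obtain K where K: "K > 0" "\<And>x. \<bar>g1 x\<bar> \<le> K"
    using periodic_bounded[of g1 T] per1 T cg1 by (metis real_norm_def)
  define m where "m = \<bar>g1 w\<bar> / 2"
  have m: "m > 0" using w by (simp add: m_def)
  obtain r where r: "r > 0" "\<And>x. \<bar>x - w\<bar> < r \<Longrightarrow> \<bar>g1 x - g1 w\<bar> < m"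
    using DERIV_isCont[OF g(2)[of w]] m unfolding continuous_at_eps_delta dist_real_def by blast
  define J where "J = integral {0..T} q"
  \<comment> \<open>\<open>h\<close> below is both the smoothing parameter and the length of an
    interval starting at the zero \<open>w\<close>. On that interval \<open>|g1| >= m\<close> and
    \<open>g^2 + h^2 <= (K^2 + 1) h^2\<close>, so \<open>e\<close> times the integral of
    \<open>?d\<close> is at least \<open>c / h\<close>, and \<open>h\<close> is taken small enough
    for this to exceed \<open>|J|\<close>.\<close>
  define c where "c = e * m\<^sup>2 / (K\<^sup>2 + 1)"
  have K1: "K\<^sup>2 + 1 > 0" by (simp add: add_nonneg_pos)
  have c: "c > 0" unfolding c_def using e m K1 by simp
  define h where "h = min (min (r / 2) (T - w)) (c / (\<bar>J\<bar> + 1))"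
  have h: "h > 0" "h < r" "w + h \<le> T" "h * (\<bar>J\<bar> + 1) \<le> c"
  proof -
    show "h > 0" "h < r" "w + h \<le> T" using r w c by (auto simp: h_def)
    have "h * (\<bar>J\<bar> + 1) \<le> c / (\<bar>J\<bar> + 1) * (\<bar>J\<bar> + 1)"
      unfolding h_def by (intro mult_right_mono) auto
    then show "h * (\<bar>J\<bar> + 1) \<le> c" by simp
  qed
  have den: "(g x)\<^sup>2 + h\<^sup>2 > 0" for x using h by (simp add: add_nonneg_pos)
  let ?d = "\<lambda>x. (g1 x)\<^sup>2 / ((g x)\<^sup>2 + h\<^sup>2)"
  have cd: "continuous_on S ?d" for S
    using den by (intro continuous_intros cg cg1) (auto simp: less_imp_neq[symmetric])
  have gb: "(g x)\<^sup>2 \<le> K\<^sup>2 * h\<^sup>2" if "x \<in> {w..w + h}" for x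
  proof -
    have "\<bar>g x - g w\<bar> \<le> K * \<bar>x - w\<bar>"
      using field_differentiable_bound[of UNIV g g1 K x w] g(1) K by auto
    also have "\<dots> \<le> K * h" using that K by (intro mult_left_mono) auto
    finally have "\<bar>g x\<bar> \<le> \<bar>K * h\<bar>" using w(2) by simp
    then show ?thesis by (simp add: abs_le_square_iff power_mult_distrib)
  qed
  have "m\<^sup>2 / ((K\<^sup>2 + 1) * h\<^sup>2) * h \<le> integral {w..w + h} ?d"
  proof (rule has_integral_le)
    show "((\<lambda>_. m\<^sup>2 / ((K\<^sup>2 + 1) * h\<^sup>2)) has_integral m\<^sup>2 / ((K\<^sup>2 + 1) * h\<^sup>2) * h) {w..w + h}"
      using has_integral_const_real[of "m\<^sup>2 / ((K\<^sup>2 + 1) * h\<^sup>2)" w "w + h"] h by (simp add: mult.commute)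
    show "(?d has_integral integral {w..w + h} ?d) {w..w + h}"
      by (intro integrable_integral integrable_continuous_interval cd)
    fix x assume x: "x \<in> {w..w + h}"
    have "\<bar>g1 x - g1 w\<bar> < m" using x h by (intro r) auto
    then have "m \<le> \<bar>g1 x\<bar>" unfolding m_def by linarith
    then have "m\<^sup>2 \<le> (g1 x)\<^sup>2" using m by (metis abs_le_square_iff abs_of_pos)
    moreover have "(g x)\<^sup>2 + h\<^sup>2 \<le> (K\<^sup>2 + 1) * h\<^sup>2"
      using gb[OF x] by (simp add: algebra_simps)
    ultimately show "m\<^sup>2 / ((K\<^sup>2 + 1) * h\<^sup>2) \<le> ?d x"
      using den by (intro frac_le) auto
  qed
  also have "\<dots> \<le> integral {0..T} ?d"
    using w h den by (intro integral_subset_le integrable_continuous_interval cd)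
      (auto intro!: divide_nonneg_nonneg less_imp_le)
  finally have "m\<^sup>2 / ((K\<^sup>2 + 1) * h) \<le> integral {0..T} ?d"
    using h by (simp add: power2_eq_square)
  then have "e * (m\<^sup>2 / ((K\<^sup>2 + 1) * h)) \<le> e * integral {0..T} ?d"
    using e by (intro mult_left_mono) auto
  moreover have "\<bar>J\<bar> + 1 \<le> e * (m\<^sup>2 / ((K\<^sup>2 + 1) * h))"
  proof -
    have "e * (m\<^sup>2 / ((K\<^sup>2 + 1) * h)) = c / h" by (simp add: c_def)
    then show ?thesis using h by (simp add: pos_le_divide_eq mult.commute)
  qed
  ultimately have big: "e * integral {0..T} ?d + J > 0" by linarith
  \<comment> \<open>\<open>g\<close> itself has zero energy: multiply \<open>e g'' + q g = 0\<close>
    by \<open>g\<close> and integrate over a period. Since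
    \<open>g^2 g1^2 / (g^2 + h^2) = g1^2 - h^2 ?d\<close>, smoothing changes the energy by exactly
    \<open>- h^2\<close> times the integral of \<open>e ?d + q\<close>.\<close>
  have zero: "((\<lambda>x. e * (g1 x)\<^sup>2 - q x * (g x)\<^sup>2) has_integral 0) {0..T}"
  proof -
    have "((\<lambda>x. e * (g1 x)\<^sup>2 - q x * (g x)\<^sup>2) has_integral e * g T * g1 T - e * g 0 * g1 0) {0..T}"
      by (rule has_integral_real_FTC[of "\<lambda>x. e * g x * g1 x"])
         (use T e in \<open>auto intro!: derivative_eq_intros g simp: field_simps power2_eq_square\<close>)
    then show ?thesis using per[of 0] per1[of 0] by simp
  qed
  have "((\<lambda>x. (e * (g1 x)\<^sup>2 - q x * (g x)\<^sup>2) - h\<^sup>2 * (e * ?d x + q x)) has_integral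
      0 - h\<^sup>2 * (e * integral {0..T} ?d + J)) {0..T}"
    unfolding J_def
    by (intro has_integral_diff zero has_integral_mult_right has_integral_add integrable_integral
        integrable_continuous_interval cd continuous_on_subset[OF q]) auto
  moreover have "(e * (g1 x)\<^sup>2 - q x * (g x)\<^sup>2) - h\<^sup>2 * (e * ?d x + q x) =
      e * (g x * g1 x / sqrt ((g x)\<^sup>2 + h\<^sup>2))\<^sup>2 - q x * ((g x)\<^sup>2 + h\<^sup>2)" for x
  proof -
    have sub: "(g1 x)\<^sup>2 - h\<^sup>2 * ?d x = (g x * g1 x / sqrt ((g x)\<^sup>2 + h\<^sup>2))\<^sup>2"
    proof -
      have "b - d * (b / D) = a * b / D" if "D = a + d" "D \<noteq> 0" for a b d D :: real
        using that by (simp add: field_simps)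
      from this[OF refl, of "(g x)\<^sup>2" "h\<^sup>2" "(g1 x)\<^sup>2"] den[of x] h(1) show ?thesis
        by (simp add: power_divide power_mult_distrib)
    qed
    show ?thesis unfolding sub[symmetric] by (simp add: algebra_simps)
  qed
  ultimately have "integral {0..T} (\<lambda>x. e * (g x * g1 x / sqrt ((g x)\<^sup>2 + h\<^sup>2))\<^sup>2 - q x * ((g x)\<^sup>2 + h\<^sup>2))
      = - h\<^sup>2 * (e * integral {0..T} ?d + J)"
    by (simp add: integral_unique)
  also have "\<dots> < 0" using big h by simp
  finally show ?thesis using h(1) by blast
qed

text \<open>Modulating a periodic function of negative energy by \<open>cos\<close> and \<open>sin\<close> of long wave length: the
  two energies add up to the energy of the function plus a term that tends to zero.\<close>

lemma modulation_negative:
  fixes q \<phi> \<phi>1 :: "real \<Rightarrow> real"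
  assumes e: "e > 0" and T: "T > 0" and q: "continuous_on UNIV q" "\<And>x. q (x + T) = q x"
    and \<phi>: "\<And>x. (\<phi> has_real_derivative \<phi>1 x) (at x)" "continuous_on UNIV \<phi>1" "\<And>x. \<phi> (x + T) = \<phi> x"
    and neg: "integral {0..T} (\<lambda>x. e * (\<phi>1 x)\<^sup>2 - q x * (\<phi> x)\<^sup>2) < 0"
  shows "\<exists>N::nat. N > 0 \<and> (\<exists>B B1 B2. antiperiodic_C2 (real N * T) B B1 B2 \<and> base_form (real N * T) e q B1 B2 < 0)"
proof -
  have c\<phi>: "continuous_on S \<phi>" for S
    by (rule differentiable_real_continuous_on[OF \<phi>(1)])
  have per1: "\<phi>1 (x + T) = \<phi>1 x" for x
    by (rule periodic_derivative[OF \<phi>(1,3)])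
  let ?E = "\<lambda>x. e * (\<phi>1 x)\<^sup>2 - q x * (\<phi> x)\<^sup>2"
  have cE: "continuous_on S ?E" for S
    by (intro continuous_intros c\<phi> continuous_on_subset[OF q(1)] continuous_on_subset[OF \<phi>(2)]) auto
  define E0 F0 where "E0 = integral {0..T} ?E" and "F0 = integral {0..T} (\<lambda>x. (\<phi> x)\<^sup>2)"
  have F0: "F0 \<ge> 0" unfolding F0_def
    by (intro Henstock_Kurzweil_Integration.integral_nonneg integrable_continuous_interval continuous_intros c\<phi>) auto
  have E0: "E0 < 0" using neg by (simp add: E0_def)
  obtain N :: nat where N: "N > 0" "e * pi\<^sup>2 * F0 / T\<^sup>2 < real N * (- E0)"
  proof -
    obtain N :: nat where "e * pi\<^sup>2 * F0 / T\<^sup>2 / (- E0) < real N" using reals_Archimedean2 by blast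
    then have "e * pi\<^sup>2 * F0 / T\<^sup>2 < real N * (- E0)"
      by (rule pos_divide_less_eq[THEN iffD1, rotated]) (use E0 in simp)
    moreover have "N > 0"
    proof (rule ccontr)
      assume "\<not> N > 0"
      with calculation have "e * pi\<^sup>2 * F0 / T\<^sup>2 < 0" by simp
      moreover have "e * pi\<^sup>2 * F0 / T\<^sup>2 \<ge> 0" using e F0 by simp
      ultimately show False by simp
    qed
    ultimately show ?thesis using that by blast
  qed
  define P where "P = real N * T"
  \<comment> \<open>\<open>cos (\<omega> x)\<close> and \<open>sin (\<omega> x)\<close> change sign
    over \<open>P\<close>, so their products with the periodic \<open>\<phi>\<close> are
    antiperiodic. By \<open>cos^2 + sin^2 = 1\<close> the mixed terms of the two energies cancel and
    only \<open>e \<omega>^2 \<phi>^2\<close> is added, of order \<open>1 / N^2\<close>.\<close>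
  define \<omega> where "\<omega> = pi / P"
  have P: "P > 0" using N T by (simp add: P_def)
  have perP: "\<phi> (x + P) = \<phi> x" "\<phi>1 (x + P) = \<phi>1 x" for x
    using periodic_int_shift[of \<phi> T x "int N"] periodic_int_shift[of \<phi>1 T x "int N"] \<phi>(3) per1
    by (auto simp: P_def)
  have tot: "E0 + e * \<omega>\<^sup>2 * F0 < 0"
  proof -
    have "e * \<omega>\<^sup>2 * F0 = (e * pi\<^sup>2 * F0 / T\<^sup>2) / (real N)\<^sup>2"
      by (simp add: \<omega>_def P_def power_divide power_mult_distrib)
    also have "\<dots> \<le> (e * pi\<^sup>2 * F0 / T\<^sup>2) / real N"
    proof (rule divide_left_mono)
      have "real N * 1 \<le> real N * real N" using N by (intro mult_left_mono) auto
      then show "real N \<le> (real N)\<^sup>2" by (simp add: power2_eq_square)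
    qed (use e F0 N in auto)
    also have "\<dots> < - E0" 
      by (rule pos_divide_less_eq[THEN iffD2]) (use N in \<open>simp_all only: mult.commute[of "- E0"] of_nat_0_less_iff\<close>)
    finally show ?thesis by simp
  qed
  define C1 C2 S1 S2 where "C1 x = cos (\<omega> * x) * \<phi> x"
    and "C2 x = - \<omega> * sin (\<omega> * x) * \<phi> x + cos (\<omega> * x) * \<phi>1 x"
    and "S1 x = sin (\<omega> * x) * \<phi> x"
    and "S2 x = \<omega> * cos (\<omega> * x) * \<phi> x + sin (\<omega> * x) * \<phi>1 x" for x
  have \<omega>P: "\<omega> * (x + P) = \<omega> * x + pi" for x using P by (simp add: \<omega>_def field_simps)
  have "\<exists>B. antiperiodic_C2 P B C1 C2"
    by (rule antiperiodic_primitive; unfold C1_def C2_def)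
       (auto intro!: derivative_eq_intros \<phi> continuous_intros c\<phi> simp: \<omega>P perP)
  then obtain B where B: "antiperiodic_C2 P B C1 C2" by blast
  have "\<exists>B. antiperiodic_C2 P B S1 S2"
    by (rule antiperiodic_primitive; unfold S1_def S2_def)
       (auto intro!: derivative_eq_intros \<phi> continuous_intros c\<phi> simp: \<omega>P perP)
  then obtain B' where B': "antiperiodic_C2 P B' S1 S2" by blast
  have base: "((\<lambda>x. e * (A2 x)\<^sup>2 - q x * (A1 x)\<^sup>2) has_integral base_form P e q A1 A2) {0..P}"
    if "antiperiodic_C2 P A A1 A2" for A A1 A2
    unfolding base_form_def
    by (intro integrable_integral integrable_continuous_interval continuous_intros
        antiperiodic_C2D[OF that] continuous_on_subset[OF q(1)]) auto
  have "((\<lambda>x. (e * (C2 x)\<^sup>2 - q x * (C1 x)\<^sup>2) + (e * (S2 x)\<^sup>2 - q x * (S1 x)\<^sup>2)) has_integral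
    base_form P e q C1 C2 + base_form P e q S1 S2) {0..P}"
    by (intro has_integral_add base[OF B] base[OF B'])
  moreover have "(e * (C2 x)\<^sup>2 - q x * (C1 x)\<^sup>2) + (e * (S2 x)\<^sup>2 - q x * (S1 x)\<^sup>2) =
    ?E x + e * \<omega>\<^sup>2 * (\<phi> x)\<^sup>2" for x
  proof -
    have sc: "(C1 x)\<^sup>2 + (S1 x)\<^sup>2 = (\<phi> x)\<^sup>2"
      unfolding C1_def S1_def power_mult_distrib by (metis distrib_right mult_1 sin_cos_squared_add2)
    have "(- w * s * p + c * r)\<^sup>2 + (w * c * p + s * r)\<^sup>2 = (c\<^sup>2 + s\<^sup>2) * (r\<^sup>2 + w\<^sup>2 * p\<^sup>2)"
      for w s p c r :: real by (simp add: power2_eq_square algebra_simps)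
    then have "(C2 x)\<^sup>2 + (S2 x)\<^sup>2 = (\<phi>1 x)\<^sup>2 + \<omega>\<^sup>2 * (\<phi> x)\<^sup>2"
      unfolding C2_def S2_def by simp
    moreover have "(e * (C2 x)\<^sup>2 - q x * (C1 x)\<^sup>2) + (e * (S2 x)\<^sup>2 - q x * (S1 x)\<^sup>2) =
      e * ((C2 x)\<^sup>2 + (S2 x)\<^sup>2) - q x * ((C1 x)\<^sup>2 + (S1 x)\<^sup>2)" by (simp add: algebra_simps)
    ultimately show ?thesis using sc by (simp add: algebra_simps)
  qed
  moreover have "((\<lambda>x. ?E x + e * \<omega>\<^sup>2 * (\<phi> x)\<^sup>2) has_integral
    real N * E0 + e * \<omega>\<^sup>2 * (real N * F0)) {0..P}"
  proof -
    have 1: "(?E has_integral real N * E0) {0..P}"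
      using integrable_integral[OF integrable_continuous_interval[OF cE, of 0 P]]
        periodic_integral_multiple[OF cE _ T, of N] by (simp add: E0_def P_def q \<phi> per1)
    have "continuous_on S (\<lambda>x. (\<phi> x)\<^sup>2)" for S by (intro continuous_intros c\<phi>)
    from integrable_integral[OF integrable_continuous_interval[OF this, of 0 P]]
        periodic_integral_multiple[OF this _ T, of N]
    have 2: "((\<lambda>x. (\<phi> x)\<^sup>2) has_integral real N * F0) {0..P}"
      by (simp add: F0_def P_def \<phi>)
    show ?thesis by (intro has_integral_add has_integral_mult_right 1 2)
  qed
  ultimately have "base_form P e q C1 C2 + base_form P e q S1 S2 = real N * E0 + e * \<omega>\<^sup>2 * (real N * F0)"
    using has_integral_unique by (simp add: has_integral_unique)
  also have "\<dots> = real N * (E0 + e * \<omega>\<^sup>2 * F0)" by (simp add: algebra_simps)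
  also have "\<dots> < 0" using tot N by (simp add: mult_pos_neg)
  finally have "base_form P e q C1 C2 < 0 \<or> base_form P e q S1 S2 < 0" by linarith
  with B B' N(1) show ?thesis unfolding P_def by blast
qed

theorem hill_antiperiodic_negative_direction:
  fixes q g g1 :: "real \<Rightarrow> real"
  assumes e: "e > 0" and T: "T > 0" and q: "continuous_on UNIV q" "\<And>x. q (x + T) = q x"
    and g: "\<And>x. (g has_real_derivative g1 x) (at x)" "\<And>x. (g1 has_real_derivative - (q x * g x) / e) (at x)"
    and per: "\<And>x. g (x + T) = g x" and z: "g z = 0" "g1 z \<noteq> 0"
  shows "\<exists>N::nat. N > 0 \<and> (\<exists>B B1 B2. antiperiodic_C2 (real N * T) B B1 B2 \<and> base_form (real N * T) e q B1 B2 < 0)"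
proof -
  obtain h where h: "h > 0"
    "integral {0..T} (\<lambda>x. e * (g x * g1 x / sqrt ((g x)\<^sup>2 + h\<^sup>2))\<^sup>2 - q x * ((g x)\<^sup>2 + h\<^sup>2)) < 0"
    using smoothed_modulus_negative[OF e T q(1) g per z] by blast
  have den: "(g x)\<^sup>2 + h\<^sup>2 > 0" for x using h by (simp add: add_nonneg_pos)
  have cg: "continuous_on S g" and cg1: "continuous_on S g1" for S
    by (rule differentiable_real_continuous_on[OF g(1)],
        rule differentiable_real_continuous_on[OF g(2)])
  show ?thesis
  proof (rule modulation_negative[OF e T q, of "\<lambda>x. sqrt ((g x)\<^sup>2 + h\<^sup>2)"
        "\<lambda>x. g x * g1 x / sqrt ((g x)\<^sup>2 + h\<^sup>2)"])
    show "((\<lambda>x. sqrt ((g x)\<^sup>2 + h\<^sup>2)) has_real_derivative g x * g1 x / sqrt ((g x)\<^sup>2 + h\<^sup>2)) (at x)" for x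
      using den[of x] by (auto intro!: derivative_eq_intros g simp: field_simps)
    show "continuous_on UNIV (\<lambda>x. g x * g1 x / sqrt ((g x)\<^sup>2 + h\<^sup>2))"
      using den by (intro continuous_intros cg cg1) (auto simp: less_imp_neq[symmetric])
    show "integral {0..T} (\<lambda>x. e * (g x * g1 x / sqrt ((g x)\<^sup>2 + h\<^sup>2))\<^sup>2 - q x * (sqrt ((g x)\<^sup>2 + h\<^sup>2))\<^sup>2) < 0"
      using h(2) den by (simp add: less_imp_le)
  qed (simp add: per)
qed

section \<open>Periodic eigenfunctions and the spectrum on the line\<close>

lemma weak_derivativeI:
  fixes f g :: "real \<Rightarrow> 'a::euclidean_space"
  assumes f: "\<And>x. (f has_vector_derivative g x) (at x)" and g: "continuous_on UNIV g"
  shows "weak_derivative f g"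
  unfolding weak_derivative_def
proof (intro conjI allI impI)
  have cf: "continuous_on S f" for S by (rule vector_derivative_continuous_on[OF f])
  show "locally_integrable f" "locally_integrable g"
    unfolding locally_integrable_def
    by (auto intro!: borel_integrable_atLeastAtMost' cf continuous_on_subset[OF g])
  fix \<phi> :: "real \<Rightarrow> real" assume \<phi>: "test_function \<phi>"
  then have "(deriv ^^ 0) \<phi> differentiable at x" "(deriv ^^ 1) \<phi> differentiable at x" for x
    unfolding test_function_def by blast+
  then have d: "\<phi> differentiable at x" "deriv \<phi> differentiable at x" for x by simp_all
  have D: "(\<phi> has_real_derivative deriv \<phi> x) (at x)" for x
    using d(1) DERIV_deriv_iff_real_differentiable by blast
  have c: "continuous_on S \<phi>" "continuous_on S (deriv \<phi>)" for S
    using d by (auto intro!: continuous_at_imp_continuous_on differentiable_imp_continuous_within)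
  obtain R where R: "\<And>x. \<bar>x\<bar> > R \<Longrightarrow> \<phi> x = 0" using \<phi> unfolding test_function_def by blast
  \<comment> \<open>\<open>R\<close> may be negative, and the vanishing is known only for
    \<open>|x|\<close> strictly beyond \<open>R\<close>. With the margin of one,
    \<open>\<phi>\<close> vanishes at both endpoints and the boundary terms drop out.\<close>
  define I where "I = {- \<bar>R\<bar> - 1..\<bar>R\<bar> + 1}"
  have zero: "\<phi> x = 0" "deriv \<phi> x = 0" if "x \<notin> I" for x
  proof -
    have x: "\<bar>x\<bar> > R" using that unfolding I_def by (auto simp: abs_if split: if_splits)
    then show "\<phi> x = 0" by (rule R)
    have "open {y. \<bar>y\<bar> > R}" by (intro open_Collect_less continuous_intros)
    then have "(\<phi> has_real_derivative 0) (at x)"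
      by (rule has_field_derivative_transform_within_open[OF DERIV_const]) (use x R in auto)
    then show "deriv \<phi> x = 0" by (rule DERIV_imp_deriv)
  qed
  have i1: "integrable lborel (\<lambda>x. indicator I x *\<^sub>R (\<phi> x *\<^sub>R g x))"
    and i2: "integrable lborel (\<lambda>x. indicator I x *\<^sub>R (deriv \<phi> x *\<^sub>R f x))"
    unfolding I_def set_integrable_def[symmetric]
    by (intro borel_integrable_atLeastAtMost' continuous_intros c cf continuous_on_subset[OF g] subset_UNIV)+
  have e1: "(LINT x|lborel. \<phi> x *\<^sub>R g x) = (LINT x|lborel. indicator I x *\<^sub>R (\<phi> x *\<^sub>R g x))"
    using zero by (intro Bochner_Integration.integral_cong) (auto simp: indicator_def)
  have e2: "(LINT x|lborel. deriv \<phi> x *\<^sub>R f x) = (LINT x|lborel. indicator I x *\<^sub>R (deriv \<phi> x *\<^sub>R f x))"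
    using zero by (intro Bochner_Integration.integral_cong) (auto simp: indicator_def)
  have "(LINT x|lborel. indicator I x *\<^sub>R (\<phi> x *\<^sub>R g x + deriv \<phi> x *\<^sub>R f x)) =
      \<phi> (\<bar>R\<bar> + 1) *\<^sub>R f (\<bar>R\<bar> + 1) - \<phi> (- \<bar>R\<bar> - 1) *\<^sub>R f (- \<bar>R\<bar> - 1)"
    unfolding I_def
  proof (rule integral_FTC_Icc)
    show "((\<lambda>x. \<phi> x *\<^sub>R f x) has_vector_derivative \<phi> x *\<^sub>R g x + deriv \<phi> x *\<^sub>R f x) (at x within T)" for x T
      by (intro has_vector_derivative_scaleR has_field_derivative_at_within[OF D] has_vector_derivative_at_within[OF f])
    show "continuous_on {- \<bar>R\<bar> - 1..\<bar>R\<bar> + 1} (\<lambda>x. \<phi> x *\<^sub>R g x + deriv \<phi> x *\<^sub>R f x)"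
      by (intro continuous_intros c cf continuous_on_subset[OF g] subset_UNIV)
  qed simp
  also have "\<dots> = 0" using R[of "\<bar>R\<bar> + 1"] R[of "- \<bar>R\<bar> - 1"] by simp
  finally have "(LINT x|lborel. indicator I x *\<^sub>R (\<phi> x *\<^sub>R g x)) + (LINT x|lborel. indicator I x *\<^sub>R (deriv \<phi> x *\<^sub>R f x)) = 0"
    using Bochner_Integration.integral_add[OF i1 i2] by (simp add: scaleR_add_right)
  then show "(LINT x|lborel. deriv \<phi> x *\<^sub>R f x) = - (LINT x|lborel. \<phi> x *\<^sub>R g x)"
    unfolding e1 e2 by (simp add: eq_neg_iff_add_eq_0 add.commute)
qed

text \<open>A rational cutoff at scale \<open>R\<close>. Its first two derivatives are bounded by
  \<open>bump / R\<close> and \<open>10 bump / R^2\<close>, hence by the cutoff itself, so one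
  profile dominates the eigenfunction and all error terms; its integral is explicit.\<close>

definition bump :: "real \<Rightarrow> real \<Rightarrow> real" where "bump R x = 1 / (1 + (x / R)\<^sup>2)"
definition bump' :: "real \<Rightarrow> real \<Rightarrow> real" where "bump' R x = - (2 * x / R\<^sup>2) * (bump R x)\<^sup>2"
definition bump'' :: "real \<Rightarrow> real \<Rightarrow> real" where
  "bump'' R x = - (2 / R\<^sup>2) * (bump R x)\<^sup>2 + 8 / R\<^sup>2 * (x / R)\<^sup>2 * (bump R x) ^ 3"

context
  fixes R :: real assumes R: "R > 0"
begin

lemma bump_bounds: "0 < bump R x" "bump R x \<le> 1"
  unfolding bump_def by (simp_all add: add_pos_nonneg divide_le_eq_1)

lemma bump_derivative: "(bump R has_real_derivative bump' R x) (at x)"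
proof -
  have "1 + (x / R)\<^sup>2 > 0" by (simp add: add_pos_nonneg)
  then show ?thesis
    unfolding bump_def[abs_def] bump'_def using R
    by (auto intro!: derivative_eq_intros simp: field_simps power2_eq_square)
qed

lemma bump'_derivative: "(bump' R has_real_derivative bump'' R x) (at x)"
proof -
  have "((\<lambda>x. - (2 / R\<^sup>2) * (x * (bump R x)\<^sup>2)) has_real_derivative
      - (2 / R\<^sup>2) * (1 * (bump R x)\<^sup>2 + (2 * bump R x * bump' R x) * x)) (at x)"
    by (rule DERIV_cmult, rule DERIV_mult) (auto intro!: derivative_eq_intros bump_derivative)
  moreover have "(\<lambda>x. - (2 / R\<^sup>2) * (x * (bump R x)\<^sup>2)) = bump' R"
    by (simp add: fun_eq_iff bump'_def)
  moreover have "- (2 / R\<^sup>2) * (1 * (bump R x)\<^sup>2 + (2 * bump R x * bump' R x) * x) = bump'' R x"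
    by (simp add: bump'_def bump''_def power2_eq_square power3_eq_cube algebra_simps)
  ultimately show ?thesis by simp
qed

lemma bump_continuous: "continuous_on S (bump R)" "continuous_on S (bump' R)" "continuous_on S (bump'' R)"
proof -
  show "continuous_on S (bump R)" "continuous_on S (bump' R)" for S
    by (rule differentiable_real_continuous_on[OF bump_derivative],
        rule differentiable_real_continuous_on[OF bump'_derivative])
  then show "continuous_on S (bump'' R)"
    unfolding bump''_def[abs_def] using R by (intro continuous_intros) auto
qed

lemma bump'_bound: "\<bar>bump' R x\<bar> \<le> bump R x / R"
proof -
  let ?y = "x / R"
  have y: "1 + ?y\<^sup>2 > 0" by (simp add: add_pos_nonneg)
  have "2 * \<bar>y\<bar> \<le> 1 + y\<^sup>2" for y :: real
    using zero_le_power2[of "1 - \<bar>y\<bar>"] by (simp add: power2_diff)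
  then have "2 * \<bar>?y\<bar> \<le> 1 + ?y\<^sup>2" .
  then have 1: "2 * \<bar>?y\<bar> * bump R x \<le> 1" unfolding bump_def
    by (simp only: times_divide_eq_right mult_1_right divide_le_eq_1_pos[OF y])
  have "\<bar>bump' R x\<bar> = (2 * \<bar>?y\<bar> * bump R x) * (bump R x / R)"
    using R bump_bounds[of x] by (simp add: bump'_def abs_mult power2_eq_square)
  also have "\<dots> \<le> 1 * (bump R x / R)"
    using 1 R bump_bounds[of x] by (intro mult_right_mono) auto
  finally show ?thesis by simp
qed

lemma bump''_bound: "\<bar>bump'' R x\<bar> \<le> 10 / R\<^sup>2 * bump R x"
proof -
  let ?y = "x / R"
  have y: "1 + ?y\<^sup>2 > 0" by (simp add: add_pos_nonneg)
  have 1: "?y\<^sup>2 * bump R x \<le> 1" using y by (simp add: bump_def)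
  note b = bump_bounds[of x]
  have bb: "(bump R x)\<^sup>2 \<le> bump R x" using b by (simp add: power2_eq_square mult_left_le)
  have "\<bar>bump'' R x\<bar> \<le> 2 / R\<^sup>2 * (bump R x)\<^sup>2 + 8 / R\<^sup>2 * (?y\<^sup>2 * bump R x) * (bump R x)\<^sup>2"
  proof -
    have "\<bar>bump'' R x\<bar> \<le> \<bar>- (2 / R\<^sup>2) * (bump R x)\<^sup>2\<bar> + \<bar>8 / R\<^sup>2 * ?y\<^sup>2 * (bump R x) ^ 3\<bar>"
      unfolding bump''_def by (rule abs_triangle_ineq)
    then show ?thesis using b by (simp add: abs_mult power2_eq_square power3_eq_cube mult.assoc)
  qed
  also have "\<dots> \<le> 2 / R\<^sup>2 * bump R x + 8 / R\<^sup>2 * 1 * bump R x"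
    using 1 bb b by (intro add_mono mult_mono mult_left_mono) auto
  also have "\<dots> = 10 / R\<^sup>2 * bump R x" by (simp add: add_divide_distrib[symmetric] distrib_right[symmetric])
  finally show ?thesis .
qed

end

section \<open>Norms of functions dominated by the cutoff\<close>

lemma bump_integrable: "R > 0 \<Longrightarrow> integrable lborel (bump R)"
  and bump_integral: "R > 0 \<Longrightarrow> integral\<^sup>L lborel (bump R) = R * pi"
proof -
  assume R: "R > 0"
  have 1: "integrable lborel (\<lambda>x::real. inverse (1 + x\<^sup>2))"
    using integrable_inverse_1_plus_square by (simp add: set_integrable_def)
  have "bump R = (\<lambda>x. inverse (1 + (0 + (1 / R) * x)\<^sup>2))"
    by (simp add: bump_def fun_eq_iff inverse_eq_divide)
  with lborel_integrable_real_affine[OF 1, of "1 / R" 0] R show "integrable lborel (bump R)" by simp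
  have "pi = (LINT x|lborel. inverse (1 + x\<^sup>2))"
    using LBINT_inverse_1_plus_square
    by (simp add: interval_lebesgue_integral_def set_lebesgue_integral_def)
  also have "\<dots> = (1 / R) * (LINT x|lborel. inverse (1 + (0 + (1 / R) * x)\<^sup>2))"
    using lborel_integral_real_affine[of "1 / R" "\<lambda>x. inverse (1 + x\<^sup>2)" 0] R by simp
  finally show "integral\<^sup>L lborel (bump R) = R * pi"
    using R by (simp add: bump_def[abs_def] inverse_eq_divide field_simps)
qed

text \<open>The common scale of all norms: the \<open>p\<close>-th root of the integral of
  \<open>bump R\<close>, or \<open>1\<close> for \<open>p = \<infinity>\<close>. The norm of the
  cut-off eigenfunction is compared with it from below and the error from above, so it cancels in
  the resolvent estimate.\<close>

definition Lp_weight :: "ennreal \<Rightarrow> real \<Rightarrow> real" where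
  "Lp_weight p R = (if p = \<infinity> then 1 else (R * pi) powr (1 / enn2real p))"

lemma Lp_weight_pos: "R > 0 \<Longrightarrow> Lp_weight p R > 0"
  by (simp add: Lp_weight_def)

lemma enn2real_ge_1: "1 \<le> p \<Longrightarrow> p \<noteq> \<infinity> \<Longrightarrow> 1 \<le> enn2real p"
  using enn2real_mono[of 1 p] by (simp add: top.not_eq_extremum)

text \<open>Since \<open>0 < bump \<le> 1\<close> and the exponent is at least one, the power of
  \<open>bump\<close> lies below \<open>bump\<close> itself; the single integral \<open>R pi\<close>
  thus serves every finite \<open>p\<close>.\<close>

lemma bump_dominated:
  fixes f :: "real \<Rightarrow> 'a::euclidean_space"
  assumes p: "1 \<le> p" and R: "R > 0" and f: "continuous_on UNIV f" and k: "k \<ge> 0"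
    and bound: "\<And>x. norm (f x) \<le> k * bump R x"
  shows "f \<in> Lp_space p" "Lp_norm p f \<le> k * Lp_weight p R"
proof -
  have m: "f \<in> borel_measurable lborel" using f by (simp add: borel_measurable_continuous_onI)
  note b = bump_bounds[OF R]
  have bd1: "norm (f x) \<le> k" for x
    using bound[of x] b[of x] k mult_left_le[of "bump R x" k] by linarith
  have powr_bound: "norm (f x) powr enn2real p \<le> k powr enn2real p * bump R x" if "p \<noteq> \<infinity>" for x
  proof -
    note p1 = enn2real_ge_1[OF p that]
    have "norm (f x) powr enn2real p \<le> (k * bump R x) powr enn2real p"
      using bound p1 by (intro powr_mono2) auto
    also have "\<dots> = k powr enn2real p * bump R x powr enn2real p"
      using k b[of x] by (simp add: powr_mult)
    also have "bump R x powr enn2real p \<le> bump R x powr 1"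
      using b[of x] p1 powr_mono'[of 1 "enn2real p" "bump R x"] by simp
    finally show ?thesis
      using b(1)[of x] by (simp add: mult_left_mono)
  qed
  show "f \<in> Lp_space p"
  proof (cases "p = \<infinity>")
    case True
    have "ess_norm f \<le> ereal k" unfolding ess_norm_def
      using m bd1 by (intro esssup_I) auto
    then have "ess_norm f < \<infinity>" by (rule order_le_less_trans) simp
    then show ?thesis using True m by (simp add: Lp_space_def)
  next
    case False
    note p1 = enn2real_ge_1[OF p False]
    have "integrable lborel (\<lambda>x. norm (f x) powr enn2real p)"
    proof (rule Bochner_Integration.integrable_bound)
      show "integrable lborel (\<lambda>x. k powr enn2real p * bump R x)"
        using bump_integrable[OF R] by (intro integrable_mult_right)
      show "(\<lambda>x. norm (f x) powr enn2real p) \<in> borel_measurable lborel" using m by measurable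
      show "AE x in lborel. norm (norm (f x) powr enn2real p) \<le> norm (k powr enn2real p * bump R x)"
        using powr_bound[OF False] b(1) by (intro AE_I2) (simp add: less_imp_le)
    qed
    then show ?thesis using False m by (simp add: Lp_space_def)
  qed
  show "Lp_norm p f \<le> k * Lp_weight p R"
  proof (cases "p = \<infinity>")
    case True
    have "ess_norm f \<le> ereal k" unfolding ess_norm_def
      using m bd1 by (intro esssup_I) auto
    then have "real_of_ereal (ess_norm f) \<le> k" using k by (cases "ess_norm f") auto
    then show ?thesis using True by (simp add: Lp_norm_def Lp_weight_def)
  next
    case False
    note p1 = enn2real_ge_1[OF p False]
    have "(LINT x|lborel. norm (f x) powr enn2real p) \<le> (LINT x|lborel. k powr enn2real p * bump R x)"
    proof (rule integral_mono_AE)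
      show "integrable lborel (\<lambda>x. norm (f x) powr enn2real p)"
        using \<open>f \<in> Lp_space p\<close> False by (simp add: Lp_space_def)
      show "integrable lborel (\<lambda>x. k powr enn2real p * bump R x)"
        using bump_integrable[OF R] by (intro integrable_mult_right)
      show "AE x in lborel. norm (f x) powr enn2real p \<le> k powr enn2real p * bump R x"
        using powr_bound[OF False] by simp
    qed
    also have "\<dots> = k powr enn2real p * (R * pi)"
      using bump_integral[OF R] by simp
    finally have "(LINT x|lborel. norm (f x) powr enn2real p) powr (1 / enn2real p) \<le>
        (k powr enn2real p * (R * pi)) powr (1 / enn2real p)"
      using p1 by (intro powr_mono2) auto
    also have "\<dots> = (k powr enn2real p) powr (1 / enn2real p) * (R * pi) powr (1 / enn2real p)"
      by (rule powr_mult)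
    also have "(k powr enn2real p) powr (1 / enn2real p) = k"
      using p1 k by (simp add: powr_powr)
    finally show ?thesis using False by (simp add: Lp_norm_def Lp_weight_def)
  qed
qed

text \<open>A strict superlevel set of a continuous function is open, hence not a null set once it
  contains \<open>x0\<close>. This gives pointwise lower bounds on the norm for
  \<open>p = \<infinity>\<close>.\<close>

lemma esssup_ge_continuous:
  fixes f :: "real \<Rightarrow> real"
  assumes f: "continuous_on UNIV f"
  shows "ereal (f x0) \<le> esssup lborel (\<lambda>x. ereal (f x))"
proof (rule ccontr)
  assume "\<not> ?thesis"
  then obtain r where r: "esssup lborel (\<lambda>x. ereal (f x)) < ereal r" "ereal r < ereal (f x0)"
    using ereal_dense2 by (metis not_le)
  define S where "S = {x. r < f x}"
  have "open S" unfolding S_def by (intro open_Collect_less continuous_intros f)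
  have "AE x in lborel. x \<notin> S"
    using esssup_AE[of "\<lambda>x. ereal (f x)" lborel]
  proof (rule AE_mp, intro AE_I2 impI)
    fix x assume "ereal (f x) \<le> esssup lborel (\<lambda>x. ereal (f x))"
    then have "ereal (f x) < ereal r" using r(1) by (rule order_le_less_trans)
    then show "x \<notin> S" by (simp add: S_def)
  qed
  then have "S \<in> null_sets lborel"
    using \<open>open S\<close> by (intro AE_iff_null_sets[THEN iffD2]) auto
  then have "negligible S" by (simp add: negligible_iff_null_sets null_sets_completionI)
  moreover have "x0 \<in> S" using r(2) by (simp add: S_def)
  ultimately show False using open_not_negligible[OF \<open>open S\<close>] by auto
qed

text \<open>On \<open>{0..n T}\<close> the cutoff is at least one half. For finite \<open>p\<close>
  the integral of the \<open>p\<close>-th power of \<open>|V|\<close> there is \<open>n\<close>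
  times its value over one period, the same growth as \<open>R pi = n T pi\<close>; for
  \<open>p = \<infinity>\<close> one point of the first period suffices.\<close>

lemma bump_periodic_lower_bound:
  fixes V :: "real \<Rightarrow> 'a::euclidean_space"
  assumes p: "1 \<le> p" and T: "T > 0" and V: "continuous_on UNIV V" "\<And>x. V (x + T) = V x" "V x0 \<noteq> 0"
  obtains c where "c > 0" "\<And>n::nat. n > 0 \<Longrightarrow>
    c * Lp_weight p (real n * T) \<le> Lp_norm p (\<lambda>x. bump (real n * T) x *\<^sub>R V x)"
proof -
  have half: "bump (real n * T) x \<ge> 1 / 2" if "x \<in> {0..real n * T}" "n > 0" for n x
  proof -
    have "x / (real n * T) \<le> 1" "0 \<le> x / (real n * T)" using that T by (auto simp: divide_le_eq_1)
    then have "(x / (real n * T))\<^sup>2 \<le> 1" by (simp add: power_le_one)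
    then show ?thesis unfolding bump_def by (intro frac_le) (auto simp: add_pos_nonneg)
  qed
  have cont: "continuous_on UNIV (\<lambda>x. bump (real n * T) x *\<^sub>R V x)" if "n > 0" for n
    using that T by (intro continuous_intros V bump_continuous) auto
  obtain K where K: "K > 0" "\<And>x. norm (V x) \<le> K"
    using periodic_bounded[of V T] V T by auto
  have norm_eq: "norm (bump (real n * T) x *\<^sub>R V x) = bump (real n * T) x * norm (V x)" if "n > 0" for n x
    using bump_bounds(1)[of "real n * T" x] that T by simp
  show ?thesis
  proof (cases "p = \<infinity>")
    case True
    obtain t where t: "t \<in> {0..<T}" "V x0 = V t"
      using periodic_representative[of V T x0] V T by blast
    have "norm (V t) / 2 * Lp_weight p (real n * T) \<le> Lp_norm p (\<lambda>x. bump (real n * T) x *\<^sub>R V x)"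
      if n: "n > 0" for n
    proof -
      let ?f = "\<lambda>x. bump (real n * T) x *\<^sub>R V x"
      have "T * 1 \<le> T * real n" using n T by (intro mult_left_mono) auto
      then have "t \<le> real n * T" using t(1) unfolding atLeastLessThan_iff mult.commute[of "real n"] by linarith
      then have "t \<in> {0..real n * T}" using t by simp
      then have "1 / 2 * norm (V t) \<le> norm (?f t)"
        unfolding norm_eq[OF n] using n by (intro mult_right_mono half) auto
      moreover have "ereal (norm (?f t)) \<le> ess_norm ?f"
        unfolding ess_norm_def by (rule esssup_ge_continuous) (intro continuous_intros cont n)
      ultimately have "ereal (norm (V t) / 2) \<le> ess_norm ?f"
        by (metis (no_types, lifting) ereal_less_eq(3) mult.commute mult_1 order_trans times_divide_eq_left)
      moreover have "?f \<in> Lp_space p"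
        by (rule bump_dominated(1)[where R = "real n * T" and k = K])
           (use p n T K cont norm_eq bump_bounds(1) in \<open>auto simp: mult.commute mult_right_mono less_imp_le\<close>)
      then have "ess_norm ?f < \<infinity>" using True by (simp add: Lp_space_def)
      ultimately have "norm (V t) / 2 \<le> real_of_ereal (ess_norm ?f)"
        by (cases "ess_norm ?f") auto
      then show ?thesis using True by (simp add: Lp_norm_def Lp_weight_def)
    qed
    then show ?thesis using that[of "norm (V t) / 2"] t V by simp
  next
    case False
    define r where "r = enn2real p"
    have r: "r \<ge> 1" using enn2real_ge_1[OF p False] by (simp add: r_def)
    define g where "g x = norm (V x) powr r" for x
    have g: "continuous_on S g" for S
      unfolding g_def using r by (intro continuous_on_powr' continuous_intros continuous_on_subset[OF V(1)]) auto
    define I where "I = integral {0..T} g"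
    have "I > 0"
    proof -
      obtain t where t: "t \<in> {0..<T}" "V x0 = V t"
        using periodic_representative[of V T x0] V T by blast
      have "I \<ge> 0" unfolding I_def g_def
        by (intro Henstock_Kurzweil_Integration.integral_nonneg integrable_continuous_interval g[unfolded g_def[abs_def]]) auto
      moreover have "I \<noteq> 0"
      proof
        assume "I = 0"
        then have "(g has_integral 0) (cbox 0 T)"
          unfolding I_def using integrable_integral[OF integrable_continuous_interval[OF g]] by (metis cbox_interval)
        then have "g t = 0"
          using has_integral_0_cbox_imp_0[of 0 T g t] g t T by (auto simp: g_def)
        then show False using t V(3) by (simp add: g_def)
      qed
      ultimately show ?thesis by simp
    qed
    define c where "c = 1 / 2 * (I / (T * pi)) powr (1 / r)"
    have "c > 0" unfolding c_def using \<open>I > 0\<close> T by simp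
    moreover have "c * Lp_weight p (real n * T) \<le> Lp_norm p (\<lambda>x. bump (real n * T) x *\<^sub>R V x)"
      if n: "n > 0" for n
    proof -
      let ?f = "\<lambda>x. bump (real n * T) x *\<^sub>R V x"
      have mem: "?f \<in> Lp_space p"
        by (rule bump_dominated(1)[where R = "real n * T" and k = K])
           (use p n T K cont norm_eq bump_bounds(1) in \<open>auto simp: mult.commute mult_right_mono less_imp_le\<close>)
      have si: "set_integrable lborel {0..real n * T} g"
        by (rule borel_integrable_atLeastAtMost'[OF g])
      have "(1 / 2) powr r * (real n * I) = (1 / 2) powr r * (LINT x:{0..real n * T}|lborel. g x)"
        unfolding set_borel_integral_eq_integral(2)[OF si] I_def
        using periodic_integral_multiple[OF g _ T, of n] V by (simp add: g_def)
      also have "\<dots> = (LINT x|lborel. (1 / 2) powr r * (indicator {0..real n * T} x *\<^sub>R g x))"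
        by (simp add: set_lebesgue_integral_def)
      also have "\<dots> \<le> (LINT x|lborel. norm (?f x) powr r)"
      proof (rule integral_mono_AE)
        show "integrable lborel (\<lambda>x. (1 / 2) powr r * (indicator {0..real n * T} x *\<^sub>R g x))"
          using si unfolding set_integrable_def by (intro integrable_mult_right)
        show "integrable lborel (\<lambda>x. norm (?f x) powr r)"
          using mem False by (simp add: Lp_space_def r_def)
        show "AE x in lborel. (1 / 2) powr r * (indicator {0..real n * T} x *\<^sub>R g x) \<le> norm (?f x) powr r"
        proof (rule AE_I2)
          fix x
          show "(1 / 2) powr r * (indicator {0..real n * T} x *\<^sub>R g x) \<le> norm (?f x) powr r"
          proof (cases "x \<in> {0..real n * T}")
            case True
            have "(1 / 2) powr r * g x = (1 / 2 * norm (V x)) powr r"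
              unfolding g_def by (rule powr_mult[symmetric])
            also have "\<dots> \<le> norm (?f x) powr r"
              unfolding norm_eq[OF n] using half[OF True n] r by (intro powr_mono2 mult_right_mono) auto
            finally show ?thesis using True by simp
          qed simp
        qed
      qed
      finally have "((1 / 2) powr r * (real n * I)) powr (1 / r) \<le> (LINT x|lborel. norm (?f x) powr r) powr (1 / r)"
        using r \<open>I > 0\<close> by (intro powr_mono2) auto
      moreover have "((1 / 2) powr r * (real n * I)) powr (1 / r) = c * Lp_weight p (real n * T)"
      proof -
        have 1: "((1 / 2) powr r * (real n * I)) powr (1 / r) = ((1 / 2) powr r) powr (1 / r) * (real n * I) powr (1 / r)"
          by (rule powr_mult)
        have 2: "((1 / 2::real) powr r) powr (1 / r) = 1 / 2"
          using r by (simp add: powr_powr)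
        have nI: "real n * I = I / (T * pi) * (real n * T * pi)" using T by simp
        have 3: "(real n * I) powr (1 / r) = (I / (T * pi)) powr (1 / r) * (real n * T * pi) powr (1 / r)"
          unfolding nI by (rule powr_mult)
        show ?thesis unfolding 1 2 3 using False by (simp add: c_def Lp_weight_def r_def)
      qed
      ultimately show ?thesis using False by (simp add: Lp_norm_def r_def)
    qed
    ultimately show ?thesis using that by blast
  qed
qed

text \<open>Domination by the cutoff with an unspecified constant, closed under sums and bounded
  factors. It serves the membership checks in \<open>Lp_space\<close>; explicit constants are
  tracked only for the error terms.\<close>

definition decays :: "real \<Rightarrow> (real \<Rightarrow> real) \<Rightarrow> bool" where
  "decays R f \<longleftrightarrow> continuous_on UNIV f \<and> (\<exists>k. \<forall>x. \<bar>f x\<bar> \<le> k * bump R x)"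

lemma decays_add: "decays R f \<Longrightarrow> decays R g \<Longrightarrow> decays R (\<lambda>x. f x + g x)"
proof -
  assume "decays R f" "decays R g"
  then obtain k m where km: "continuous_on UNIV f" "continuous_on UNIV g"
    "\<And>x. \<bar>f x\<bar> \<le> k * bump R x" "\<And>x. \<bar>g x\<bar> \<le> m * bump R x"
    unfolding decays_def by blast
  have "\<bar>f x + g x\<bar> \<le> (k + m) * bump R x" for x
    using km(3)[of x] km(4)[of x] abs_triangle_ineq[of "f x" "g x"] by (simp add: distrib_right)
  then show ?thesis unfolding decays_def using km by (blast intro: continuous_on_add)
qed

lemma decays_mult_bounded:
  assumes f: "decays R f" and g: "continuous_on UNIV g" "\<And>x. \<bar>g x\<bar> \<le> M"
  shows "decays R (\<lambda>x. f x * g x)"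
proof -
  obtain k where k: "continuous_on UNIV f" "\<And>x. \<bar>f x\<bar> \<le> k * bump R x"
    using f unfolding decays_def by blast
  have "\<bar>f x * g x\<bar> \<le> (k * M) * bump R x" for x
  proof -
    have "\<bar>f x * g x\<bar> \<le> (k * bump R x) * M"
      unfolding abs_mult using k(2)[of x] g(2)[of x] by (intro mult_mono) linarith+
    then show ?thesis by (simp add: mult.commute mult.left_commute)
  qed
  then show ?thesis unfolding decays_def using k(1) g(1) by (blast intro: continuous_on_mult)
qed

lemma decays_cmult: "decays R f \<Longrightarrow> decays R (\<lambda>x. c * f x)"
  using decays_mult_bounded[of R f "\<lambda>_. c" "\<bar>c\<bar>"] by (simp add: mult.commute)

lemma decays_bump:
  assumes R: "R > 0"
  shows "decays R (bump R)" "decays R (bump' R)" "decays R (bump'' R)"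
proof -
  have "\<bar>bump R x\<bar> \<le> 1 * bump R x" for x using bump_bounds(1)[OF R, of x] by simp
  then show "decays R (bump R)" unfolding decays_def using bump_continuous(1)[OF R] by blast
  have "\<bar>bump' R x\<bar> \<le> (1 / R) * bump R x" for x using bump'_bound[OF R, of x] by simp
  then show "decays R (bump' R)" unfolding decays_def using bump_continuous(2)[OF R] by blast
  show "decays R (bump'' R)" unfolding decays_def
    using bump_continuous(3)[OF R] bump''_bound[OF R] by blast
qed

definition cvec :: "(real \<Rightarrow> real) \<Rightarrow> (real \<Rightarrow> real) \<Rightarrow> real \<Rightarrow> complex \<times> complex" where
  "cvec f g x = (complex_of_real (f x), complex_of_real (g x))"

lemma cvec_continuous: "continuous_on S f \<Longrightarrow> continuous_on S g \<Longrightarrow> continuous_on S (cvec f g)"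
  unfolding cvec_def[abs_def] by (intro continuous_intros)

lemma cvec_derivative:
  "(f has_real_derivative f') (at x) \<Longrightarrow> (g has_real_derivative g') (at x) \<Longrightarrow>
    (cvec f g has_vector_derivative (complex_of_real f', complex_of_real g')) (at x)"
  unfolding cvec_def[abs_def]
  by (intro has_vector_derivative_Pair has_vector_derivative_of_real)

lemma cvec_weak_derivative:
  assumes "\<And>x. (f has_real_derivative f' x) (at x)" "\<And>x. (g has_real_derivative g' x) (at x)"
    and "continuous_on UNIV f'" "continuous_on UNIV g'"
  shows "weak_derivative (cvec f g) (cvec f' g')"
  using cvec_derivative[OF assms(1,2)] cvec_continuous[OF assms(3,4)]
  by (intro weak_derivativeI) (simp_all add: cvec_def)

lemma cvec_norm_le: "norm (cvec f g x) \<le> \<bar>f x\<bar> + \<bar>g x\<bar>"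
  unfolding cvec_def using norm_Pair_le[of "complex_of_real (f x)" "complex_of_real (g x)"] by simp

lemma cvec_Lp_space:
  assumes p: "1 \<le> p" and R: "R > 0" and "decays R f" "decays R g"
  shows "cvec f g \<in> Lp_space p"
proof -
  obtain k m where km: "continuous_on UNIV f" "continuous_on UNIV g"
    "\<And>x. \<bar>f x\<bar> \<le> k * bump R x" "\<And>x. \<bar>g x\<bar> \<le> m * bump R x"
    using assms unfolding decays_def by blast
  have "k * bump R 0 \<ge> 0" "m * bump R 0 \<ge> 0"
    using km(3)[of 0] km(4)[of 0] by linarith+
  then have "k \<ge> 0" "m \<ge> 0" by (simp_all add: bump_def)
  show ?thesis
  proof (rule bump_dominated(1)[OF p R cvec_continuous[OF km(1,2)], of "k + m"])
    show "norm (cvec f g x) \<le> (k + m) * bump R x" for x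
      using cvec_norm_le[of f g x] km(3)[of x] km(4)[of x] by (simp add: distrib_right)
  qed (use \<open>k \<ge> 0\<close> \<open>m \<ge> 0\<close> in simp)
qed

text \<open>A periodic eigenfunction is not in \<open>L\<^sup>p\<close> for \<open>p < \<infinity>\<close>, but cutting it off at scale \<open>n\<close> gives functions
  for which the eigenvalue equation holds up to a relative error of order \<open>1 / n\<close>.\<close>

theorem periodic_eigenvalue_in_spectrum:
  fixes a b q w :: "real \<Rightarrow> real"
  assumes p: "1 \<le> p" and T: "T > 0" and e: "e1 > 0" "e2 > 0"
    and a: "\<And>x. (a has_real_derivative a1 x) (at x)" "\<And>x. (a1 has_real_derivative a2 x) (at x)"
    and b: "\<And>x. (b has_real_derivative b1 x) (at x)" "\<And>x. (b1 has_real_derivative b2 x) (at x)"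
    and q: "\<And>x. q x = deriv pressure (fst (U x))"
    and w: "\<And>x. ((\<lambda>x. q x * a x) has_real_derivative w x) (at x)"
    and cont: "continuous_on UNIV a2" "continuous_on UNIV b2" "continuous_on UNIV w"
    and per: "\<And>x. a (x + T) = a x" "\<And>x. b (x + T) = b x" "\<And>x. q (x + T) = q x"
    and eq: "\<And>x. l * a x = e1 * a2 x + b1 x" "\<And>x. l * b x = e2 * b2 x - w x"
    and nz: "a x0 \<noteq> 0 \<or> b x0 \<noteq> 0"
  shows "complex_of_real l \<in> spectrum p e1 e2 U"
proof (rule ccontr)
  assume "\<not> ?thesis"
  then have "complex_of_real l \<in> resolvent_set p e1 e2 U" by (simp add: spectrum_def)
  then obtain C where C: "\<And>V G. linearized_op p e1 e2 U V G \<Longrightarrow>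
      Lp_norm p V \<le> C * Lp_norm p (\<lambda>x. cscale (complex_of_real l) (V x) - G x)"
    unfolding resolvent_set_def by blast
  have ca: "continuous_on UNIV a" "continuous_on UNIV a1" "continuous_on UNIV b" "continuous_on UNIV b1"
    "continuous_on UNIV (\<lambda>x. q x * a x)"
    by (rule differentiable_real_continuous_on[OF a(1)],
        rule differentiable_real_continuous_on[OF a(2)],
        rule differentiable_real_continuous_on[OF b(1)],
        rule differentiable_real_continuous_on[OF b(2)],
        rule differentiable_real_continuous_on[OF w])
  have pera: "a1 (x + T) = a1 x" "b1 (x + T) = b1 x" for x
    by (rule periodic_derivative[OF a(1) per(1)], rule periodic_derivative[OF b(1) per(2)])
  have pera2: "a2 (x + T) = a2 x" "b2 (x + T) = b2 x" "w (x + T) = w x" for x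
    by (rule periodic_derivative[OF a(2) pera(1)], rule periodic_derivative[OF b(2) pera(2)],
        rule periodic_derivative[OF w]) (simp add: per)
  have "\<exists>M. \<forall>x. \<bar>f x\<bar> \<le> M" if "continuous_on UNIV f" "\<And>x. f (x + T) = f x" for f :: "real \<Rightarrow> real"
    using periodic_bounded[of f T] that T by (metis real_norm_def)
  note bd = this
  obtain Ma Ma1 Ma2 Mb Mb1 Mb2 Mq Mw where M:
    "\<And>x. \<bar>a x\<bar> \<le> Ma" "\<And>x. \<bar>a1 x\<bar> \<le> Ma1" "\<And>x. \<bar>a2 x\<bar> \<le> Ma2"
    "\<And>x. \<bar>b x\<bar> \<le> Mb" "\<And>x. \<bar>b1 x\<bar> \<le> Mb1" "\<And>x. \<bar>b2 x\<bar> \<le> Mb2"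
    "\<And>x. \<bar>q x * a x\<bar> \<le> Mq" "\<And>x. \<bar>w x\<bar> \<le> Mw"
    using bd[OF ca(1) per(1)] bd[OF ca(2) pera(1)] bd[OF cont(1) pera2(1)] bd[OF ca(3) per(2)]
      bd[OF ca(4) pera(2)] bd[OF cont(2) pera2(2)] bd[OF ca(5)] bd[OF cont(3) pera2(3)] per(1,3)
    by (auto simp: per) metis
  have M0: "0 \<le> Ma" "0 \<le> Ma1" "0 \<le> Mb" "0 \<le> Mb1" "0 \<le> Mq"
    using M(1)[of 0] M(2)[of 0] M(4)[of 0] M(5)[of 0] M(7)[of 0] by linarith+
  \<comment> \<open>\<open>K / n\<close> bounds the error relative to the cutoff: every term carries
    at least one derivative of the cutoff, hence a factor \<open>1 / R\<close> with
    \<open>R = n T\<close>. The extra \<open>1 / R\<close> of the second derivative is weakened to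
    \<open>1 / T\<close>, using \<open>T \<le> R\<close>.\<close>
  define K where "K = (e1 * (10 / T * Ma + 2 * Ma1) + Mb + (e2 * (10 / T * Mb + 2 * Mb1) + Mq)) / T"
  have K: "K \<ge> 0" unfolding K_def using M0 T e by simp
  have perV: "cvec a b (x + T) = cvec a b x" for x by (simp add: cvec_def per)
  have nzV: "cvec a b x0 \<noteq> 0" using nz by (auto simp: cvec_def prod_eq_iff)
  obtain c where c: "c > 0" "\<And>n::nat. n > 0 \<Longrightarrow>
      c * Lp_weight p (real n * T) \<le> Lp_norm p (\<lambda>x. bump (real n * T) x *\<^sub>R cvec a b x)"
    using bump_periodic_lower_bound[OF p T cvec_continuous[OF ca(1,3)] perV nzV] by blast
  have main: "c \<le> \<bar>C\<bar> * K / real n" if n: "n > 0" for n :: nat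
  proof -
    define R where "R = real n * T"
    have "T * 1 \<le> T * real n" using n T by (intro mult_left_mono) auto
    then have R: "R > 0" "T \<le> R" using T by (auto simp: R_def mult.commute)
    define h h1 h2 where "h = bump R" and "h1 = bump' R" and "h2 = bump'' R"
    have h: "(h has_real_derivative h1 x) (at x)" "(h1 has_real_derivative h2 x) (at x)" for x
      unfolding h_def h1_def h2_def by (rule bump_derivative[OF R(1)], rule bump'_derivative[OF R(1)])
    have dh: "decays R h" "decays R h1" "decays R h2"
      unfolding h_def h1_def h2_def by (rule decays_bump[OF R(1)])+
    have ch: "continuous_on UNIV h" "continuous_on UNIV h1" "continuous_on UNIV h2"
      unfolding h_def h1_def h2_def by (rule bump_continuous[OF R(1)])+
    have h0: "h x > 0" "\<bar>h1 x\<bar> \<le> h x / R" "\<bar>h2 x\<bar> \<le> 10 / T * (h x / R)" for x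
    proof -
      show "h x > 0" "\<bar>h1 x\<bar> \<le> h x / R"
        unfolding h_def h1_def by (rule bump_bounds(1)[OF R(1)], rule bump'_bound[OF R(1)])
      have "\<bar>h2 x\<bar> \<le> 10 / R\<^sup>2 * h x"
        unfolding h_def h2_def by (rule bump''_bound[OF R(1)])
      also have "\<dots> = 10 / R * (h x / R)" by (simp add: power2_eq_square)
      also have "\<dots> \<le> 10 / T * (h x / R)"
        using R T \<open>h x > 0\<close> by (intro mult_right_mono divide_left_mono) auto
      finally show "\<bar>h2 x\<bar> \<le> 10 / T * (h x / R)" .
    qed
    \<comment> \<open>The commutator of the linearized operator with the cutoff:
      \<open>(\<alpha>, \<beta>)\<close> collects the terms of \<open>L (h V)\<close> in which a
      derivative falls on \<open>h\<close>, and the rest is \<open>l h V\<close> by the eigenvalue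
      equation.\<close>
    define \<alpha> \<beta> where "\<alpha> x = e1 * (h2 x * a x + 2 * (h1 x * a1 x)) + h1 x * b x"
      and "\<beta> x = e2 * (h2 x * b x + 2 * (h1 x * b1 x)) + - 1 * (h1 x * (q x * a x))" for x
    let ?V = "cvec (\<lambda>x. h x * a x) (\<lambda>x. h x * b x)"
    let ?V1 = "cvec (\<lambda>x. h1 x * a x + h x * a1 x) (\<lambda>x. h1 x * b x + h x * b1 x)"
    let ?V2 = "cvec (\<lambda>x. h2 x * a x + 2 * (h1 x * a1 x) + h x * a2 x) (\<lambda>x. h2 x * b x + 2 * (h1 x * b1 x) + h x * b2 x)"
    let ?W = "cvec (\<lambda>x. - (h1 x * b x + h x * b1 x)) (\<lambda>x. h1 x * (q x * a x) + h x * w x)"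
    let ?G = "cvec (\<lambda>x. l * (h x * a x) + \<alpha> x) (\<lambda>x. l * (h x * b x) + \<beta> x)"
    have d: "decays R (\<lambda>x. h x * a x)" "decays R (\<lambda>x. h x * b x)" "decays R (\<lambda>x. h1 x * a x)" "decays R (\<lambda>x. h1 x * b x)"
      "decays R (\<lambda>x. h x * a1 x)" "decays R (\<lambda>x. h x * b1 x)" "decays R (\<lambda>x. h1 x * a1 x)" "decays R (\<lambda>x. h1 x * b1 x)"
      "decays R (\<lambda>x. h2 x * a x)" "decays R (\<lambda>x. h2 x * b x)" "decays R (\<lambda>x. h x * a2 x)" "decays R (\<lambda>x. h x * b2 x)"
      "decays R (\<lambda>x. h1 x * (q x * a x))"
      by (rule decays_mult_bounded[OF dh(1) ca(1) M(1)] decays_mult_bounded[OF dh(1) ca(3) M(4)]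
          decays_mult_bounded[OF dh(2) ca(1) M(1)] decays_mult_bounded[OF dh(2) ca(3) M(4)]
          decays_mult_bounded[OF dh(1) ca(2) M(2)] decays_mult_bounded[OF dh(1) ca(4) M(5)]
          decays_mult_bounded[OF dh(2) ca(2) M(2)] decays_mult_bounded[OF dh(2) ca(4) M(5)]
          decays_mult_bounded[OF dh(3) ca(1) M(1)] decays_mult_bounded[OF dh(3) ca(3) M(4)]
          decays_mult_bounded[OF dh(1) cont(1) M(3)] decays_mult_bounded[OF dh(1) cont(2) M(6)]
          decays_mult_bounded[OF dh(2) ca(5) M(7)])+
    have "linearized_op p e1 e2 U ?V ?G"
      unfolding linearized_op_def
    proof (intro conjI exI)
      show "?V \<in> Lp_space p" "?V1 \<in> Lp_space p" "?V2 \<in> Lp_space p"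
        by (intro cvec_Lp_space[OF p R(1)] decays_add decays_cmult d)+
      show "?G \<in> Lp_space p" unfolding \<alpha>_def \<beta>_def
        by (intro cvec_Lp_space[OF p R(1)] decays_add decays_cmult d)+
      show "weak_derivative ?V ?V1"
        by (rule cvec_weak_derivative)
           (auto intro!: derivative_eq_intros h a b continuous_intros ca ch)
      show "weak_derivative ?V1 ?V2"
        by (rule cvec_weak_derivative)
           (auto intro!: derivative_eq_intros h a b continuous_intros ca ch cont)
      have "dflux (U x) (?V x) = cvec (\<lambda>x. - (h x * b x)) (\<lambda>x. h x * (q x * a x)) x" for x
        by (cases "U x") (simp add: cvec_def q)
      then have "(\<lambda>x. dflux (U x) (?V x)) = cvec (\<lambda>x. - (h x * b x)) (\<lambda>x. h x * (q x * a x))"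
        by blast
      moreover have "weak_derivative (cvec (\<lambda>x. - (h x * b x)) (\<lambda>x. h x * (q x * a x))) ?W"
      proof (rule cvec_weak_derivative)
        show "((\<lambda>x. h x * (q x * a x)) has_real_derivative h1 x * (q x * a x) + h x * w x) (at x)" for x
          using DERIV_mult[OF h(1)[of x] w[of x]] by (simp add: mult.commute add.commute)
      qed (auto intro!: derivative_eq_intros h b continuous_intros ca ch cont)
      ultimately show "weak_derivative (\<lambda>x. dflux (U x) (?V x)) ?W" by simp
      have "?G x = viscosity e1 e2 (?V2 x) - ?W x" for x
      proof -
        have 1: "l * (h x * a x) + \<alpha> x = e1 * (h2 x * a x + 2 * (h1 x * a1 x) + h x * a2 x) - - (h1 x * b x + h x * b1 x)"
          using arg_cong[OF eq(1)[of x], of "\<lambda>y. h x * y"] by (simp add: \<alpha>_def algebra_simps)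
        have 2: "l * (h x * b x) + \<beta> x = e2 * (h2 x * b x + 2 * (h1 x * b1 x) + h x * b2 x) - (h1 x * (q x * a x) + h x * w x)"
          using arg_cong[OF eq(2)[of x], of "\<lambda>y. h x * y"] by (simp add: \<beta>_def algebra_simps)
        show ?thesis unfolding cvec_def viscosity.simps 1 2 by simp
      qed
      then show "AE x in lborel. ?G x = viscosity e1 e2 (?V2 x) - ?W x" by simp
    qed
    from C[OF this] have 1: "Lp_norm p ?V \<le> C * Lp_norm p (\<lambda>x. cscale (complex_of_real l) (?V x) - ?G x)" .
    have "cscale (complex_of_real l) (?V x) - ?G x = cvec (\<lambda>x. - \<alpha> x) (\<lambda>x. - \<beta> x) x" for x
      by (simp add: cvec_def)
    then have 2: "(\<lambda>x. cscale (complex_of_real l) (?V x) - ?G x) = cvec (\<lambda>x. - \<alpha> x) (\<lambda>x. - \<beta> x)" by blast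
    have c\<alpha>\<beta>: "continuous_on UNIV (\<lambda>x. - \<alpha> x)" "continuous_on UNIV (\<lambda>x. - \<beta> x)"
      unfolding \<alpha>_def \<beta>_def by (intro continuous_intros ca ch)+
    have prod: "\<bar>u * v\<bar> \<le> k * M * y" if "\<bar>u\<bar> \<le> k * y" "\<bar>v\<bar> \<le> M" for u v k M y :: real
    proof -
      have "\<bar>u * v\<bar> \<le> (k * y) * M" unfolding abs_mult using that by (intro mult_mono) linarith+
      then show ?thesis by (simp add: mult.commute mult.left_commute)
    qed
    have tri: "\<bar>u + 2 * v\<bar> \<le> (k + 2 * m) * y" if "\<bar>u\<bar> \<le> k * y" "\<bar>v\<bar> \<le> m * y" for u v k m y :: real
    proof -
      have "\<bar>u + 2 * v\<bar> \<le> k * y + 2 * (m * y)" using that by linarith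
      then show ?thesis by (simp add: distrib_right)
    qed
    have "norm (cvec (\<lambda>x. - \<alpha> x) (\<lambda>x. - \<beta> x) x) \<le> K / real n * bump R x" for x
    proof -
      let ?y = "h x / R"
      have h1': "\<bar>h1 x\<bar> \<le> 1 * ?y" using h0 by simp
      have e\<alpha>: "\<bar>h2 x * a x + 2 * (h1 x * a1 x)\<bar> \<le> (10 / T * Ma + 2 * Ma1) * ?y"
        by (rule tri[OF prod[OF h0(3) M(1)]]) (use prod[OF h1' M(2)[of x]] in simp)
      have e\<beta>: "\<bar>h2 x * b x + 2 * (h1 x * b1 x)\<bar> \<le> (10 / T * Mb + 2 * Mb1) * ?y"
        by (rule tri[OF prod[OF h0(3) M(4)]]) (use prod[OF h1' M(5)[of x]] in simp)
      have "\<bar>\<alpha> x\<bar> \<le> \<bar>e1 * (h2 x * a x + 2 * (h1 x * a1 x))\<bar> + \<bar>h1 x * b x\<bar>"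
        unfolding \<alpha>_def by (rule abs_triangle_ineq)
      also have "\<dots> \<le> e1 * ((10 / T * Ma + 2 * Ma1) * ?y) + Mb * ?y"
        using mult_left_mono[OF e\<alpha>, of e1] prod[OF h1' M(4)[of x]] e by (simp add: abs_mult)
      finally have \<alpha>: "\<bar>\<alpha> x\<bar> \<le> (e1 * (10 / T * Ma + 2 * Ma1) + Mb) * ?y" by (simp only: distrib_right mult.assoc)
      have "\<bar>\<beta> x\<bar> \<le> \<bar>e2 * (h2 x * b x + 2 * (h1 x * b1 x))\<bar> + \<bar>- 1 * (h1 x * (q x * a x))\<bar>"
        unfolding \<beta>_def by (rule abs_triangle_ineq)
      also have "\<dots> \<le> e2 * ((10 / T * Mb + 2 * Mb1) * ?y) + Mq * ?y"
        using mult_left_mono[OF e\<beta>, of e2] prod[OF h1' M(7)[of x]] e by (simp add: abs_mult)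
      finally have \<beta>: "\<bar>\<beta> x\<bar> \<le> (e2 * (10 / T * Mb + 2 * Mb1) + Mq) * ?y" by (simp only: distrib_right mult.assoc)
      have "norm (cvec (\<lambda>x. - \<alpha> x) (\<lambda>x. - \<beta> x) x) \<le> \<bar>\<alpha> x\<bar> + \<bar>\<beta> x\<bar>"
        using cvec_norm_le[of "\<lambda>x. - \<alpha> x" "\<lambda>x. - \<beta> x" x] by simp
      also have "\<dots> \<le> (e1 * (10 / T * Ma + 2 * Ma1) + Mb + (e2 * (10 / T * Mb + 2 * Mb1) + Mq)) * ?y"
        using \<alpha> \<beta> by (simp only: distrib_right)
      also have "\<dots> = K / real n * bump R x"
        using T n by (simp add: K_def h_def R_def)
      finally show ?thesis .
    qed
    then have "Lp_norm p (cvec (\<lambda>x. - \<alpha> x) (\<lambda>x. - \<beta> x)) \<le> K / real n * Lp_weight p R"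
      using K n by (intro bump_dominated(2)[OF p R(1) cvec_continuous[OF c\<alpha>\<beta>]]) auto
    \<comment> \<open>The resolvent constant \<open>C\<close> may have either sign; since the norm
      is non-negative, \<open>C\<close> can be replaced by \<open>|C|\<close>.\<close>
    moreover have "0 \<le> Lp_norm p (cvec (\<lambda>x. - \<alpha> x) (\<lambda>x. - \<beta> x))"
    proof (cases "p = \<infinity>")
      case True
      have "0 \<le> ereal (norm (cvec (\<lambda>x. - \<alpha> x) (\<lambda>x. - \<beta> x) 0))" by simp
      also have "\<dots> \<le> ess_norm (cvec (\<lambda>x. - \<alpha> x) (\<lambda>x. - \<beta> x))"
        unfolding ess_norm_def
        by (rule esssup_ge_continuous) (intro continuous_on_norm cvec_continuous[OF c\<alpha>\<beta>])
      finally show ?thesis using True by (simp add: Lp_norm_def real_of_ereal_pos)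
    qed (simp add: Lp_norm_def)
    ultimately have "C * Lp_norm p (cvec (\<lambda>x. - \<alpha> x) (\<lambda>x. - \<beta> x)) \<le> \<bar>C\<bar> * (K / real n * Lp_weight p R)"
      by (intro mult_mono) auto
    moreover have "(\<lambda>x. bump (real n * T) x *\<^sub>R cvec a b x) = ?V"
      by (simp add: fun_eq_iff cvec_def h_def R_def scaleR_conv_of_real)
    then have "c * Lp_weight p R \<le> Lp_norm p ?V"
      using c(2)[OF n] by (simp add: R_def)
    ultimately have "c * Lp_weight p R \<le> (\<bar>C\<bar> * K / real n) * Lp_weight p R"
      using 1 unfolding 2 by simp
    then show ?thesis by (rule mult_right_le_imp_le) (rule Lp_weight_pos[OF R(1)])
  qed
  obtain n :: nat where "\<bar>C\<bar> * K / c < real n" using reals_Archimedean2 by blast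
  then have n: "\<bar>C\<bar> * K < real (Suc n) * c" using c(1) by (simp add: pos_divide_less_eq algebra_simps)
  have "c * real (Suc n) \<le> \<bar>C\<bar> * K"
    using main[of "Suc n"] by (simp add: pos_le_divide_eq del: of_nat_Suc)
  with n show False by (simp add: mult.commute del: of_nat_Suc)
qed

section \<open>Instability of periodic waves\<close>

lemma pressure_derivative: "(pressure has_real_derivative 2 - 6 * v\<^sup>2) (at v)"
proof -
  have p: "pressure = (\<lambda>v. 2 * v * (1 - v\<^sup>2))" by (simp add: fun_eq_iff pressure_eq)
  show ?thesis unfolding p
    by (auto intro!: derivative_eq_intros simp: power2_eq_square algebra_simps)
qed

lemma deriv_pressure: "deriv pressure v = 2 - 6 * v\<^sup>2"
  by (rule DERIV_imp_deriv[OF pressure_derivative])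

lemma stationary_solution_components:
  assumes "stationary_solution e1 e2 (vm, um) w"
  shows "((\<lambda>x. fst (w x)) has_real_derivative - (snd (w x) - um) / e1) (at x)"
    "((\<lambda>x. snd (w x)) has_real_derivative (pressure (fst (w x)) - pressure vm) / e2) (at x)"
proof -
  have "(w has_vector_derivative stationary_field e1 e2 (vm, um) (fst (w x), snd (w x))) (at x)"
    using assms by (simp add: stationary_solution_def)
  then have w: "(w has_vector_derivative (- (snd (w x) - um) / e1, (pressure (fst (w x)) - pressure vm) / e2)) (at x)"
    by (simp only: stationary_field.simps)
  from bounded_linear.has_vector_derivative[OF bounded_linear_fst w]
    bounded_linear.has_vector_derivative[OF bounded_linear_snd w]
  show "((\<lambda>x. fst (w x)) has_real_derivative - (snd (w x) - um) / e1) (at x)"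
    "((\<lambda>x. snd (w x)) has_real_derivative (pressure (fst (w x)) - pressure vm) / e2) (at x)"
    by (simp_all add: has_real_derivative_iff_has_vector_derivative)
qed

lemma stationary_solutionI:
  assumes "\<And>x. ((\<lambda>x. fst (w x)) has_real_derivative - (snd (w x) - um) / e1) (at x)"
    "\<And>x. ((\<lambda>x. snd (w x)) has_real_derivative (pressure (fst (w x)) - pressure vm) / e2) (at x)"
  shows "stationary_solution e1 e2 (vm, um) w"
  unfolding stationary_solution_def
proof
  fix x
  have "((\<lambda>x. (fst (w x), snd (w x))) has_vector_derivative
      (- (snd (w x) - um) / e1, (pressure (fst (w x)) - pressure vm) / e2)) (at x)"
    using assms unfolding has_real_derivative_iff_has_vector_derivative
    by (intro has_vector_derivative_Pair)
  moreover have "stationary_field e1 e2 (vm, um) (w x) = (- (snd (w x) - um) / e1, (pressure (fst (w x)) - pressure vm) / e2)"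
    by (metis prod.collapse stationary_field.simps)
  ultimately show "(w has_vector_derivative stationary_field e1 e2 (vm, um) (w x)) (at x)" by simp
qed

lemma periodic_derivative_zero:
  fixes f :: "real \<Rightarrow> real"
  assumes "\<And>x. (f has_real_derivative f' x) (at x)" "\<And>x. f (x + T) = f x" "T > 0"
  obtains z where "f' z = 0"
proof -
  obtain z where "0 < z" "z < T" "f T - f 0 = (T - 0) * f' z"
    using MVT2[of 0 T f f'] assms by blast
  then show ?thesis using assms(2)[of 0] assms(3) that by simp
qed

text \<open>Differentiating the profile equation \<open>e1 e2 v'' = - (p(v) - p(vm))\<close> shows
  that \<open>g = v'\<close> solves \<open>e g'' + q g = 0\<close>; it has a zero because
  \<open>v\<close> is periodic, and the zero is simple. This supplies the negative direction. The
  eigenfunction of the pencil changes sign over \<open>P\<close>, so the eigenfunction of the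
  linearization has period \<open>2 P\<close>.\<close>

theorem stationary_periodic_unstable:
  assumes e: "e1 > 0" "e2 > 0" and U: "stationary_solution e1 e2 (vm, um) U"
    and np: "nonconstant_periodic U" and p: "1 \<le> p"
  shows "spectrally_unstable p e1 e2 U"
proof -
  obtain T where T: "T > 0" "\<And>x. U (x + T) = U x" and nc: "\<not> U constant_on UNIV"
    using np unfolding nonconstant_periodic_def periodic_with_def by blast
  define v u where "v x = fst (U x)" and "u x = snd (U x)" for x
  have per: "v (x + T) = v x" "u (x + T) = u x" for x by (simp_all add: v_def u_def T)
  define g g1 q where "g x = - (u x - um) / e1" and "g1 x = - (pressure (v x) - pressure vm) / (e1 * e2)"
    and "q x = 2 - 6 * (v x)\<^sup>2" for x
  have v: "(v has_real_derivative g x) (at x)" for x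
    using stationary_solution_components(1)[OF U, of x] by (simp add: v_def[abs_def] u_def g_def)
  have u: "(u has_real_derivative - e1 * g1 x) (at x)" for x
  proof -
    have "- e1 * g1 x = (pressure (v x) - pressure vm) / e2" using e by (simp add: g1_def field_simps)
    then show ?thesis using stationary_solution_components(2)[OF U, of x] by (simp add: v_def u_def[abs_def])
  qed
  have g: "(g has_real_derivative g1 x) (at x)" for x
  proof -
    have "g = (\<lambda>x. - (1 / e1) * (u x - um))" using e by (simp add: g_def fun_eq_iff field_simps)
    then show ?thesis using e by (auto intro!: derivative_eq_intros u)
  qed
  have pv: "((\<lambda>x. pressure (v x)) has_real_derivative q x * g x) (at x)" for x
    unfolding q_def by (rule DERIV_chain2[OF pressure_derivative v])
  have g1: "(g1 has_real_derivative - (q x * g x) / (e1 * e2)) (at x)" for x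
  proof -
    have "g1 = (\<lambda>x. - (1 / (e1 * e2)) * (pressure (v x) - pressure vm))" using e by (simp add: g1_def fun_eq_iff field_simps)
    then show ?thesis using e by (auto intro!: derivative_eq_intros pv)
  qed
  have cv: "continuous_on S v" and cg: "continuous_on S g" for S
    by (rule differentiable_real_continuous_on[OF v],
        rule differentiable_real_continuous_on[OF g])
  have cq: "continuous_on S q" for S unfolding q_def by (intro continuous_intros cv)
  have perq: "q (x + T) = q x" and perg: "g (x + T) = g x" for x by (simp_all add: q_def g_def per)
  obtain z where z: "g z = 0" using periodic_derivative_zero[OF v per(1) T(1)] by blast
  \<comment> \<open>A double zero of \<open>g\<close> would make it vanish identically, by
    uniqueness for the linear equation, and the wave would be constant.\<close>
  have "g1 z \<noteq> 0"
  proof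
    assume "g1 z = 0"
    obtain Q where Q: "Q > 0" "\<And>x. \<bar>q x\<bar> \<le> Q"
      using periodic_bounded[of q T] perq T(1) cq by (metis real_norm_def)
    have zero: "(g x, g1 x) = 0" for x
    proof (rule vanishing_of_linear_growth[of "\<lambda>x. (g x, g1 x)" "\<lambda>x. (g1 x, - (q x * g x) / (e1 * e2))"
          "1 + Q / (e1 * e2)" z x])
      show "((\<lambda>x. (g x, g1 x)) has_vector_derivative (g1 x, - (q x * g x) / (e1 * e2))) (at x)" for x
        using g g1 unfolding has_real_derivative_iff_has_vector_derivative
        by (intro has_vector_derivative_Pair)
      show "norm (g1 x, - (q x * g x) / (e1 * e2)) \<le> (1 + Q / (e1 * e2)) * norm (g x, g1 x)" for x
      proof -
        let ?n = "norm (g x, g1 x)"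
        have n: "\<bar>g x\<bar> \<le> ?n" "\<bar>g1 x\<bar> \<le> ?n" by (metis norm_fst_le real_norm_def, metis norm_snd_le real_norm_def)
        have "norm (g1 x, - (q x * g x) / (e1 * e2)) \<le> \<bar>g1 x\<bar> + \<bar>q x\<bar> * \<bar>g x\<bar> / (e1 * e2)"
          using norm_Pair_le[of "g1 x" "- (q x * g x) / (e1 * e2)"] e by (simp add: abs_mult)
        also have "\<dots> \<le> ?n + Q * ?n / (e1 * e2)"
          using n Q e by (intro add_mono divide_right_mono mult_mono) auto
        finally show ?thesis by (simp add: algebra_simps)
      qed
      show "(g z, g1 z) = 0" using z \<open>g1 z = 0\<close> by (simp add: zero_prod_def)
    qed
    have "u x = um" for x using zero[of x] e by (simp add: g_def zero_prod_def)
    moreover have "v x = v 0" for x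
      using DERIV_isconst_all[of v x 0] v zero by (auto simp: zero_prod_def)
    ultimately have "U x = (v 0, um)" for x unfolding v_def u_def by (metis prod.collapse)
    then show False using nc unfolding constant_on_def by blast
  qed
  let ?e = "e1 * e2" and ?k = "e1 + e2"
  have e': "?e > 0" "?k > 0" using e by simp_all
  obtain N :: nat and B B1 B2 where N: "N > 0" and B: "antiperiodic_C2 (real N * T) B B1 B2"
    "base_form (real N * T) ?e q B1 B2 < 0"
    using hill_antiperiodic_negative_direction[OF e'(1) T(1) cq perq g g1 perg z \<open>g1 z \<noteq> 0\<close>] by blast
  define P where "P = real N * T"
  have P: "P > 0" using N T by (simp add: P_def)
  have perqP: "q (x + P) = q x" for x
    using periodic_int_shift[of q T x "int N"] perq by (simp add: P_def)
  obtain l A A1 A2 Y x0 where l: "l > 0" and sol: "antiperiodic_pencil_solution P ?e ?k q l (\<lambda>_. 0) A A1 A2 Y"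
    and nz: "A x0 \<noteq> 0"
    using antiperiodic_eigenfunction_exists[OF e' P cq perqP B[folded P_def]] by blast
  have A: "(A has_real_derivative A1 x) (at x)" "(A1 has_real_derivative A2 x) (at x)"
    "(A2 has_real_derivative (Y x - q x * A1 x) / ?e) (at x)"
    "(Y has_real_derivative l * ?k * A2 x - l\<^sup>2 * A x) (at x)" "A (x + P) = - A x" for x
    using sol by (simp_all add: antiperiodic_pencil_solution_def)
  have antiA1: "A1 (x + P) = - A1 x" for x by (rule antiperiodic_derivative[OF A(1,5)])
  have antiA2: "A2 (x + P) = - A2 x" for x by (rule antiperiodic_derivative[OF A(2) antiA1])
  define w where "w x = - (12 * v x * g x) * A1 x + q x * A2 x" for x
  have q': "(q has_real_derivative - (12 * v x * g x)) (at x)" for x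
    unfolding q_def[abs_def] by (auto intro!: derivative_eq_intros v)
  have w: "((\<lambda>x. q x * A1 x) has_real_derivative w x) (at x)" for x
    using DERIV_mult[OF q' A(2)[of x]] by (simp add: w_def mult.commute)
  have cA: "continuous_on S A" "continuous_on S A1" "continuous_on S A2" "continuous_on S Y" for S
    by (rule differentiable_real_continuous_on[OF A(1)],
        rule differentiable_real_continuous_on[OF A(2)],
        rule differentiable_real_continuous_on[OF A(3)],
        rule differentiable_real_continuous_on[OF A(4)])
  have cw: "continuous_on UNIV w" unfolding w_def by (intro continuous_intros cv cg cq cA)
  \<comment> \<open>\<open>(Y - q A1) / ?e\<close> is the third derivative of \<open>A\<close>. The
    fourth comes from differentiating this expression, with \<open>Y'\<close> given by the pencil
    equation and \<open>w = (q A1)'\<close>; this makes \<open>b\<close> twice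
    differentiable.\<close>
  define b b1 b2 where "b x = l * A x - e1 * A2 x" and "b1 x = l * A1 x - e1 * ((Y x - q x * A1 x) / ?e)"
    and "b2 x = l * A2 x - e1 * ((l * ?k * A2 x - l\<^sup>2 * A x - w x) / ?e)" for x
  have "\<exists>x. A1 x \<noteq> 0 \<or> b x \<noteq> 0"
  proof (rule ccontr)
    assume "\<nexists>x. A1 x \<noteq> 0 \<or> b x \<noteq> 0"
    then have 0: "A1 x = 0" "b x = 0" for x by blast+
    have "A2 x = 0" for x using DERIV_unique[OF A(2)[of x]] 0(1) by (metis DERIV_const ext)
    then have "A x0 = 0" using 0(2)[of x0] l by (simp add: b_def)
    then show False using nz by simp
  qed
  then obtain y where y: "A1 y \<noteq> 0 \<or> b y \<noteq> 0" by blast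
  have "complex_of_real l \<in> spectrum p e1 e2 U"
  proof (rule periodic_eigenvalue_in_spectrum[OF p, of "2 * P" e1 e2 A1 A2 "\<lambda>x. (Y x - q x * A1 x) / ?e" b b1 b2 q U w l y])
    show "(b has_real_derivative b1 x) (at x)" for x
      unfolding b_def[abs_def] b1_def by (intro DERIV_diff DERIV_cmult A)
    show "(b1 has_real_derivative b2 x) (at x)" for x
      unfolding b1_def[abs_def] b2_def by (intro DERIV_diff DERIV_cmult DERIV_cdivide A w)
    show "q x = deriv pressure (fst (U x))" for x
      by (simp add: q_def v_def deriv_pressure)
    show "continuous_on UNIV (\<lambda>x. (Y x - q x * A1 x) / ?e)" "continuous_on UNIV b2"
      unfolding b2_def using e by (intro continuous_intros cA cq cw; simp)+
    show "A1 (x + 2 * P) = A1 x" for x using antiA1[of "x + P"] antiA1[of x] by (simp add: algebra_simps)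
    show "b (x + 2 * P) = b x" for x
      using antiA2[of "x + P"] antiA2[of x] A(5)[of "x + P"] A(5)[of x] by (simp add: b_def algebra_simps)
    show "q (x + 2 * P) = q x" for x using perqP[of "x + P"] perqP[of x] by (simp add: algebra_simps)
    show "l * A1 x = e1 * ((Y x - q x * A1 x) / ?e) + b1 x" for x by (simp add: b1_def)
    show "l * b x = e2 * b2 x - w x" for x
      using e by (simp add: b_def b2_def field_simps power2_eq_square)
  qed (use P e A w cw y in auto)
  moreover have "Re (complex_of_real l) > 0" using l by simp
  ultimately show ?thesis unfolding spectrally_unstable_def by blast
qed

section \<open>Periodic travelling waves do not move\<close>

lemma decreasing_periodic_constant:
  fixes E :: "real \<Rightarrow> real"
  assumes "\<And>x y. x \<le> y \<Longrightarrow> E y \<le> E x" "\<And>x. E (x + T) = E x" "T > 0"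
  shows "E x = E y"
proof -
  have le: "E x \<le> E y" for x y
  proof -
    obtain n :: nat where "(y - x) / T < real n" using reals_Archimedean2 by blast
    then have "y \<le> x + real n * T" using \<open>T > 0\<close> by (simp add: pos_divide_less_eq)
    then have "E (x + of_int (int n) * T) \<le> E y" using assms(1) by simp
    then show ?thesis using periodic_int_shift[of E T x "int n"] assms(2) by simp
  qed
  show ?thesis by (rule antisym[OF le le])
qed

text \<open>The energy of the profile equation is monotone along the profile with derivative
  \<open>- s (e1 + e2) v'\<^sup>2\<close>, so periodicity forces \<open>s = 0\<close>.\<close>

theorem periodic_traveling_wave_stationary:
  assumes e: "e1 > 0" "e2 > 0" and W: "periodic_traveling_wave e1 e2 s U"
  shows "s = 0 \<and> (\<exists>vm um. stationary_solution e1 e2 (vm, um) U)"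
proof -
  obtain T where T: "T > 0" "\<And>x. U (x + T) = U x" and nc: "\<not> U constant_on UNIV"
    using W unfolding periodic_traveling_wave_def nonconstant_periodic_def periodic_with_def by blast
  define v u v1 u1 v2 u2 where "v x = fst (U x)" and "u x = snd (U x)"
    and "v1 = deriv v" and "u1 = deriv u" and "v2 = deriv v1" and "u2 = deriv u1" for x
  have per: "v (x + T) = v x" "u (x + T) = u x" for x by (simp_all add: v_def u_def T)
  have sys: "p_system_solution e1 e2 (\<lambda>t x. v (x - s * t)) (\<lambda>t x. u (x - s * t))"
    using W unfolding periodic_traveling_wave_def v_def u_def by blast
  have all: "v differentiable at x \<and> v1 differentiable at x \<and> u differentiable at x \<and> u1 differentiable at x \<and>
      deriv (\<lambda>\<tau>. v (x - s * \<tau>)) 0 - u1 x = e1 * v2 x \<and>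
      deriv (\<lambda>\<tau>. u (x - s * \<tau>)) 0 + deriv (\<lambda>y. pressure (v y)) x = e2 * u2 x" for x
    using sys[unfolded p_system_solution_def, rule_format, of x 0]
    by (simp add: v1_def u1_def v2_def u2_def)
  have D: "(v has_real_derivative v1 x) (at x)" "(u has_real_derivative u1 x) (at x)"
    "(v1 has_real_derivative v2 x) (at x)" "(u1 has_real_derivative u2 x) (at x)" for x
    using all[of x] by (simp_all add: v1_def u1_def v2_def u2_def DERIV_deriv_iff_real_differentiable)
  have pv: "((\<lambda>x. pressure (v x)) has_real_derivative (2 - 6 * (v x)\<^sup>2) * v1 x) (at x)" for x
    by (rule DERIV_chain2[OF pressure_derivative D(1)])
  have time: "deriv (\<lambda>\<tau>. f (x - s * \<tau>)) 0 = - s * f' x" if "(f has_real_derivative f' x) (at x)" for f f' and x :: real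
  proof (rule DERIV_imp_deriv)
    have "((\<lambda>\<tau>. f (x - s * \<tau>)) has_real_derivative f' x * (- s)) (at 0)"
      by (rule DERIV_chain2[of f "f' x"]) (use that in \<open>auto intro!: derivative_eq_intros\<close>)
    then show "((\<lambda>\<tau>. f (x - s * \<tau>)) has_real_derivative - s * f' x) (at 0)" by (simp add: mult.commute)
  qed
  have eq1: "- s * v1 x - u1 x = e1 * v2 x" and eq2: "- s * u1 x + (2 - 6 * (v x)\<^sup>2) * v1 x = e2 * u2 x" for x
    using all[of x] time[of v v1 x] time[of u u1 x] D DERIV_imp_deriv[OF pv[of x]] by auto
  \<comment> \<open>Both equations are conservation laws, so the travelling-wave equations integrate
    once; \<open>c1\<close> and \<open>c2\<close> are the integration constants.\<close>
  define c1 c2 where "c1 = e1 * v1 0 + s * v 0 + u 0" and "c2 = e2 * u1 0 + s * u 0 - pressure (v 0)"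
  have "((\<lambda>x. e1 * v1 x + s * v x + u x) has_real_derivative 0) (at x)" for x
  proof -
    have "((\<lambda>x. e1 * v1 x + s * v x + u x) has_real_derivative e1 * v2 x + s * v1 x + u1 x) (at x)"
      by (intro DERIV_add DERIV_cmult D)
    moreover have "e1 * v2 x + s * v1 x + u1 x = 0"
      unfolding eq1[of x, symmetric] by simp
    ultimately show ?thesis by simp
  qed
  then have c1: "e1 * v1 x + s * v x + u x = c1" for x
    using DERIV_isconst_all[of "\<lambda>x. e1 * v1 x + s * v x + u x" x 0] by (simp add: c1_def)
  have "((\<lambda>x. e2 * u1 x + s * u x - pressure (v x)) has_real_derivative 0) (at x)" for x
  proof -
    have "((\<lambda>x. e2 * u1 x + s * u x - pressure (v x)) has_real_derivative
        e2 * u2 x + s * u1 x - (2 - 6 * (v x)\<^sup>2) * v1 x) (at x)"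
      by (intro DERIV_add DERIV_diff DERIV_cmult D pv)
    moreover have "e2 * u2 x + s * u1 x - (2 - 6 * (v x)\<^sup>2) * v1 x = 0"
      unfolding eq2[of x, symmetric] by simp
    ultimately show ?thesis by simp
  qed
  then have c2: "e2 * u1 x + s * u x - pressure (v x) = c2" for x
    using DERIV_isconst_all[of "\<lambda>x. e2 * u1 x + s * u x - pressure (v x)" x 0] by (simp add: c2_def)
  have perv1: "v1 (x + T) = v1 x" for x by (rule periodic_derivative[OF D(1) per(1)])
  have "s = 0"
  proof (rule ccontr)
    assume s: "s \<noteq> 0"
    \<comment> \<open>Eliminating \<open>u\<close> gives
      \<open>e1 e2 v'' + s^2 v + p(v) - (s c1 - c2) = - s (e1 + e2) v'\<close>. \<open>E\<close> is
      the mechanical energy of the left-hand side; the right-hand side acts as friction for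
      \<open>s > 0\<close> and as negative friction for \<open>s < 0\<close>.\<close>
    define E where "E x = e1 * e2 * (v1 x)\<^sup>2 / 2 + s\<^sup>2 * (v x)\<^sup>2 / 2 + ((v x)\<^sup>2 - (v x) ^ 4 / 2) - (s * c1 - c2) * v x" for x
    have E: "(E has_real_derivative - s * (e1 + e2) * (v1 x)\<^sup>2) (at x)" for x
    proof -
      have u1: "u1 x = - s * v1 x - e1 * v2 x" using eq1[of x] by simp
      have u: "u x = c1 - e1 * v1 x - s * v x" using c1[of x] by simp
      have "e2 * (- s * v1 x - e1 * v2 x) + s * (c1 - e1 * v1 x - s * v x) - 2 * v x * (1 - (v x)\<^sup>2) = c2"
        using c2[of x] unfolding u u1 pressure_eq .
      then have key: "e1 * e2 * v2 x + s\<^sup>2 * v x + 2 * v x * (1 - (v x)\<^sup>2) - (s * c1 - c2) = - s * (e1 + e2) * v1 x"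
        by (simp add: algebra_simps power2_eq_square)
      have "(E has_real_derivative (e1 * e2 * v2 x + s\<^sup>2 * v x + 2 * v x * (1 - (v x)\<^sup>2) - (s * c1 - c2)) * v1 x) (at x)"
        unfolding E_def[abs_def]
        by (auto intro!: derivative_eq_intros D simp: algebra_simps power2_eq_square power3_eq_cube)
      then show ?thesis unfolding key by (simp add: power2_eq_square mult.assoc)
    qed
    have perE: "E (x + T) = E x" for x by (simp add: E_def per perv1)
    have const: "E x = E y" for x y
    proof (cases "s > 0")
      case True
      show ?thesis
      proof (rule decreasing_periodic_constant[of E T])
        show "E y \<le> E x" if "x \<le> y" for x y
        proof (rule DERIV_nonpos_imp_nonincreasing[OF that])
          fix t
          have "- s * (e1 + e2) * (v1 t)\<^sup>2 \<le> 0" using True e by simp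
          with E[of t] show "\<exists>d. (E has_real_derivative d) (at t) \<and> d \<le> 0" by blast
        qed
      qed (use perE T in auto)
    next
      case False
      have "- E x = - E y"
      proof (rule decreasing_periodic_constant[of "\<lambda>x. - E x" T])
        show "- E y \<le> - E x" if "x \<le> y" for x y
        proof -
          have "E x \<le> E y"
          proof (rule DERIV_nonneg_imp_nondecreasing[OF that])
            fix t
            have "0 \<le> - s * (e1 + e2) * (v1 t)\<^sup>2" using False e by (intro mult_nonneg_nonneg) auto
            with E[of t] show "\<exists>d. (E has_real_derivative d) (at t) \<and> 0 \<le> d" by blast
          qed
          then show ?thesis by simp
        qed
      qed (use perE T in auto)
      then show ?thesis by simp
    qed
    have v1: "v1 x = 0" for x
    proof -
      have "E = (\<lambda>_. E 0)" using const by blast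
      then have "(E has_real_derivative 0) (at x)" by (metis DERIV_const)
      then have "- s * (e1 + e2) * (v1 x)\<^sup>2 = 0" using E DERIV_unique by blast
      then show ?thesis using s e by simp
    qed
    have vx: "v x = v 0" for x using DERIV_isconst_all[of v x 0] D(1) v1 by auto
    have "u x = c1 - s * v 0" for x using c1[of x] v1[of x] vx[of x] by simp
    with vx have "U x = (v 0, c1 - s * v 0)" for x unfolding v_def u_def by (metis prod.collapse)
    then show False using nc unfolding constant_on_def by blast
  qed
  \<comment> \<open>At a zero of \<open>u'\<close> the second first integral with
    \<open>s = 0\<close> reads \<open>p(v z) = - c2\<close>, so \<open>(v z, c1)\<close> is a rest
    point of the integrated system.\<close>
  obtain z where z: "u1 z = 0" using periodic_derivative_zero[OF D(2) per(2) T(1)] by blast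
  have "stationary_solution e1 e2 (v z, c1) U"
  proof (rule stationary_solutionI)
    fix x
    have "- (snd (U x) - c1) / e1 = v1 x" using c1[of x] \<open>s = 0\<close> e by (simp add: u_def field_simps)
    then show "((\<lambda>x. fst (U x)) has_real_derivative - (snd (U x) - c1) / e1) (at x)"
      using D(1)[of x] by (simp add: v_def[abs_def])
    have "(pressure (fst (U x)) - pressure (v z)) / e2 = u1 x"
      using c2[of x] c2[of z] z \<open>s = 0\<close> e by (simp add: v_def field_simps)
    then show "((\<lambda>x. snd (U x)) has_real_derivative (pressure (fst (U x)) - pressure (v z)) / e2) (at x)"
      using D(2)[of x] by (simp add: u_def[abs_def])
  qed
  with \<open>s = 0\<close> show ?thesis by blast
qed

section \<open>The periodic orbits\<close>

lemma real_cos_gt: "\<bar>d\<bar> < s \<Longrightarrow> s + d * cos \<theta> > (0::real)"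
proof -
  assume "\<bar>d\<bar> < s"
  have "\<bar>d * cos \<theta>\<bar> \<le> \<bar>d\<bar> * 1" unfolding abs_mult by (intro mult_left_mono) auto
  with \<open>\<bar>d\<bar> < s\<close> show ?thesis by linarith
qed

text \<open>\<open>\<phi>\<close> is the angle as a function of time, \<open>\<Theta>\<close> the time as a function of the angle.\<close>

lemma angle_solution:
  fixes s d r :: real
  assumes sd: "\<bar>d\<bar> < s" and r: "r > 0"
  defines "T \<equiv> r * integral {0..2 * pi} (\<lambda>\<theta>. 1 / sqrt (s + d * cos \<theta>))"
  obtains \<phi> \<Theta> :: "real \<Rightarrow> real" where
    "\<phi> 0 = 0" "\<And>x. (\<phi> has_real_derivative sqrt (s + d * cos (\<phi> x)) / r) (at x)"
    "\<And>x. \<Theta> (\<phi> x) = x" "\<And>\<theta>. \<phi> (\<Theta> \<theta>) = \<theta>" "strict_mono \<Theta>"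
    "\<And>x. \<phi> (x + T) = \<phi> x + 2 * pi" "T > 0"
proof -
  have pos: "s + d * cos \<theta> > 0" for \<theta> by (rule real_cos_gt[OF sd])
  define m where "m = s - \<bar>d\<bar>"
  have m: "m > 0" using sd by (simp add: m_def)
  have mle: "m \<le> s + d * cos \<theta>" for \<theta>
  proof -
    have "\<bar>d * cos \<theta>\<bar> \<le> \<bar>d\<bar> * 1" unfolding abs_mult by (intro mult_left_mono) auto
    then show ?thesis unfolding m_def by linarith
  qed
  let ?g = "\<lambda>\<theta>. sqrt (s + d * cos \<theta>) / r"
  have dg: "(?g has_real_derivative - d * sin \<theta> / (2 * sqrt (s + d * cos \<theta>)) / r) (at \<theta>)" for \<theta>
    using pos[of \<theta>] r by (auto intro!: derivative_eq_intros simp: field_simps)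
  \<comment> \<open>The summand \<open>1\<close> keeps the Lipschitz constant positive when
    \<open>d = 0\<close>.\<close>
  define L where "L = \<bar>d\<bar> / (2 * sqrt m) / r + 1"
  have L: "L > 0" unfolding L_def using m r by (intro add_nonneg_pos) auto
  have "\<bar>- d * sin \<theta> / (2 * sqrt (s + d * cos \<theta>)) / r\<bar> \<le> L" for \<theta>
  proof -
    have "\<bar>- d * sin \<theta> / (2 * sqrt (s + d * cos \<theta>)) / r\<bar> = \<bar>d\<bar> * \<bar>sin \<theta>\<bar> / (2 * sqrt (s + d * cos \<theta>)) / r"
      using pos[of \<theta>] r by (simp add: abs_mult)
    also have "\<dots> \<le> \<bar>d\<bar> * 1 / (2 * sqrt m) / r"
      using m r mle[of \<theta>] by (intro divide_right_mono frac_le mult_left_mono mult_nonneg_nonneg) auto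
    finally show ?thesis by (simp add: L_def)
  qed
  then have lip: "\<bar>?g y - ?g z\<bar> \<le> L * \<bar>y - z\<bar>" for y z
    using field_differentiable_bound[of UNIV ?g "\<lambda>\<theta>. - d * sin \<theta> / (2 * sqrt (s + d * cos \<theta>)) / r" L y z] dg by auto
  have cg: "continuous_on S ?g" for S
    by (rule differentiable_real_continuous_on[OF dg])
  have "\<exists>y. y 0 = 0 \<and> (\<forall>x. (y has_vector_derivative ?g (y x)) (at x))"
  proof (rule global_lipschitz_solution[where G = "\<lambda>_. ?g" and C = "?g 0", OF L])
    show "norm (?g y - ?g z) \<le> L * norm (y - z)" for y z :: real using lip by simp
    show "continuous_on UNIV (\<lambda>x. ?g (y x))" if "continuous_on UNIV y" for y :: "real \<Rightarrow> real"
      by (rule continuous_on_compose2[OF cg that]) auto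
    show "norm (?g 0) \<le> ?g 0" using pos[of 0] r by simp
  qed
  then obtain \<phi> where \<phi>: "\<phi> 0 = 0" "\<And>x. (\<phi> has_real_derivative ?g (\<phi> x)) (at x)"
    by (auto simp: has_real_derivative_iff_has_vector_derivative)
  let ?h = "\<lambda>\<theta>. r * (1 / sqrt (s + d * cos \<theta>))"
  have ch: "continuous_on S ?h" for S
    using pos by (intro continuous_intros) (auto simp: less_imp_neq[symmetric])
  obtain \<Theta> where \<Theta>: "\<Theta> 0 = 0" "\<And>x. (\<Theta> has_real_derivative ?h x) (at x)"
    using primitive_exists[OF ch] by (auto simp: has_real_derivative_iff_has_vector_derivative)
  have sm: "strict_mono \<Theta>"
  proof (rule strict_monoI)
    fix x y :: real assume "x < y"
    then show "\<Theta> x < \<Theta> y"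
    proof (rule DERIV_pos_imp_increasing)
      fix t
      have "?h t > 0" using pos[of t] r by simp
      with \<Theta>(2)[of t] show "\<exists>z. (\<Theta> has_real_derivative z) (at t) \<and> 0 < z" by blast
    qed
  qed
  have inv1: "\<Theta> (\<phi> x) = x" for x
  proof -
    have "((\<lambda>x. \<Theta> (\<phi> x) - x) has_real_derivative 0) (at x)" for x
    proof -
      have "((\<lambda>x. \<Theta> (\<phi> x) - x) has_real_derivative ?h (\<phi> x) * ?g (\<phi> x) - 1) (at x)"
        by (intro DERIV_diff DERIV_chain2[OF \<Theta>(2)] \<phi>(2) DERIV_ident)
      then show ?thesis using pos[of "\<phi> x"] r by simp
    qed
    then show ?thesis using DERIV_isconst_all[of "\<lambda>x. \<Theta> (\<phi> x) - x" x 0] \<phi>(1) \<Theta>(1) by simp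
  qed
  have inj: "\<Theta> x = \<Theta> y \<longleftrightarrow> x = y" for x y using strict_mono_eq[OF sm] .
  have inv2: "\<phi> (\<Theta> \<theta>) = \<theta>" for \<theta>
    using inv1[of "\<Theta> \<theta>"] inj by blast
  have "(?h has_integral \<Theta> (2 * pi) - \<Theta> 0) {0..2 * pi}"
    by (rule has_integral_real_FTC[OF \<Theta>(2)]) simp
  then have T: "\<Theta> (2 * pi) = T"
    unfolding T_def using \<Theta>(1) by (metis integral_mult_right integral_unique diff_zero)
  have "\<Theta> (\<theta> + 2 * pi) = \<Theta> \<theta> + T" for \<theta>
  proof -
    have "((\<lambda>\<theta>. \<Theta> (\<theta> + 2 * pi) - \<Theta> \<theta>) has_real_derivative 0) (at \<theta>)" for \<theta>
      using DERIV_diff[OF \<Theta>(2)[of "\<theta> + 2 * pi", THEN DERIV_shift[THEN iffD1]] \<Theta>(2)[of \<theta>]] by simp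
    then show ?thesis
      using DERIV_isconst_all[of "\<lambda>\<theta>. \<Theta> (\<theta> + 2 * pi) - \<Theta> \<theta>" \<theta> 0] \<Theta>(1) T by simp
  qed
  then have "\<Theta> (\<phi> x + 2 * pi) = \<Theta> (\<phi> (x + T))" for x
    by (simp add: inv1)
  then have per: "\<phi> (x + T) = \<phi> x + 2 * pi" for x using inj by metis
  have "T > 0" using strict_monoD[OF sm, of 0 "2 * pi"] T \<Theta>(1) by simp
  show ?thesis by (rule that[OF \<phi> inv1 inv2 sm per \<open>T > 0\<close>])
qed

section \<open>The Hamiltonian and the explicit orbits\<close>

definition pot :: "real \<Rightarrow> real \<Rightarrow> real" where
  "pot pm v = v\<^sup>2 - v ^ 4 / 2 - pm * v"

lemma pot_derivative: "(pot pm has_real_derivative pressure v - pm) (at v)"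
  unfolding pot_def[abs_def] pressure_eq
  by (auto intro!: derivative_eq_intros simp: algebra_simps power2_eq_square power3_eq_cube)

text \<open>As \<open>v' = - (u - um) / e1\<close>, the second summand is the kinetic energy
  \<open>e1 e2 v'^2 / 2\<close> of the profile equation, and \<open>pot\<close> is a primitive of
  its restoring force \<open>p(v) - pm\<close>.\<close>

definition energy :: "real \<Rightarrow> real \<Rightarrow> real \<times> real \<Rightarrow> real \<times> real \<Rightarrow> real" where
  "energy e1 e2 Um z = pot (pressure (fst Um)) (fst z) + e2 / (2 * e1) * (snd z - snd Um)\<^sup>2"

lemma energy_conserved:
  assumes e: "e1 > 0" "e2 > 0" and w: "stationary_solution e1 e2 (vm, um) w"
  shows "energy e1 e2 (vm, um) (w x) = energy e1 e2 (vm, um) (w y)"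
proof -
  note D = stationary_solution_components[OF w]
  have "((\<lambda>x. energy e1 e2 (vm, um) (w x)) has_real_derivative 0) (at x)" for x
  proof -
    have "((\<lambda>x. pot (pressure vm) (fst (w x)) + e2 / (2 * e1) * (snd (w x) - um)\<^sup>2) has_real_derivative
      (pressure (fst (w x)) - pressure vm) * (- (snd (w x) - um) / e1) +
      e2 / (2 * e1) * (2 * (snd (w x) - um) * ((pressure (fst (w x)) - pressure vm) / e2))) (at x)"
    proof (intro DERIV_add DERIV_cmult DERIV_chain2[OF pot_derivative] D)
      have S: "((\<lambda>x. snd (w x) - um) has_real_derivative (pressure (fst (w x)) - pressure vm) / e2) (at x)"
        using DERIV_diff[OF D(2)[of x] DERIV_const[of um]] by simp
      show "((\<lambda>x. (snd (w x) - um)\<^sup>2) has_real_derivative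
          2 * (snd (w x) - um) * ((pressure (fst (w x)) - pressure vm) / e2)) (at x)"
        unfolding power2_eq_square by (rule DERIV_cong[OF DERIV_mult[OF S S]]) simp
    qed
    moreover have "(pressure (fst (w x)) - pressure vm) * (- (snd (w x) - um) / e1) +
      e2 / (2 * e1) * (2 * (snd (w x) - um) * ((pressure (fst (w x)) - pressure vm) / e2)) = 0"
      using e by (simp add: field_simps)
    ultimately show ?thesis by (simp add: energy_def)
  qed
  then show ?thesis using DERIV_isconst_all[of "\<lambda>x. energy e1 e2 (vm, um) (w x)" x y] by blast
qed

text \<open>The turning points of an orbit are \<open>\<mu> - \<delta>\<close> and \<open>\<mu> + \<delta>\<close>; the two other roots of the quartic
  \<open>pot - E\<close> are \<open>- \<mu> - \<rho>\<close> and \<open>- \<mu> + \<rho>\<close>.\<close>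

definition outer_root :: "real \<Rightarrow> real \<Rightarrow> real" where
  "outer_root \<mu> \<delta> = sqrt (2 - 2 * \<mu>\<^sup>2 - \<delta>\<^sup>2)"

text \<open>Vieta's formulas for the quartic \<open>pot - E\<close>: the cubic term is absent, so
  the roots are symmetric as above; the quadratic coefficient fixes \<open>outer_root\<close>, and
  the linear one gives the equation for \<open>pm\<close>. The strict inequality places both turning
  points strictly between the two outer roots, so all four roots are simple.\<close>

definition well :: "real \<Rightarrow> real \<Rightarrow> real \<Rightarrow> bool" where
  "well pm \<mu> \<delta> \<longleftrightarrow> \<delta> > 0 \<and> \<delta> + 2 * \<bar>\<mu>\<bar> < outer_root \<mu> \<delta> \<and> pm = 2 * \<mu> * (1 - \<mu>\<^sup>2 - \<delta>\<^sup>2)"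

lemma wellD:
  assumes "well pm \<mu> \<delta>"
  shows "\<delta> > 0" "\<delta> + 2 * \<bar>\<mu>\<bar> < outer_root \<mu> \<delta>" "(outer_root \<mu> \<delta>)\<^sup>2 = 2 - 2 * \<mu>\<^sup>2 - \<delta>\<^sup>2" "outer_root \<mu> \<delta> > 0"
    "pm = \<mu> * ((outer_root \<mu> \<delta>)\<^sup>2 - \<delta>\<^sup>2)"
proof -
  show 1: "\<delta> > 0" "\<delta> + 2 * \<bar>\<mu>\<bar> < outer_root \<mu> \<delta>" using assms by (auto simp: well_def)
  then show "outer_root \<mu> \<delta> > 0" by linarith
  then have "2 - 2 * \<mu>\<^sup>2 - \<delta>\<^sup>2 > 0" unfolding outer_root_def by simp
  then show 2: "(outer_root \<mu> \<delta>)\<^sup>2 = 2 - 2 * \<mu>\<^sup>2 - \<delta>\<^sup>2" unfolding outer_root_def by simp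
  show "pm = \<mu> * ((outer_root \<mu> \<delta>)\<^sup>2 - \<delta>\<^sup>2)"
    unfolding 2 using assms by (simp add: well_def algebra_simps)
qed

lemma pot_factor:
  assumes "\<rho>\<^sup>2 = 2 - 2 * \<mu>\<^sup>2 - \<delta>\<^sup>2" "pm = 2 * \<mu> * (1 - \<mu>\<^sup>2 - \<delta>\<^sup>2)"
  shows "pot pm v - pot pm (\<mu> - \<delta>) = (v - (\<mu> - \<delta>)) * ((\<mu> + \<delta>) - v) * ((v + \<mu>)\<^sup>2 - \<rho>\<^sup>2) / 2"
  unfolding pot_def assms
  by (simp add: field_simps power2_eq_square power4_eq_xxxx)

definition orbit_period :: "real \<Rightarrow> real \<Rightarrow> real \<Rightarrow> real" where
  "orbit_period e \<mu> \<delta> = sqrt e * integral {0..2 * pi}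
    (\<lambda>\<theta>. 1 / sqrt ((2 - 6 * \<mu>\<^sup>2) + 2 * outer_root \<mu> \<delta> * \<delta> * cos \<theta>))"

text \<open>With \<open>\<rho> = outer_root \<mu> \<delta>\<close> one has
  \<open>2 - 6 \<mu>^2 = \<rho>^2 + \<delta>^2 - 4 \<mu>^2\<close>, so the difference of the two
  sides is \<open>(\<rho> - \<delta>)^2 - 4 \<mu>^2\<close>, positive by the inequality in
  \<open>well\<close>.\<close>

lemma well_modulus:
  assumes "well pm \<mu> \<delta>"
  shows "0 < 2 * outer_root \<mu> \<delta> * \<delta>" "2 * outer_root \<mu> \<delta> * \<delta> < 2 - 6 * \<mu>\<^sup>2"
proof -
  note w = wellD[OF assms]
  show "0 < 2 * outer_root \<mu> \<delta> * \<delta>" using w by simp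
  have "(2 * \<bar>\<mu>\<bar>)\<^sup>2 < (outer_root \<mu> \<delta> - \<delta>)\<^sup>2"
    using w by (intro power_strict_mono) auto
  then show "2 * outer_root \<mu> \<delta> * \<delta> < 2 - 6 * \<mu>\<^sup>2"
    using w(3) by (simp add: power2_diff power_mult_distrib)
qed

text \<open>The profile equation multiplied by \<open>D^3\<close>. The left-hand side is
  \<open>e v''\<close> for the Moebius function \<open>v = - (\<mu> + \<rho>) + C / D\<close> of
  \<open>c = cos \<phi>\<close>; the right-hand side is the cubic \<open>2 v^3 - 2 v + pm\<close> at
  this \<open>v\<close>, its coefficients written in terms of the roots.\<close>

lemma explicit_identity:
  fixes \<mu> \<rho> \<delta> c :: real
  defines "k \<equiv> 2 * \<mu> + \<rho>" and "D \<equiv> (2 * \<mu> + \<rho>) + \<delta> * c"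
    and "C \<equiv> (2 * \<mu> + \<rho>)\<^sup>2 - \<delta>\<^sup>2" and "s \<equiv> \<rho>\<^sup>2 + \<delta>\<^sup>2 - 4 * \<mu>\<^sup>2" and "d \<equiv> 2 * \<rho> * \<delta>"
  shows "C * \<delta> * ((c * (s + d * c) - d * (1 - c\<^sup>2) / 2) * D + 2 * \<delta> * (1 - c\<^sup>2) * (s + d * c)) =
    2 * (C - (\<mu> + \<rho>) * D) ^ 3 - (\<rho>\<^sup>2 + 2 * \<mu>\<^sup>2 + \<delta>\<^sup>2) * (C - (\<mu> + \<rho>) * D) * D\<^sup>2 + \<mu> * (\<rho>\<^sup>2 - \<delta>\<^sup>2) * D ^ 3"
  unfolding assms by algebra

text \<open>The Moebius function \<open>v\<close> of \<open>c = cos \<phi>\<close> maps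
  \<open>c = 1\<close> to \<open>\<mu> - \<delta>\<close>, \<open>c = -1\<close> to
  \<open>\<mu> + \<delta>\<close> and infinity to the outer root \<open>- \<mu> - \<rho>\<close>;
  the root \<open>- \<mu> + \<rho>\<close> corresponds to \<open>c = - s / d\<close>, beyond the
  range of the cosine. This turns the quartic into a multiple of
  \<open>(1 - c^2) (s + d c) / D^4\<close>, so the equation for \<open>\<phi>\<close> stays regular
  at the turning points.\<close>

theorem explicit_orbit:
  assumes e: "e1 > 0" "e2 > 0" and well: "well (pressure vm) \<mu> \<delta>"
  obtains w where "stationary_solution e1 e2 (vm, um) w" "nonconstant_periodic w"
    "fundamental_period w (orbit_period (e1 * e2) \<mu> \<delta>)"
    "range w = {z. \<mu> - \<delta> \<le> fst z \<and> fst z \<le> \<mu> + \<delta> \<and>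
      energy e1 e2 (vm, um) z = pot (pressure vm) (\<mu> - \<delta>)}"
proof -
  define \<rho> where "\<rho> = outer_root \<mu> \<delta>"
  note W = wellD[OF well, folded \<rho>_def]
  define s d k C r where "s = 2 - 6 * \<mu>\<^sup>2" and "d = 2 * \<rho> * \<delta>" and "k = 2 * \<mu> + \<rho>"
    and "C = k\<^sup>2 - \<delta>\<^sup>2" and "r = sqrt (e1 * e2)"
  have sd: "\<bar>d\<bar> < s" using well_modulus[OF well, folded \<rho>_def] by (simp add: s_def d_def)
  have s': "s = \<rho>\<^sup>2 + \<delta>\<^sup>2 - 4 * \<mu>\<^sup>2" using W(3) by (simp add: s_def)
  have r: "r > 0" "r\<^sup>2 = e1 * e2" using e by (simp_all add: r_def)
  have k: "\<delta> < k" using W by (simp add: k_def abs_if split: if_splits)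
  have C: "C > 0" using k W(1) unfolding C_def by (simp add: power_strict_mono)
  define T where "T = r * integral {0..2 * pi} (\<lambda>\<theta>. 1 / sqrt (s + d * cos \<theta>))"
  have Top: "T = orbit_period (e1 * e2) \<mu> \<delta>"
    by (simp add: T_def orbit_period_def r_def s_def d_def \<rho>_def)
  obtain \<phi> \<Theta> :: "real \<Rightarrow> real" where ph:
    "\<phi> 0 = 0" "\<And>x. (\<phi> has_real_derivative sqrt (s + d * cos (\<phi> x)) / r) (at x)"
    "\<And>x. \<Theta> (\<phi> x) = x" "\<And>\<theta>. \<phi> (\<Theta> \<theta>) = \<theta>" "strict_mono \<Theta>"
    "\<And>x. \<phi> (x + T) = \<phi> x + 2 * pi" "T > 0"
    using angle_solution[OF sd r(1)] unfolding T_def by blast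
  define D v f f1 u where "D x = k + \<delta> * cos (\<phi> x)" and "v x = - (\<mu> + \<rho>) + C / D x"
    and "f x = sqrt (s + d * cos (\<phi> x)) / r"
    and "f1 x = C * \<delta> * sin (\<phi> x) * f x / (D x)\<^sup>2" and "u x = um - e1 * f1 x" for x
  have Dpos: "D x > 0" for x
  proof -
    have "\<bar>\<delta> * cos (\<phi> x)\<bar> \<le> \<delta> * 1" unfolding abs_mult using W(1) by (intro mult_mono) auto
    then show ?thesis using k unfolding D_def by linarith
  qed
  have pos: "s + d * cos \<theta> > 0" for \<theta> by (rule real_cos_gt[OF sd])
  have fpos: "f x > 0" for x using pos[of "\<phi> x"] r by (simp add: f_def)
  have f2: "r\<^sup>2 * (f x)\<^sup>2 = s + d * cos (\<phi> x)" for x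
    using pos[of "\<phi> x"] r e by (simp add: f_def power_divide)
  have dphi: "(\<phi> has_real_derivative f x) (at x)" for x using ph(2) by (simp add: f_def)
  have df: "(f has_real_derivative - d * sin (\<phi> x) / (2 * r\<^sup>2)) (at x)" for x
  proof -
    have q: "sqrt (s + d * cos (\<phi> x)) > 0" using pos by simp
    have "((\<lambda>x. s + d * cos (\<phi> x)) has_real_derivative - d * sin (\<phi> x) * f x) (at x)"
      by (auto intro!: derivative_eq_intros dphi)
    from DERIV_chain2[OF DERIV_real_sqrt[OF pos] this]
    have "((\<lambda>x. sqrt (s + d * cos (\<phi> x))) has_real_derivative
        inverse (sqrt (s + d * cos (\<phi> x))) / 2 * (- d * sin (\<phi> x) * f x)) (at x)" .
    from DERIV_cdivide[OF this, of r] show ?thesis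
      using q r(1) unfolding f_def[abs_def] by (simp add: field_simps power2_eq_square)
  qed
  have dD: "(D has_real_derivative - \<delta> * sin (\<phi> x) * f x) (at x)" for x
    unfolding D_def[abs_def] by (auto intro!: derivative_eq_intros dphi)
  have dv: "(v has_real_derivative f1 x) (at x)" for x
  proof -
    have "(v has_real_derivative 0 + C * (- (inverse (D x) * (- \<delta> * sin (\<phi> x) * f x) * inverse (D x)))) (at x)"
      unfolding v_def[abs_def] divide_inverse
      by (intro DERIV_add DERIV_const DERIV_cmult DERIV_inverse' dD) (use Dpos[of x] in simp)
    then show ?thesis using Dpos[of x] by (simp add: f1_def field_simps power2_eq_square)
  qed
  define F where "F x = C * \<delta> * ((cos (\<phi> x) * (f x)\<^sup>2 + sin (\<phi> x) * (- d * sin (\<phi> x) / (2 * r\<^sup>2))) * D x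
    + 2 * \<delta> * (sin (\<phi> x))\<^sup>2 * (f x)\<^sup>2) / (D x) ^ 3" for x
  have df1: "(f1 has_real_derivative F x) (at x)" for x
  proof -
    have 1: "((\<lambda>x. C * \<delta> * sin (\<phi> x) * f x) has_real_derivative
        C * \<delta> * (cos (\<phi> x) * (f x)\<^sup>2 + sin (\<phi> x) * (- d * sin (\<phi> x) / (2 * r\<^sup>2)))) (at x)"
    proof -
      have "((\<lambda>x. sin (\<phi> x)) has_real_derivative cos (\<phi> x) * f x) (at x)"
        by (auto intro!: derivative_eq_intros dphi)
      from DERIV_cmult[OF DERIV_mult[OF this df[of x]], of "C * \<delta>"] show ?thesis
        by (simp add: power2_eq_square algebra_simps)
    qed
    have 2: "((\<lambda>x. (D x)\<^sup>2) has_real_derivative 2 * D x * (- \<delta> * sin (\<phi> x) * f x)) (at x)"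
      using DERIV_mult[OF dD dD] by (simp add: power2_eq_square algebra_simps)
    have "D x \<noteq> 0" using Dpos[of x] by simp
    from DERIV_divide[OF 1 2] this
    have "(f1 has_real_derivative (C * \<delta> * (cos (\<phi> x) * (f x)\<^sup>2 + sin (\<phi> x) * (- d * sin (\<phi> x) / (2 * r\<^sup>2))) * (D x)\<^sup>2 -
      C * \<delta> * sin (\<phi> x) * f x * (2 * D x * (- \<delta> * sin (\<phi> x) * f x))) / ((D x)\<^sup>2 * (D x)\<^sup>2)) (at x)"
      unfolding f1_def[abs_def] by simp
    moreover have "(C * \<delta> * A * (D x)\<^sup>2 - C * \<delta> * S * G * (2 * D x * (- \<delta> * S * G))) / ((D x)\<^sup>2 * (D x)\<^sup>2)
      = C * \<delta> * (A * D x + 2 * \<delta> * S\<^sup>2 * G\<^sup>2) / (D x) ^ 3" for A S G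
      using \<open>D x \<noteq> 0\<close> by (simp add: field_simps power2_eq_square power3_eq_cube)
    ultimately show ?thesis unfolding F_def by simp
  qed
  have key: "e1 * e2 * F x = - (pressure (v x) - pressure vm)" for x
  proof -
    define c where "c = cos (\<phi> x)"
    have sin2: "(sin (\<phi> x))\<^sup>2 = 1 - c\<^sup>2" by (simp add: c_def sin_squared_eq)
    have "r\<^sup>2 * F x = C * \<delta> * ((c * (r\<^sup>2 * (f x)\<^sup>2) - d * (sin (\<phi> x))\<^sup>2 / 2) * D x
        + 2 * \<delta> * (sin (\<phi> x))\<^sup>2 * (r\<^sup>2 * (f x)\<^sup>2)) / (D x) ^ 3"
    proof -
      have gen: "R * ((c * g + S * (- d * S / (2 * R))) * Z + 2 * \<delta> * S\<^sup>2 * g) =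
          (c * (R * g) - d * S\<^sup>2 / 2) * Z + 2 * \<delta> * S\<^sup>2 * (R * g)" if "R \<noteq> 0" for R g S Z
        using that by (simp add: field_simps power2_eq_square)
      have "r\<^sup>2 \<noteq> 0" using r(1) by simp
      from gen[OF this, of "(f x)\<^sup>2" "sin (\<phi> x)" "D x"] show ?thesis
        unfolding F_def c_def[symmetric] times_divide_eq_right mult.left_commute[of "r\<^sup>2"] by simp
    qed
    also have "\<dots> = C * \<delta> * ((c * (s + d * c) - d * (1 - c\<^sup>2) / 2) * D x + 2 * \<delta> * (1 - c\<^sup>2) * (s + d * c)) / (D x) ^ 3"
      unfolding f2 sin2 c_def[symmetric] ..
    also have "\<dots> = (2 * (C - (\<mu> + \<rho>) * D x) ^ 3 - (\<rho>\<^sup>2 + 2 * \<mu>\<^sup>2 + \<delta>\<^sup>2) * (C - (\<mu> + \<rho>) * D x) * (D x)\<^sup>2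
        + \<mu> * (\<rho>\<^sup>2 - \<delta>\<^sup>2) * (D x) ^ 3) / (D x) ^ 3"
      using explicit_identity[of \<mu> \<rho> \<delta> c] by (simp add: C_def k_def s' d_def D_def c_def)
    also have "\<dots> = 2 * (v x) ^ 3 - (\<rho>\<^sup>2 + 2 * \<mu>\<^sup>2 + \<delta>\<^sup>2) * v x + \<mu> * (\<rho>\<^sup>2 - \<delta>\<^sup>2)"
    proof -
      have "C - (\<mu> + \<rho>) * D x = v x * D x" using Dpos[of x] by (simp add: v_def field_simps)
      then show ?thesis using Dpos[of x] by (simp add: field_simps power2_eq_square power3_eq_cube)
    qed
    also have "\<dots> = - (pressure (v x) - pressure vm)"
    proof -
      have "\<rho>\<^sup>2 + 2 * \<mu>\<^sup>2 + \<delta>\<^sup>2 = 2" using W(3) by simp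
      then show ?thesis unfolding W(5)[symmetric] pressure_eq[of "v x"]
        by (simp add: algebra_simps power2_eq_square power3_eq_cube)
    qed
    finally show ?thesis by (simp add: r)
  qed
  define w where "w x = (v x, u x)" for x
  have sol: "stationary_solution e1 e2 (vm, um) w"
  proof (rule stationary_solutionI)
    fix x
    show "((\<lambda>x. fst (w x)) has_real_derivative - (snd (w x) - um) / e1) (at x)"
      using dv[of x] e by (simp add: w_def u_def)
    have "(u has_real_derivative 0 - e1 * F x) (at x)"
      unfolding u_def[abs_def] by (intro DERIV_diff DERIV_const DERIV_cmult df1)
    moreover have "0 - e1 * F x = (pressure (v x) - pressure vm) / e2"
      using key[of x] e by (simp add: field_simps)
    ultimately show "((\<lambda>x. snd (w x)) has_real_derivative (pressure (fst (w x)) - pressure vm) / e2) (at x)"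
      by (simp add: w_def)
  qed
  have Ck: "C = (k - \<delta>) * (k + \<delta>)" by (simp add: C_def power2_eq_square algebra_simps)
  have v_range: "\<mu> - \<delta> \<le> v x" "v x \<le> \<mu> + \<delta>" for x
  proof -
    have Dle: "k - \<delta> \<le> D x" "D x \<le> k + \<delta>"
      using W(1) mult_left_mono[of "cos (\<phi> x)" 1 \<delta>] mult_left_mono[of "-1" "cos (\<phi> x)" \<delta>]
      by (simp_all add: D_def)
    have "k - \<delta> \<le> C / D x"
      using mult_left_mono[OF Dle(2), of "k - \<delta>"] k Dpos[of x] by (simp add: Ck pos_le_divide_eq)
    then show "\<mu> - \<delta> \<le> v x" by (simp add: v_def k_def)
    have "C / D x \<le> k + \<delta>"
      using mult_left_mono[OF Dle(1), of "k + \<delta>"] k W(1) Dpos[of x] by (simp add: Ck pos_divide_le_eq mult.commute)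
    then show "v x \<le> \<mu> + \<delta>" by (simp add: v_def k_def)
  qed
  have v_min: "v x = \<mu> - \<delta> \<longleftrightarrow> cos (\<phi> x) = 1" for x
  proof -
    have "v x = \<mu> - \<delta> \<longleftrightarrow> C / D x = k - \<delta>" by (auto simp: v_def k_def)
    also have "\<dots> \<longleftrightarrow> C = (k - \<delta>) * D x" using Dpos[of x] by (auto simp: nonzero_divide_eq_eq)
    also have "\<dots> \<longleftrightarrow> k + \<delta> = D x" using k by (simp add: Ck)
    also have "\<dots> \<longleftrightarrow> cos (\<phi> x) = 1" using W(1) by (auto simp: D_def)
    finally show ?thesis .
  qed
  have perw: "periodic_with T w"
    unfolding periodic_with_def w_def u_def f1_def v_def f_def D_def using ph(6,7) by simp
  have nc: "\<not> w constant_on UNIV"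
  proof
    assume "w constant_on UNIV"
    then have "v (\<Theta> pi) = v 0" unfolding constant_on_def w_def by (metis UNIV_I prod.inject)
    then have "cos (\<phi> (\<Theta> pi)) = 1" using v_min[of 0] v_min[of "\<Theta> pi"] ph(1) by simp
    then show False by (simp add: ph(4))
  qed
  have mono: "\<phi> x < \<phi> y" if "x < y" for x y
    using strict_mono_less[OF ph(5), of "\<phi> x" "\<phi> y"] that by (simp add: ph(3))
  \<comment> \<open>The minimum of \<open>v\<close> is reached only where
    \<open>cos \<phi> = 1\<close>, so every period advances \<open>\<phi>\<close> by a positive
    multiple of \<open>2 pi\<close>.\<close>
  have fund: "fundamental_period w T"
    unfolding fundamental_period_def
  proof (intro conjI allI impI perw)
    fix S assume "periodic_with S w"
    then have S: "S > 0" "w (0 + S) = w 0" unfolding periodic_with_def by blast+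
    then have "v S = v 0" by (simp add: w_def)
    then have "cos (\<phi> S) = 1" using v_min[of 0] v_min[of S] ph(1) by simp
    then obtain n :: int where n: "\<phi> S = of_int n * 2 * pi" using cos_one_2pi_int by blast
    have "\<phi> S > 0" using mono[OF S(1)] ph(1) by simp
    then have "n \<ge> 1" using n by (simp add: zero_less_mult_iff)
    then have "1 * (2 * pi) \<le> of_int n * (2 * pi)" by (intro mult_right_mono) auto
    then have "\<phi> T \<le> \<phi> S" using ph(6)[of 0] ph(1) n by simp
    then show "T \<le> S" using mono[of S T] by fastforce
  qed
  have ew: "energy e1 e2 (vm, um) (w x) = pot (pressure vm) (\<mu> - \<delta>)" for x
  proof -
    have "v 0 = \<mu> - \<delta>" using v_min ph(1) by simp
    moreover have "u 0 = um" by (simp add: u_def f1_def ph(1))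
    ultimately show ?thesis
      using energy_conserved[OF e sol, of x 0] by (simp add: energy_def w_def)
  qed
  have "range w = {z. \<mu> - \<delta> \<le> fst z \<and> fst z \<le> \<mu> + \<delta> \<and>
      energy e1 e2 (vm, um) z = pot (pressure vm) (\<mu> - \<delta>)}" (is "_ = ?R")
  proof (intro equalityI subsetI)
    fix z assume "z \<in> range w"
    then show "z \<in> ?R" using v_range ew by (auto simp: w_def)
  next
    fix z assume z: "z \<in> ?R"
    \<comment> \<open>Inverting the Moebius map recovers \<open>cos \<theta>\<close> from the first
      coordinate. The energy then determines \<open>u - um\<close> up to sign, and the reflection of
      \<open>\<theta>\<close> switches that sign.\<close>
    define y where "y = C / (fst z + \<mu> + \<rho>)"
    have zb: "k - \<delta> \<le> fst z + \<mu> + \<rho>" "fst z + \<mu> + \<rho> \<le> k + \<delta>" using z by (auto simp: k_def)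
    then have zp: "fst z + \<mu> + \<rho> > 0" using k by linarith
    have "k - \<delta> \<le> y" unfolding y_def
      using mult_left_mono[OF zb(2), of "k - \<delta>"] k zp by (simp add: Ck pos_le_divide_eq)
    moreover have "y \<le> k + \<delta>" unfolding y_def
      using mult_left_mono[OF zb(1), of "k + \<delta>"] k W(1) zp by (simp add: Ck pos_divide_le_eq mult.commute)
    ultimately have bounds: "-1 \<le> (y - k) / \<delta>" "(y - k) / \<delta> \<le> 1" using W(1) by (auto simp: field_simps)
    define \<theta> where "\<theta> = arccos ((y - k) / \<delta>)"
    have cos\<theta>: "cos \<theta> = (y - k) / \<delta>" unfolding \<theta>_def using bounds by (rule cos_arccos)
    have vz: "v (\<Theta> \<theta>') = fst z" if "cos \<theta>' = cos \<theta>" for \<theta>'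
    proof -
      have "D (\<Theta> \<theta>') = y" using W(1) by (simp add: D_def ph(4) that cos\<theta>)
      then show ?thesis using zp C by (simp add: v_def y_def)
    qed
    have uz: "(u (\<Theta> \<theta>') - um)\<^sup>2 = (snd z - um)\<^sup>2" if "cos \<theta>' = cos \<theta>" for \<theta>'
    proof -
      have "energy e1 e2 (vm, um) (w (\<Theta> \<theta>')) = energy e1 e2 (vm, um) z" using ew z by simp
      then show ?thesis using vz[OF that] e by (simp add: energy_def w_def)
    qed
    have "u (\<Theta> (- \<theta>)) - um = - (u (\<Theta> \<theta>) - um)"
      by (simp add: u_def f1_def f_def D_def ph(4))
    moreover have "u (\<Theta> \<theta>) - um = snd z - um \<or> u (\<Theta> \<theta>) - um = - (snd z - um)"
      using uz[of \<theta>] by (simp add: power2_eq_iff)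
    ultimately have "u (\<Theta> \<theta>) = snd z \<or> u (\<Theta> (- \<theta>)) = snd z" by auto
    then have "w (\<Theta> \<theta>) = z \<or> w (\<Theta> (- \<theta>)) = z"
      using vz[of \<theta>] vz[of "- \<theta>"] by (auto simp: w_def prod_eq_iff)
    then show "z \<in> range w" by auto
  qed
  moreover have "nonconstant_periodic w"
    unfolding nonconstant_periodic_def using perw nc by blast
  ultimately show ?thesis using that sol fund unfolding Top by blast
qed

section \<open>Monotonicity of the period\<close>

definition kappa :: "real \<Rightarrow> real" where
  "kappa z = integral {0..2 * pi} (\<lambda>t. 1 / sqrt (1 + z * cos t))"

text \<open>The integrand of the derivative changes sign. Subtracting its value
  \<open>- cos t / 2\<close> at \<open>z = 0\<close>, whose integral over \<open>[0, 2 pi]\<close>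
  vanishes, leaves \<open>cos t (1 - (1 + z cos t)^(-3/2)) / 2\<close>, where both factors have the
  same sign.\<close>

lemma kappa_derivative:
  assumes z: "0 < z" "z < 1"
  shows "\<exists>k>0. (kappa has_real_derivative k) (at z)" "kappa z > 0"
proof -
  define fx where "fx y t = - cos t / (2 * ((1 + y * cos t) * sqrt (1 + y * cos t)))" for y t :: real
  have pos: "1 + y * cos t > 0" if "y \<in> {-1<..<1}" for y t :: real
    by (rule real_cos_gt) (use that in auto)
  have cont1: "continuous_on S (\<lambda>t. 1 / sqrt (1 + y * cos t))" if "y \<in> {-1<..<1}" for y S
    using pos[OF that] by (intro continuous_intros) (auto simp: less_imp_neq[symmetric])
  have "((\<lambda>y. integral (cbox 0 (2 * pi)) (\<lambda>t. 1 / sqrt (1 + y * cos t))) has_field_derivative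
      integral (cbox 0 (2 * pi)) (fx z)) (at z within {-1<..<1})"
  proof (rule leibniz_rule_field_derivative)
    fix y t :: real assume y: "y \<in> {-1<..<1}"
    show "((\<lambda>y. 1 / sqrt (1 + y * cos t)) has_field_derivative fx y t) (at y within {-1<..<1})"
      using pos[OF y, of t] unfolding fx_def
      by (auto intro!: derivative_eq_intros simp: field_simps)
  next
    show "(\<lambda>t. 1 / sqrt (1 + y * cos t)) integrable_on cbox 0 (2 * pi)" if "y \<in> {-1<..<1}" for y
      using cont1[OF that] by (intro integrable_continuous)
    show "continuous_on ({-1<..<1} \<times> cbox 0 (2 * pi)) (\<lambda>(y, t). fx y t)"
      unfolding fx_def case_prod_beta
    proof (intro continuous_intros ballI)
      fix p :: "real \<times> real" assume "p \<in> {-1<..<1} \<times> cbox 0 (2 * pi)"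
      then have "1 + fst p * cos (snd p) > 0" by (intro pos) auto
      then show "2 * ((1 + fst p * cos (snd p)) * sqrt (1 + fst p * cos (snd p))) \<noteq> 0" by simp
    qed
  qed (use z in auto)
  then have D: "(kappa has_real_derivative integral {0..2 * pi} (fx z)) (at z)"
    using z by (simp add: kappa_def[abs_def] at_within_open[of _ "{-1<..<1}"])
  have zin: "z \<in> {-1<..<1}" using z by simp
  define h where "h t = fx z t + cos t / 2" for t
  have cfx: "continuous_on S (fx z)" for S
    unfolding fx_def using pos[OF zin] by (intro continuous_intros) (auto simp: less_imp_neq[symmetric])
  have ch: "continuous_on S h" for S
    unfolding h_def by (intro continuous_intros cfx) auto
  have h_eq: "h t = cos t * (1 - 1 / ((1 + z * cos t) * sqrt (1 + z * cos t))) / 2" for t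
    by (simp add: h_def fx_def right_diff_distrib diff_divide_distrib)
  have h0: "h t \<ge> 0" for t
  proof -
    let ?w = "1 + z * cos t"
    note w = pos[OF zin, of t]
    show ?thesis
    proof (cases "cos t \<ge> 0")
      case True
      then have "?w \<ge> 1" using z by simp
      then have "1 * 1 \<le> ?w * sqrt ?w" by (intro mult_mono) auto
      then show ?thesis unfolding h_eq using True w by simp
    next
      case False
      then have w1: "?w \<le> 1" using z by (simp add: mult_pos_neg less_imp_le)
      then have "?w * sqrt ?w \<le> 1 * 1" using w by (intro mult_mono) auto
      then have "1 - 1 / (?w * sqrt ?w) \<le> 0" using w by (simp add: le_divide_eq_1_pos)
      then show ?thesis unfolding h_eq using False by (simp add: mult_nonpos_nonpos)
    qed
  qed
  have "h 0 > 0"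
  proof -
    have "1 * 1 < (1 + z) * sqrt (1 + z)" using z by (intro mult_strict_mono) auto
    then show ?thesis unfolding h_eq using z by simp
  qed
  have "integral {0..2 * pi} h > 0"
  proof -
    have "integral {0..2 * pi} h \<ge> 0"
      by (intro Henstock_Kurzweil_Integration.integral_nonneg integrable_continuous_interval ch h0)
    moreover have "integral {0..2 * pi} h \<noteq> 0"
    proof
      assume "integral {0..2 * pi} h = 0"
      then have "(h has_integral 0) (cbox 0 (2 * pi))"
        using integrable_integral[OF integrable_continuous_interval[OF ch]] by (metis cbox_interval)
      then have "h 0 = 0" using has_integral_0_cbox_imp_0[of 0 "2 * pi" h 0] ch h0 by (auto simp: not_le)
      then show False using \<open>h 0 > 0\<close> by simp
    qed
    ultimately show ?thesis by simp
  qed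
  moreover have "integral {0..2 * pi} h = integral {0..2 * pi} (fx z)"
  proof -
    have c: "((\<lambda>t. cos t / 2) has_integral sin (2 * pi) / 2 - sin 0 / 2) {0..2 * pi}"
      by (rule has_integral_real_FTC) (auto intro!: derivative_eq_intros)
    have "(h has_integral integral {0..2 * pi} (fx z) + (sin (2 * pi) / 2 - sin 0 / 2)) {0..2 * pi}"
      unfolding h_def
      by (intro has_integral_add c integrable_integral integrable_continuous_interval cfx)
    then show ?thesis by (simp add: integral_unique)
  qed
  ultimately show "\<exists>k>0. (kappa has_real_derivative k) (at z)" using D by auto
  have "kappa z \<ge> integral {0..2 * pi} (\<lambda>_. 1 / 2)"
    unfolding kappa_def
  proof (intro integral_le integrable_continuous_interval cont1 zin continuous_intros)
    fix t
    have "z * cos t \<le> 1 * 1" using z abs_cos_le_one[of t]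
      by (smt (verit) mult_left_le mult_nonneg_nonpos)
    then have "sqrt (1 + z * cos t) \<le> sqrt 4" by (intro real_sqrt_le_mono) simp
    then show "1 / 2 \<le> 1 / sqrt (1 + z * cos t)"
      using pos[OF zin, of t] by (intro divide_left_mono) (auto simp: real_sqrt_four)
  qed
  then show "kappa z > 0" by (simp add: order_less_le_trans[OF pi_gt_zero])
qed

lemma orbit_period_kappa:
  assumes "2 - 6 * \<mu>\<^sup>2 > 0"
  shows "orbit_period e \<mu> \<delta> =
    sqrt e / sqrt (2 - 6 * \<mu>\<^sup>2) * kappa (2 * outer_root \<mu> \<delta> * \<delta> / (2 - 6 * \<mu>\<^sup>2))"
proof -
  define s d where "s = 2 - 6 * \<mu>\<^sup>2" and "d = 2 * outer_root \<mu> \<delta> * \<delta>"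
  have s: "s > 0" using assms by (simp add: s_def)
  have "1 / sqrt (s + d * cos t) = 1 / sqrt s * (1 / sqrt (1 + d / s * cos t))" for t
  proof -
    have "s + d * cos t = s * (1 + d / s * cos t)" using s by (simp add: field_simps)
    then show ?thesis by (simp add: real_sqrt_mult)
  qed
  then have "integral {0..2 * pi} (\<lambda>t. 1 / sqrt (s + d * cos t)) = 1 / sqrt s * kappa (d / s)"
    by (simp only: kappa_def integral_mult_right)
  then show ?thesis by (simp add: orbit_period_def s_def d_def)
qed

text \<open>The prescribed derivatives of \<open>m\<close> and \<open>h\<close> are those with
  respect to the energy along the family of orbits, with \<open>Q\<close> the product of the two
  slope factors of the potential at the turning points. In
  \<open>sqrt e / sqrt s * kappa (d / s)\<close> the first factor does not decrease, as
  \<open>s' = - 48 \<mu>^2 / Q\<close>, and the second increases once \<open>d' > 0\<close>.\<close>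

lemma orbit_period_increasing:
  fixes m h :: "real \<Rightarrow> real"
  assumes e: "e > 0" and well: "well pm (m E) (h E)"
    and Q: "Q > 0"
    and m: "(m has_real_derivative 4 * m E / Q) (at E)"
    and h: "(h has_real_derivative ((outer_root (m E) (h E))\<^sup>2 - 4 * (m E)\<^sup>2 - (h E)\<^sup>2) / (h E * Q)) (at E)"
  shows "\<exists>T'>0. ((\<lambda>x. orbit_period e (m x) (h x)) has_real_derivative T') (at E)"
proof -
  define \<mu> \<delta> \<rho> where "\<mu> = m E" and "\<delta> = h E" and "\<rho> = outer_root \<mu> \<delta>"
  note W = wellD[OF well, folded \<mu>_def \<delta>_def, folded \<rho>_def]
  define m' h' where "m' = 4 * \<mu> / Q" and "h' = (\<rho>\<^sup>2 - 4 * \<mu>\<^sup>2 - \<delta>\<^sup>2) / (\<delta> * Q)"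
  have m: "(m has_real_derivative m') (at E)" and h: "(h has_real_derivative h') (at E)"
    using m h by (simp_all add: m'_def h'_def \<mu>_def \<delta>_def \<rho>_def)
  define s d where "s x = 2 - 6 * (m x)\<^sup>2" and "d x = 2 * outer_root (m x) (h x) * h x" for x
  have sd: "0 < d E" "d E < s E" using well_modulus[OF well] by (simp_all add: s_def d_def)
  define s' where "s' = - (12 * \<mu> * m')"
  have ds: "(s has_real_derivative s') (at E)"
    unfolding s_def[abs_def] s'_def by (auto intro!: derivative_eq_intros m simp: \<mu>_def)
  have s': "s' \<le> 0" using Q by (simp add: s'_def m'_def)
  have drho: "((\<lambda>x. outer_root (m x) (h x)) has_real_derivative - (2 * \<mu> * m' + \<delta> * h') / \<rho>) (at E)"
  proof -
    have q: "2 - 2 * (m E)\<^sup>2 - (h E)\<^sup>2 > 0" 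
    proof -
      have "\<rho>\<^sup>2 > 0" using W(4) by simp
      then show ?thesis unfolding W(3) by (simp add: \<mu>_def \<delta>_def)
    qed
    have D: "((\<lambda>x. 2 - 2 * (m x)\<^sup>2 - (h x)\<^sup>2) has_real_derivative - (2 * (2 * \<mu> * m' + \<delta> * h'))) (at E)"
      by (auto intro!: derivative_eq_intros m h simp: \<mu>_def \<delta>_def)
    have rs: "sqrt (2 - 2 * (m E)\<^sup>2 - (h E)\<^sup>2) = \<rho>" by (simp add: \<rho>_def outer_root_def \<mu>_def \<delta>_def)
    have eq: "inverse \<rho> / 2 * - (2 * X) = - X / \<rho>" for X using W(4) by (simp add: field_simps)
    show ?thesis
      using DERIV_chain2[OF DERIV_real_sqrt[OF q] D] unfolding rs eq outer_root_def .
  qed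
  define d' where "d' = 2 / \<rho> * ((\<rho>\<^sup>2 - \<delta>\<^sup>2) * h' - 2 * \<mu> * m' * \<delta>)"
  have dd: "(d has_real_derivative d') (at E)"
  proof -
    have "(d has_real_derivative 2 * (- (2 * \<mu> * m' + \<delta> * h') / \<rho>) * h E + h' * (2 * outer_root (m E) (h E))) (at E)"
      unfolding d_def[abs_def] by (intro DERIV_mult DERIV_cmult drho h)
    moreover have "2 * (- (2 * \<mu> * m' + \<delta> * h') / \<rho>) * h E + h' * (2 * outer_root (m E) (h E)) = d'"
      using W(4) unfolding d'_def \<mu>_def[symmetric] \<delta>_def[symmetric] \<rho>_def[symmetric]
      by (simp add: field_simps power2_eq_square)
    ultimately show ?thesis by simp
  qed
  \<comment> \<open>With \<open>A = \<rho>^2 - \<delta>^2\<close> the claim is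
    \<open>A (A - 4 \<mu>^2) > 8 \<mu>^2 \<delta>^2\<close>. Squaring the inequality in
    \<open>well\<close> gives \<open>A > 4 |\<mu>| \<delta> + 4 \<mu>^2\<close>, so both factors
    exceed \<open>x = 4 |\<mu>| \<delta>\<close> and the product even exceeds
    \<open>16 \<mu>^2 \<delta>^2\<close>.\<close>
  have d': "d' > 0"
  proof -
    define A where "A = \<rho>\<^sup>2 - \<delta>\<^sup>2"
    define x where "x = 4 * \<bar>\<mu>\<bar> * \<delta>"
    have "(\<delta> + 2 * \<bar>\<mu>\<bar>)\<^sup>2 < \<rho>\<^sup>2" using W(1,2) by (intro power_strict_mono) auto
    then have A: "x + 4 * \<mu>\<^sup>2 < A"
      unfolding A_def x_def by (simp add: power2_sum power_mult_distrib mult.commute mult.left_commute)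
    have x: "x \<ge> 0" using W(1) by (simp add: x_def)
    have "x * x < A * (A - 4 * \<mu>\<^sup>2)"
      using A x zero_le_power2[of \<mu>] by (intro mult_strict_mono) linarith+
    moreover have "x * x = 16 * \<mu>\<^sup>2 * \<delta>\<^sup>2"
      unfolding x_def by (simp add: power2_eq_square mult.commute mult.left_commute)
    moreover have "16 * \<mu>\<^sup>2 * \<delta>\<^sup>2 \<ge> 8 * \<mu>\<^sup>2 * \<delta>\<^sup>2" by (intro mult_right_mono) auto
    ultimately have "A * (A - 4 * \<mu>\<^sup>2) - 8 * \<mu>\<^sup>2 * \<delta>\<^sup>2 > 0" by linarith
    then have "(A * (A - 4 * \<mu>\<^sup>2) - 8 * \<mu>\<^sup>2 * \<delta>\<^sup>2) / (\<delta> * Q) > 0" using W(1) Q by simp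
    moreover have "(\<rho>\<^sup>2 - \<delta>\<^sup>2) * h' - 2 * \<mu> * m' * \<delta> = (A * (A - 4 * \<mu>\<^sup>2) - 8 * \<mu>\<^sup>2 * \<delta>\<^sup>2) / (\<delta> * Q)"
      using W(1) Q unfolding h'_def m'_def A_def by (simp add: field_simps power2_eq_square)
    ultimately have "(\<rho>\<^sup>2 - \<delta>\<^sup>2) * h' - 2 * \<mu> * m' * \<delta> > 0" by (simp only:)
    then show ?thesis unfolding d'_def using W(4) by (intro mult_pos_pos) auto
  qed
  define z where "z = d E / s E"
  have z: "0 < z" "z < 1" using sd by (simp_all add: z_def)
  obtain k where k: "k > 0" "(kappa has_real_derivative k) (at z)" and kp: "kappa z > 0"
    using kappa_derivative[OF z] by blast
  have s: "s E > 0" using sd by linarith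
  let ?R = "- (inverse (sqrt (s E)) * (inverse (sqrt (s E)) / 2 * s') * inverse (sqrt (s E)))"
  let ?Z = "(d' * s E - d E * s') / (s E * s E)"
  have "((\<lambda>x. sqrt e * (inverse (sqrt (s x)) * kappa (d x / s x))) has_real_derivative
      sqrt e * (?R * kappa (d E / s E) + (k * ?Z) * inverse (sqrt (s E)))) (at E)"
  proof (intro DERIV_cmult DERIV_mult DERIV_inverse')
    show "((\<lambda>x. sqrt (s x)) has_real_derivative inverse (sqrt (s E)) / 2 * s') (at E)"
      by (rule DERIV_chain2[OF DERIV_real_sqrt[OF s] ds])
    show "((\<lambda>x. kappa (d x / s x)) has_real_derivative k * ?Z) (at E)"
      by (rule DERIV_chain2[OF k(2)[unfolded z_def] DERIV_divide[OF dd ds]]) (use s in simp)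
  qed (use s in simp)
  \<comment> \<open>The reduction to \<open>kappa\<close> requires \<open>s > 0\<close>, so the two
    expressions are known to agree only near \<open>E\<close>.\<close>
  moreover have ev: "\<forall>\<^sub>F x in nhds E. orbit_period e (m x) (h x) = sqrt e * (inverse (sqrt (s x)) * kappa (d x / s x))"
  proof -
    have "\<forall>\<^sub>F x in nhds E. s x > 0"
    proof -
      have "(s \<longlongrightarrow> s E) (nhds E)"
        using DERIV_isCont[OF ds] by (simp add: isCont_def tendsto_at_iff_tendsto_nhds)
      then show ?thesis using s by (rule order_tendstoD)
    qed
    then show ?thesis
      by eventually_elim (simp add: orbit_period_kappa s_def d_def divide_inverse)
  qed
  ultimately have "((\<lambda>x. orbit_period e (m x) (h x)) has_real_derivative
      sqrt e * (?R * kappa (d E / s E) + (k * ?Z) * inverse (sqrt (s E)))) (at E)"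
    by (simp only: DERIV_cong_ev[OF refl ev refl])
  moreover have "sqrt e * (?R * kappa (d E / s E) + (k * ?Z) * inverse (sqrt (s E))) > 0"
  proof -
    have "?Z > 0"
    proof -
      have "d' * s E > 0" "d E * s' \<le> 0" using d' s sd s' by (simp_all add: mult_nonneg_nonpos)
      then have "d' * s E - d E * s' > 0" by linarith
      then show ?thesis using s by simp
    qed
    moreover have "?R \<ge> 0"
    proof -
      have "inverse (sqrt (s E)) * (inverse (sqrt (s E)) / 2 * s') * inverse (sqrt (s E)) =
        (inverse (sqrt (s E)) * inverse (sqrt (s E)) / 2 * inverse (sqrt (s E))) * s'" by simp
      also have "\<dots> \<le> 0" using s s' by (intro mult_nonneg_nonpos) auto
      finally show ?thesis by linarith
    qed
    ultimately show ?thesis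
      using k(1) kp s e unfolding z_def[symmetric]
      by (intro mult_pos_pos add_nonneg_pos mult_nonneg_nonneg) auto
  qed
  ultimately show ?thesis by blast
qed

section \<open>Orbits, turning points and the outward normal\<close>

lemma local_inverse_increasing:
  fixes f :: "real \<Rightarrow> real"
  assumes f: "\<And>x. (f has_real_derivative f' x) (at x)" and f': "continuous_on UNIV f'" and pos: "f' x0 > 0"
  obtains g where "g (f x0) = x0" "\<forall>\<^sub>F y in nhds (f x0). f (g y) = y"
    "(g has_real_derivative inverse (f' x0)) (at (f x0))"
proof -
  have "\<forall>\<^sub>F x in nhds x0. f' x > 0"
    using f' pos by (intro order_tendstoD(1)[of f' "f' x0"])
      (auto simp: continuous_on_eq_continuous_at isCont_def tendsto_at_iff_tendsto_nhds)
  then obtain r where r: "r > 0" "\<And>x. \<bar>x - x0\<bar> < r \<Longrightarrow> f' x > 0"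
    unfolding eventually_nhds_metric dist_real_def by blast
  define d where "d = r / 2"
  have d: "d > 0" "\<And>x. \<bar>x - x0\<bar> \<le> d \<Longrightarrow> f' x > 0" using r by (auto simp: d_def)
  let ?I = "{x0 - d..x0 + d}"
  have mono: "f x < f y" if "x \<in> ?I" "y \<in> ?I" "x < y" for x y
  proof (rule DERIV_pos_imp_increasing[OF that(3)])
    fix t assume "x \<le> t" "t \<le> y"
    then have "\<bar>t - x0\<bar> \<le> d" using that by auto
    then show "\<exists>z. (f has_real_derivative z) (at t) \<and> 0 < z" using f d(2) by blast
  qed
  have inj: "inj_on f ?I"
    by (rule inj_onI) (metis mono less_irrefl linorder_neqE_linordered_idom)
  define g where "g = the_inv_into ?I f"
  have gf: "g (f z) = z" if "\<bar>z - x0\<bar> \<le> d" for z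
    unfolding g_def by (rule the_inv_into_f_f[OF inj]) (use that in auto)
  have fg: "f (g y) = y" if "f (x0 - d) < y" "y < f (x0 + d)" for y
  proof -
    have "\<exists>z. x0 - d \<le> z \<and> z \<le> x0 + d \<and> f z = y"
      by (rule IVT') (use that d(1) in \<open>auto intro: differentiable_real_continuous_on[OF f]\<close>)
    then obtain z where "z \<in> ?I" "f z = y" by auto
    then show ?thesis using gf[of z] by (auto simp: abs_le_iff)
  qed
  have near: "f (x0 - d) < f x0" "f x0 < f (x0 + d)" using d(1) by (auto intro!: mono)
  have "isCont g (f x0)"
    by (rule isCont_inverse_function[OF d(1)]) (use gf DERIV_isCont[OF f] in auto)
  have g0: "g (f x0) = x0" using gf[of x0] d(1) by simp
  have "(g has_real_derivative inverse (f' x0)) (at (f x0))"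
    by (rule DERIV_inverse_function[where f = f and a = "f (x0 - d)" and b = "f (x0 + d)"])
       (use f g0 pos near fg \<open>isCont g (f x0)\<close> in auto)
  moreover have "\<forall>\<^sub>F y in nhds (f x0). f (g y) = y"
    unfolding eventually_nhds using near fg
    by (intro exI[of _ "{f (x0 - d)<..<f (x0 + d)}"]) auto
  ultimately show ?thesis using that g0 by blast
qed

text \<open>The left turning point lies on a decreasing branch of the potential and the right one on
  an increasing branch, so both signs of the slope occur.\<close>

lemma local_inverse:
  fixes f :: "real \<Rightarrow> real"
  assumes f: "\<And>x. (f has_real_derivative f' x) (at x)" and f': "continuous_on UNIV f'" and nz: "f' x0 \<noteq> 0"
  obtains g where "g (f x0) = x0" "\<forall>\<^sub>F y in nhds (f x0). f (g y) = y"
    "(g has_real_derivative inverse (f' x0)) (at (f x0))"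
proof (cases "f' x0 > 0")
  case True
  then show ?thesis using local_inverse_increasing[OF f f'] that by blast
next
  case False
  then have "- f' x0 > 0" using nz by simp
  then obtain g where g: "g (- f x0) = x0" "\<forall>\<^sub>F y in nhds (- f x0). - f (g y) = y"
    "(g has_real_derivative inverse (- f' x0)) (at (- f x0))"
    using local_inverse_increasing[of "\<lambda>x. - f x" "\<lambda>x. - f' x" x0] f f'
    by (auto intro!: derivative_intros continuous_intros)
  have "((\<lambda>y. g (- y)) has_real_derivative inverse (- f' x0) * (- 1)) (at (f x0))"
    by (rule DERIV_chain2[of g "inverse (- f' x0)" uminus "f x0"]) (use g(3) in \<open>auto intro!: derivative_eq_intros\<close>)
  moreover have "\<forall>\<^sub>F y in nhds (f x0). f (g (- y)) = y"
  proof -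
    have "filterlim uminus (nhds (- f x0)) (nhds (f x0))" by (intro tendsto_minus filterlim_ident)
    from eventually_compose_filterlim[OF g(2) this] show ?thesis
      by eventually_elim simp
  qed
  ultimately show ?thesis using that[of "\<lambda>y. g (- y)"] g(1) by simp
qed

text \<open>The field is cubic and only locally Lipschitz. A common bound \<open>M\<close> on the
  first components makes \<open>pressure\<close> Lipschitz with constant \<open>2 + 6 M^2\<close>
  along both solutions, so their difference has linear growth.\<close>

lemma stationary_solution_unique:
  assumes e: "e1 > 0" "e2 > 0" and w1: "stationary_solution e1 e2 (vm, um) w1"
    and w2: "stationary_solution e1 e2 (vm, um) w2"
    and bd: "\<And>x. \<bar>fst (w1 x)\<bar> \<le> M" "\<And>x. \<bar>fst (w2 x)\<bar> \<le> M" and "w1 x0 = w2 x0"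
  shows "w1 = w2"
proof
  fix x
  define y' where "y' x = (- (snd (w1 x) - snd (w2 x)) / e1, (pressure (fst (w1 x)) - pressure (fst (w2 x))) / e2)" for x
  have "w1 x - w2 x = 0"
  proof (rule vanishing_of_linear_growth[of "\<lambda>x. w1 x - w2 x" y' "1 / e1 + (2 + 6 * M\<^sup>2) / e2" x0 x])
    fix x
    note D1 = stationary_solution_components[OF w1, of x] and D2 = stationary_solution_components[OF w2, of x]
    have "((\<lambda>x. (fst (w1 x) - fst (w2 x), snd (w1 x) - snd (w2 x))) has_vector_derivative
       (- (snd (w1 x) - um) / e1 - - (snd (w2 x) - um) / e1,
        (pressure (fst (w1 x)) - pressure vm) / e2 - (pressure (fst (w2 x)) - pressure vm) / e2)) (at x)"
      using DERIV_diff[OF D1(1) D2(1)] DERIV_diff[OF D1(2) D2(2)]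
      unfolding has_real_derivative_iff_has_vector_derivative by (rule has_vector_derivative_Pair)
    moreover have "(\<lambda>x. (fst (w1 x) - fst (w2 x), snd (w1 x) - snd (w2 x))) = (\<lambda>x. w1 x - w2 x)"
      by (simp add: fun_eq_iff prod_eq_iff)
    ultimately show "((\<lambda>x. w1 x - w2 x) has_vector_derivative y' x) (at x)"
      by (simp add: y'_def diff_divide_distrib algebra_simps)
    let ?n = "norm (w1 x - w2 x)"
    have n: "\<bar>fst (w1 x) - fst (w2 x)\<bar> \<le> ?n" "\<bar>snd (w1 x) - snd (w2 x)\<bar> \<le> ?n"
      using norm_fst_le[of "fst (w1 x - w2 x)" "snd (w1 x - w2 x)", unfolded prod.collapse]
        norm_snd_le[of "snd (w1 x - w2 x)" "fst (w1 x - w2 x)", unfolded prod.collapse] by simp_all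
    have lip: "\<bar>pressure a - pressure b\<bar> \<le> (2 + 6 * M\<^sup>2) * \<bar>a - b\<bar>" if "\<bar>a\<bar> \<le> M" "\<bar>b\<bar> \<le> M" for a b
    proof -
      have "pressure a - pressure b = (2 - 2 * (a\<^sup>2 + a * b + b\<^sup>2)) * (a - b)"
        unfolding pressure_eq by (simp add: algebra_simps power2_eq_square)
      moreover have "\<bar>2 - 2 * (a\<^sup>2 + a * b + b\<^sup>2)\<bar> \<le> 2 + 6 * M\<^sup>2"
      proof -
        have M: "M \<ge> 0" using that by linarith
        have "\<bar>a * a\<bar> \<le> M * M" "\<bar>a * b\<bar> \<le> M * M" "\<bar>b * b\<bar> \<le> M * M"
          unfolding abs_mult using that M by (intro mult_mono; simp)+
        then have "- (a * b) \<le> M * M" "a * b \<le> M * M" "a * a \<le> M * M" "b * b \<le> M * M"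
          by (simp_all add: abs_le_iff)
        moreover have "0 \<le> a * a" "0 \<le> b * b" by simp_all
        ultimately have "\<bar>2 - 2 * (a * a + a * b + b * b)\<bar> \<le> 2 + 6 * (M * M)"
          unfolding abs_le_iff distrib_left by linarith
        then show ?thesis by (simp only: power2_eq_square)
      qed
      ultimately show ?thesis by (simp add: abs_mult mult_right_mono)
    qed
    have "norm (y' x) \<le> \<bar>snd (w1 x) - snd (w2 x)\<bar> / e1 + \<bar>pressure (fst (w1 x)) - pressure (fst (w2 x))\<bar> / e2"
      unfolding y'_def using norm_Pair_le[of "- (snd (w1 x) - snd (w2 x)) / e1"
          "(pressure (fst (w1 x)) - pressure (fst (w2 x))) / e2"] e by (simp add: abs_minus_commute)
    also have "\<dots> \<le> ?n / e1 + (2 + 6 * M\<^sup>2) * ?n / e2"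
    proof (intro add_mono divide_right_mono n)
      have "\<bar>pressure (fst (w1 x)) - pressure (fst (w2 x))\<bar> \<le> (2 + 6 * M\<^sup>2) * \<bar>fst (w1 x) - fst (w2 x)\<bar>"
        by (rule lip[OF bd])
      also have "\<dots> \<le> (2 + 6 * M\<^sup>2) * ?n" by (rule mult_left_mono[OF n(1)]) simp
      finally show "\<bar>pressure (fst (w1 x)) - pressure (fst (w2 x))\<bar> \<le> (2 + 6 * M\<^sup>2) * ?n" .
    qed (use e in auto)
    also have "\<dots> = (1 / e1 + (2 + 6 * M\<^sup>2) / e2) * ?n" by (simp add: distrib_right)
    finally show "norm (y' x) \<le> (1 / e1 + (2 + 6 * M\<^sup>2) / e2) * ?n" .
  qed (use assms in simp)
  then show "w1 x = w2 x" by simp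
qed

lemma stationary_solution_shift:
  assumes "stationary_solution e1 e2 Um w"
  shows "stationary_solution e1 e2 Um (\<lambda>x. w (x + t))"
  using assms unfolding stationary_solution_def by (auto intro: has_vector_derivative_shift)

section \<open>Periodic orbits as ovals of the energy\<close>

lemma pressure_turning_points:
  assumes "pm = 2 * \<mu> * (1 - \<mu>\<^sup>2 - \<delta>\<^sup>2)"
  shows "pressure (\<mu> + \<delta>) - pm = \<delta> * ((2 - 2 * \<mu>\<^sup>2 - \<delta>\<^sup>2) - (2 * \<mu> + \<delta>)\<^sup>2)"
    "pressure (\<mu> - \<delta>) - pm = - (\<delta> * ((2 - 2 * \<mu>\<^sup>2 - \<delta>\<^sup>2) - (2 * \<mu> - \<delta>)\<^sup>2))"
  unfolding pressure_eq assms by (simp_all add: algebra_simps power2_eq_square)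

lemma pot_equal_turning_points:
  assumes "pot pm (\<mu> - \<delta>) = pot pm (\<mu> + \<delta>)" "\<delta> \<noteq> 0"
  shows "pm = 2 * \<mu> * (1 - \<mu>\<^sup>2 - \<delta>\<^sup>2)"
proof -
  have "\<delta> * (pm - 2 * \<mu> * (1 - \<mu>\<^sup>2 - \<delta>\<^sup>2)) = (pot pm (\<mu> - \<delta>) - pot pm (\<mu> + \<delta>)) / 2"
    unfolding pot_def by (simp add: field_simps power2_eq_square power4_eq_xxxx)
  then show ?thesis using assms by simp
qed

text \<open>The potential tends to \<open>- \<infinity>\<close> on both sides, so the level set also
  has unbounded branches beyond the outer roots; the bounds on the first coordinate select the
  closed curve.\<close>

definition oval :: "real \<Rightarrow> real \<Rightarrow> real \<times> real \<Rightarrow> real \<Rightarrow> real \<Rightarrow> (real \<times> real) set" where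
  "oval e1 e2 Um \<mu> \<delta> = {z. \<mu> - \<delta> \<le> fst z \<and> fst z \<le> \<mu> + \<delta> \<and>
      energy e1 e2 Um z = pot (pressure (fst Um)) (\<mu> - \<delta>)}"

lemma rest_point_constant:
  assumes e: "e1 > 0" "e2 > 0" and w: "stationary_solution e1 e2 (vm, um) w"
    and bd: "\<And>x. \<bar>fst (w x)\<bar> \<le> M"
    and rest: "pressure (fst (w x0)) = pressure vm" "snd (w x0) = um"
  shows "w constant_on UNIV"
proof -
  have "stationary_solution e1 e2 (vm, um) (\<lambda>_. w x0)"
    by (rule stationary_solutionI) (simp_all add: rest)
  from stationary_solution_unique[OF e w this bd bd refl] have "w x = w x0" for x by (metis)
  then show ?thesis unfolding constant_on_def by blast
qed

text \<open>The turning points are the extreme values of \<open>v\<close> over a period. The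
  potential stays below the energy between them, and neither is a rest point, so its slope is
  negative at the left one and positive at the right one. These two signs amount to the inequality
  in \<open>well\<close>, and uniqueness identifies the orbit with a shift of the explicit
  one.\<close>

theorem periodic_orbit_is_oval:
  assumes e: "e1 > 0" "e2 > 0" and w: "stationary_solution e1 e2 (vm, um) w" and np: "nonconstant_periodic w"
  obtains \<mu> \<delta> where "well (pressure vm) \<mu> \<delta>" "range w = oval e1 e2 (vm, um) \<mu> \<delta>"
proof -
  obtain T where T: "T > 0" "\<And>x. w (x + T) = w x" and nc: "\<not> w constant_on UNIV"
    using np unfolding nonconstant_periodic_def periodic_with_def by blast
  define v u where "v x = fst (w x)" and "u x = snd (w x)" for x
  define pm where "pm = pressure vm"
  have D: "(v has_real_derivative - (u x - um) / e1) (at x)" for x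
    using stationary_solution_components(1)[OF w, of x] by (simp add: v_def[abs_def] u_def)
  have cv: "continuous_on S v" for S
    by (rule differentiable_real_continuous_on[OF D])
  have per: "v (x + T) = v x" for x by (simp add: v_def T)
  obtain xc where "xc \<in> {0..T}" "\<forall>y\<in>{0..T}. v y \<le> v xc"
    using continuous_attains_sup[of "{0..T}" v] cv T(1) by auto
  then have xc: "v y \<le> v xc" for y
    using periodic_representative[of v T y, OF per T(1)] by force
  obtain xb where "xb \<in> {0..T}" "\<forall>y\<in>{0..T}. v xb \<le> v y"
    using continuous_attains_inf[of "{0..T}" v] cv T(1) by auto
  then have xb: "v xb \<le> v y" for y
    using periodic_representative[of v T y, OF per T(1)] by force
  have "- (u xc - um) / e1 = 0" by (rule DERIV_local_max[OF D, of 1]) (use xc in auto)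
  then have uc: "u xc = um" using e by simp
  have "- (u xb - um) / e1 = 0" by (rule DERIV_local_min[OF D, of 1]) (use xb in auto)
  then have ub: "u xb = um" using e by simp
  define b c where "b = v xb" and "c = v xc"
  obtain M where M: "\<And>x. \<bar>fst (w x)\<bar> \<le> M"
    using periodic_bounded[of v T] per T(1) cv by (metis real_norm_def v_def)
  have en: "energy e1 e2 (vm, um) (w x) = pot pm (v x) + e2 / (2 * e1) * (u x - um)\<^sup>2" for x
    by (simp add: energy_def v_def u_def pm_def)
  have Eb: "energy e1 e2 (vm, um) (w x) = pot pm b" for x
    using energy_conserved[OF e w, of x xb] en[of xb] ub by (simp add: b_def)
  have Ec: "pot pm c = pot pm b" using Eb[of xc] en[of xc] uc by (simp add: c_def)
  have "b < c"
  proof (rule ccontr)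
    assume "\<not> b < c"
    then have vx: "v x = b" for x using xb[of x] xc[of x] by (auto simp: b_def c_def)
    have ux: "u x = um" for x
    proof -
      have "(v has_real_derivative 0) (at x)"
        using DERIV_const[of b "at x"] vx by (metis ext)
      from DERIV_unique[OF this D] show ?thesis using e by simp
    qed
    have "w x = (b, um)" for x using vx[of x] ux[of x] by (simp add: v_def u_def prod_eq_iff)
    then show False using nc unfolding constant_on_def by blast
  qed
  \<comment> \<open>Every value between \<open>b\<close> and \<open>c\<close> is attained by
    \<open>v\<close>, and at such a time the kinetic energy is non-negative.\<close>
  have below: "pot pm y \<le> pot pm b" if "b \<le> y" "y \<le> c" for y
  proof -
    have "\<exists>x. v x = y"
      using connected_contains_Icc[of "range v" b c] that cv[of UNIV]
        connected_continuous_image[of UNIV v] by (force simp: b_def c_def)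
    then obtain x where "v x = y" by blast
    then have "pot pm b = pot pm y + e2 / (2 * e1) * (u x - um)\<^sup>2" using Eb[of x] en[of x] by simp
    moreover have "e2 / (2 * e1) * (u x - um)\<^sup>2 \<ge> 0" using e by simp
    ultimately show ?thesis by linarith
  qed
  have nz: "pressure c \<noteq> pm" "pressure b \<noteq> pm"
    using rest_point_constant[OF e w M, of xc] rest_point_constant[OF e w M, of xb] nc uc ub
    by (auto simp: v_def u_def b_def c_def pm_def)
  have pc: "pressure c - pm > 0"
  proof (rule ccontr)
    assume "\<not> pressure c - pm > 0"
    then have "pressure c - pm < 0" using nz by simp
    then obtain d where d: "d > 0" "\<And>h. 0 < h \<Longrightarrow> h < d \<Longrightarrow> pot pm c < pot pm (c - h)"
      using DERIV_neg_dec_left[OF pot_derivative] by blast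
    define h where "h = min (d / 2) (c - b)"
    have "pot pm c < pot pm (c - h)" using d \<open>b < c\<close> by (intro d) (auto simp: h_def)
    moreover have "pot pm (c - h) \<le> pot pm b" using d \<open>b < c\<close> by (intro below) (auto simp: h_def)
    ultimately show False using Ec by simp
  qed
  have pb: "pressure b - pm < 0"
  proof (rule ccontr)
    assume "\<not> pressure b - pm < 0"
    then have "pressure b - pm > 0" using nz by simp
    then obtain d where d: "d > 0" "\<And>h. 0 < h \<Longrightarrow> h < d \<Longrightarrow> pot pm b < pot pm (b + h)"
      using DERIV_pos_inc_right[OF pot_derivative] by blast
    define h where "h = min (d / 2) (c - b)"
    have "pot pm b < pot pm (b + h)" using d \<open>b < c\<close> by (intro d) (auto simp: h_def)
    moreover have "pot pm (b + h) \<le> pot pm b" using d \<open>b < c\<close> by (intro below) (auto simp: h_def)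
    ultimately show False by simp
  qed
  define \<mu> \<delta> where "\<mu> = (b + c) / 2" and "\<delta> = (c - b) / 2"
  have bc: "\<mu> - \<delta> = b" "\<mu> + \<delta> = c" by (simp_all add: \<mu>_def \<delta>_def field_simps)
  have \<delta>: "\<delta> > 0" using \<open>b < c\<close> by (simp add: \<delta>_def)
  have pm: "pm = 2 * \<mu> * (1 - \<mu>\<^sup>2 - \<delta>\<^sup>2)"
    by (rule pot_equal_turning_points) (use Ec \<delta> in \<open>simp_all add: bc\<close>)
  have "well pm \<mu> \<delta>"
  proof -
    have "\<delta> * ((2 - 2 * \<mu>\<^sup>2 - \<delta>\<^sup>2) - (2 * \<mu> + \<delta>)\<^sup>2) > 0" "\<delta> * ((2 - 2 * \<mu>\<^sup>2 - \<delta>\<^sup>2) - (2 * \<mu> - \<delta>)\<^sup>2) > 0"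
      using pc pb pressure_turning_points[OF pm] by (simp_all add: bc)
    then have "(2 * \<mu> + \<delta>)\<^sup>2 < 2 - 2 * \<mu>\<^sup>2 - \<delta>\<^sup>2" "(2 * \<mu> - \<delta>)\<^sup>2 < 2 - 2 * \<mu>\<^sup>2 - \<delta>\<^sup>2"
      using \<delta> by (simp_all add: zero_less_mult_iff)
    then have "(\<delta> + 2 * \<bar>\<mu>\<bar>)\<^sup>2 < 2 - 2 * \<mu>\<^sup>2 - \<delta>\<^sup>2"
      by (cases "\<mu> \<ge> 0") (simp_all add: power2_eq_square algebra_simps)
    then have "\<delta> + 2 * \<bar>\<mu>\<bar> < outer_root \<mu> \<delta>"
      unfolding outer_root_def by (rule real_less_rsqrt)
    then show ?thesis using \<delta> pm by (simp add: well_def)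
  qed
  then have well: "well (pressure vm) \<mu> \<delta>" by (simp add: pm_def)
  obtain w' where w': "stationary_solution e1 e2 (vm, um) w'" "range w' = oval e1 e2 (vm, um) \<mu> \<delta>"
    by (rule explicit_orbit[OF e well]) (simp add: oval_def)
  have "w 0 \<in> oval e1 e2 (vm, um) \<mu> \<delta>"
    unfolding oval_def using xb[of 0] xc[of 0] Eb[of 0] by (auto simp: bc b_def c_def v_def pm_def)
  then obtain t where t: "w 0 = w' t" unfolding w'(2)[symmetric] by blast
  have bd': "\<bar>fst (w' x)\<bar> \<le> \<bar>\<mu>\<bar> + \<delta>" for x
  proof -
    have "w' x \<in> oval e1 e2 (vm, um) \<mu> \<delta>" using w'(2) by blast
    then show ?thesis by (auto simp: oval_def)
  qed
  have bdw: "\<bar>fst (w x)\<bar> \<le> \<bar>\<mu>\<bar> + \<delta>" for x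
    using xb[of x] xc[of x] bc unfolding b_def c_def v_def by auto
  have "w = (\<lambda>x. w' (x + t))"
    by (rule stationary_solution_unique[OF e w stationary_solution_shift[OF w'(1)] bdw bd', of 0])
      (simp add: t)
  moreover have "range (\<lambda>x. w' (x + t)) = range w'"
  proof (intro equalityI subsetI)
    fix z assume "z \<in> range w'"
    then obtain x where "z = w' ((x - t) + t)" by auto
    then show "z \<in> range (\<lambda>x. w' (x + t))" by blast
  qed auto
  ultimately have "range w = range w'" by simp
  then show ?thesis using that[OF well] w'(2) by simp
qed

text \<open>The component of \<open>z\<close> in the complement of \<open>S\<close> would be
  unbounded, hence would leave \<open>D\<close> and by connectedness meet its frontier, which lies
  in \<open>S\<close>. This locates the inside of an orbit without the Jordan curve theorem.\<close>

lemma outside_disjoint_open_bounded: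
  fixes S D :: "'a::euclidean_space set"
  assumes "open D" "bounded D" "frontier D \<subseteq> S" "z \<in> D"
  shows "z \<notin> outside S"
proof
  assume z: "z \<in> outside S"
  let ?C = "connected_component_set (- S) z"
  have z': "z \<in> - S" "\<not> bounded ?C" using z by (auto simp: outside_def)
  then have "?C - D \<noteq> {}" using bounded_subset[OF \<open>bounded D\<close>] by blast
  moreover have "?C \<inter> D \<noteq> {}" using z'(1) \<open>z \<in> D\<close> by (auto intro!: connected_component_refl)
  ultimately have "?C \<inter> frontier D \<noteq> {}"
    by (intro connected_Int_frontier connected_connected_component)
  then show False using \<open>frontier D \<subseteq> S\<close> connected_component_subset[of "- S" z] by blast
qed

lemma energy_continuous: "continuous_on S (energy e1 e2 Um)"
  unfolding energy_def[abs_def] pot_def by (intro continuous_intros) auto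

text \<open>The points of smaller energy between the turning points form an open bounded set. At the
  two end abscissas the energy is at least that of the orbit, so no frontier point has smaller
  energy and the frontier lies on the oval.\<close>

lemma oval_interior_not_outside:
  assumes e: "e1 > 0" "e2 > 0"
    and z: "\<mu> - \<delta> \<le> fst z" "fst z \<le> \<mu> + \<delta>" "energy e1 e2 Um z < pot (pressure (fst Um)) (\<mu> - \<delta>)"
    and eq: "pot (pressure (fst Um)) (\<mu> + \<delta>) = pot (pressure (fst Um)) (\<mu> - \<delta>)"
  shows "z \<notin> outside (oval e1 e2 Um \<mu> \<delta>)"
proof -
  define E where "E = pot (pressure (fst Um)) (\<mu> - \<delta>)"
  define D where "D = {z. \<mu> - \<delta> < fst z \<and> fst z < \<mu> + \<delta> \<and> energy e1 e2 Um z < E}"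
  have ge: "energy e1 e2 Um y \<ge> pot (pressure (fst Um)) (fst y)" for y
    unfolding energy_def using e by simp
  have inD: "y \<in> D" if "\<mu> - \<delta> \<le> fst y" "fst y \<le> \<mu> + \<delta>" "energy e1 e2 Um y < E" for y
    using ge[of y] that eq unfolding D_def E_def by (auto simp: less_le)
  have "open D"
  proof -
    have "open {z. energy e1 e2 Um z < E}"
      by (intro open_Collect_less energy_continuous continuous_intros)
    moreover have "open {z :: real \<times> real. \<mu> - \<delta> < fst z}" "open {z :: real \<times> real. fst z < \<mu> + \<delta>}"
      by (intro open_Collect_less continuous_intros)+
    moreover have "D = {z. \<mu> - \<delta> < fst z} \<inter> {z. fst z < \<mu> + \<delta>} \<inter> {z. energy e1 e2 Um z < E}"
      by (auto simp: D_def)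
    ultimately show ?thesis by (simp add: open_Int)
  qed
  moreover have "bounded D"
  proof -
    have "compact (pot (pressure (fst Um)) ` {\<mu> - \<delta>..\<mu> + \<delta>})"
      by (intro compact_continuous_image differentiable_real_continuous_on[OF pot_derivative]) auto
    then obtain K where K: "\<And>y. y \<in> {\<mu> - \<delta>..\<mu> + \<delta>} \<Longrightarrow> \<bar>pot (pressure (fst Um)) y\<bar> \<le> K"
      using compact_imp_bounded[THEN bounded_iff[THEN iffD1]] by (metis imageI real_norm_def)
    have "\<bar>snd y - snd Um\<bar> \<le> sqrt ((E + K) * (2 * e1) / e2)" if "y \<in> D" for y
    proof -
      have "e2 / (2 * e1) * (snd y - snd Um)\<^sup>2 \<le> E + K"
        using that K[of "fst y"] unfolding D_def energy_def by (auto simp: abs_le_iff)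
      then have "(snd y - snd Um)\<^sup>2 \<le> (E + K) * (2 * e1) / e2" using e by (simp add: field_simps)
      then show ?thesis by (rule real_le_rsqrt[of "\<bar>snd y - snd Um\<bar>", simplified])
    qed
    then have "D \<subseteq> cbox (\<mu> - \<delta>, snd Um - sqrt ((E + K) * (2 * e1) / e2)) (\<mu> + \<delta>, snd Um + sqrt ((E + K) * (2 * e1) / e2))"
      by (fastforce simp: D_def cbox_Pair_eq abs_le_iff)
    then show ?thesis using bounded_cbox bounded_subset by blast
  qed
  moreover have "frontier D \<subseteq> oval e1 e2 Um \<mu> \<delta>"
  proof
    fix y assume y: "y \<in> frontier D"
    have "closed {z. energy e1 e2 Um z \<le> E}"
      by (intro closed_Collect_le energy_continuous continuous_intros)
    moreover have "closed {z :: real \<times> real. \<mu> - \<delta> \<le> fst z}" "closed {z :: real \<times> real. fst z \<le> \<mu> + \<delta>}"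
      by (intro closed_Collect_le continuous_intros)+
    ultimately have "closed ({z. \<mu> - \<delta> \<le> fst z} \<inter> {z. fst z \<le> \<mu> + \<delta>} \<inter> {z. energy e1 e2 Um z \<le> E})"
      by (intro closed_Int)
    then have "closure D \<subseteq> {z. \<mu> - \<delta> \<le> fst z} \<inter> {z. fst z \<le> \<mu> + \<delta>} \<inter> {z. energy e1 e2 Um z \<le> E}"
      by (rule closure_minimal[rotated]) (auto simp: D_def)
    moreover have "y \<in> closure D" "y \<notin> D"
      using y \<open>open D\<close> by (auto simp: frontier_def interior_open)
    ultimately have "\<mu> - \<delta> \<le> fst y" "fst y \<le> \<mu> + \<delta>" "energy e1 e2 Um y \<le> E" by auto
    moreover from this have "\<not> energy e1 e2 Um y < E" using inD[of y] \<open>y \<notin> D\<close> by blast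
    ultimately have "energy e1 e2 Um y = E" "\<mu> - \<delta> \<le> fst y" "fst y \<le> \<mu> + \<delta>" by simp_all
    then show "y \<in> oval e1 e2 Um \<mu> \<delta>" by (simp add: oval_def E_def)
  qed
  moreover have "z \<in> D" by (rule inD) (use z in \<open>simp_all add: E_def\<close>)
  ultimately show ?thesis by (rule outside_disjoint_open_bounded)
qed

lemma well_turning_points:
  assumes "well pm \<mu> \<delta>"
  shows "pot pm (\<mu> + \<delta>) = pot pm (\<mu> - \<delta>)"
    "0 < (outer_root \<mu> \<delta>)\<^sup>2 - (2 * \<mu> + \<delta>)\<^sup>2" "0 < (outer_root \<mu> \<delta>)\<^sup>2 - (2 * \<mu> - \<delta>)\<^sup>2"
proof -
  note W = wellD[OF assms]
  have pm: "pm = 2 * \<mu> * (1 - \<mu>\<^sup>2 - \<delta>\<^sup>2)" using assms by (simp add: well_def)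
  show "pot pm (\<mu> + \<delta>) = pot pm (\<mu> - \<delta>)"
    using pot_factor[OF W(3) pm, of "\<mu> + \<delta>"] by simp
  have "\<bar>2 * \<mu> + \<delta>\<bar> < \<bar>outer_root \<mu> \<delta>\<bar>" "\<bar>2 * \<mu> - \<delta>\<bar> < \<bar>outer_root \<mu> \<delta>\<bar>"
    using W(1,2,4) by linarith+
  moreover have "x\<^sup>2 < y\<^sup>2" if "\<bar>x\<bar> < \<bar>y\<bar>" for x y :: real
    using power_strict_mono[OF that, of 2] by simp
  ultimately show "0 < (outer_root \<mu> \<delta>)\<^sup>2 - (2 * \<mu> + \<delta>)\<^sup>2" "0 < (outer_root \<mu> \<delta>)\<^sup>2 - (2 * \<mu> - \<delta>)\<^sup>2"
    by simp_all
qed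

text \<open>Between the outer roots the last factor of the quartic is negative, so potential at most
  \<open>E\<close> forces the first coordinate between the turning points. The strict condition on
  the first coordinate is open and thus passes to nearby points and nearby orbits, while the
  conclusion by itself would not.\<close>

lemma oval_criterion:
  assumes e: "e1 > 0" "e2 > 0" and W: "well (pressure (fst Um)) \<mu> \<delta>"
    and z: "\<bar>fst z + \<mu>\<bar> < outer_root \<mu> \<delta>" "energy e1 e2 Um z \<le> pot (pressure (fst Um)) (\<mu> - \<delta>)"
  shows "\<mu> - \<delta> \<le> fst z" "fst z \<le> \<mu> + \<delta>"
proof -
  note w = wellD[OF W]
  define pm where "pm = pressure (fst Um)"
  have pm: "pm = 2 * \<mu> * (1 - \<mu>\<^sup>2 - \<delta>\<^sup>2)" using W by (simp add: well_def pm_def)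
  have "pot pm (fst z) \<le> pot pm (\<mu> - \<delta>)"
  proof -
    have "pot pm (fst z) \<le> energy e1 e2 Um z" unfolding energy_def pm_def using e by simp
    then show ?thesis using z(2) by (simp add: pm_def)
  qed
  then have "(fst z - (\<mu> - \<delta>)) * ((\<mu> + \<delta>) - fst z) * ((fst z + \<mu>)\<^sup>2 - (outer_root \<mu> \<delta>)\<^sup>2) \<le> 0"
    using pot_factor[OF w(3) pm, of "fst z"] by simp
  moreover have "(fst z + \<mu>)\<^sup>2 < (outer_root \<mu> \<delta>)\<^sup>2"
    using z(1) w(4) by (metis abs_ge_zero power2_abs power_strict_mono zero_less_numeral)
  ultimately have "0 \<le> (fst z - (\<mu> - \<delta>)) * ((\<mu> + \<delta>) - fst z)"
    by (simp add: mult_le_0_iff)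
  then show "\<mu> - \<delta> \<le> fst z" "fst z \<le> \<mu> + \<delta>"
    using w(1) by (auto simp: zero_le_mult_iff)
qed

text \<open>Near a given orbit the turning points are local inverses of the potential, hence
  differentiable functions of the energy.\<close>

lemma well_family:
  assumes W: "well pm \<mu> \<delta>"
  obtains m h where "m (pot pm (\<mu> - \<delta>)) = \<mu>" "h (pot pm (\<mu> - \<delta>)) = \<delta>"
    "\<forall>\<^sub>F E in nhds (pot pm (\<mu> - \<delta>)). well pm (m E) (h E) \<and> pot pm (m E - h E) = E"
    "\<And>e. e > 0 \<Longrightarrow> \<exists>T'>0. ((\<lambda>E. orbit_period e (m E) (h E)) has_real_derivative T') (at (pot pm (\<mu> - \<delta>)))"
    "isCont m (pot pm (\<mu> - \<delta>))" "isCont h (pot pm (\<mu> - \<delta>))"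
proof -
  note w = wellD[OF W] and t = well_turning_points[OF W]
  define \<rho> E0 where "\<rho> = outer_root \<mu> \<delta>" and "E0 = pot pm (\<mu> - \<delta>)"
  \<comment> \<open>\<open>- \<delta> B\<close> and \<open>\<delta> C\<close> are the slopes of the
    potential at the left and right turning points, whose derivatives in the energy are therefore
    \<open>- 1 / (\<delta> B)\<close> and \<open>1 / (\<delta> C)\<close>. With
    \<open>B - C = 8 \<mu> \<delta>\<close> the midpoint has derivative
    \<open>4 \<mu> / (B C)\<close>.\<close>
  define B C where "B = \<rho>\<^sup>2 - (2 * \<mu> - \<delta>)\<^sup>2" and "C = \<rho>\<^sup>2 - (2 * \<mu> + \<delta>)\<^sup>2"
  have BC: "B > 0" "C > 0" using t by (simp_all add: B_def C_def \<rho>_def)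
  have pm: "pm = 2 * \<mu> * (1 - \<mu>\<^sup>2 - \<delta>\<^sup>2)" using W by (simp add: well_def)
  have pb: "pressure (\<mu> - \<delta>) - pm = - (\<delta> * B)" and pc: "pressure (\<mu> + \<delta>) - pm = \<delta> * C"
    unfolding B_def C_def \<rho>_def w(3) by (rule pressure_turning_points[OF pm])+
  have cont: "continuous_on UNIV (\<lambda>v. pressure v - pm)"
    unfolding pressure_eq by (intro continuous_intros)
  obtain gb where gb: "gb (pot pm (\<mu> - \<delta>)) = \<mu> - \<delta>" "\<forall>\<^sub>F y in nhds (pot pm (\<mu> - \<delta>)). pot pm (gb y) = y"
    "(gb has_real_derivative inverse (pressure (\<mu> - \<delta>) - pm)) (at (pot pm (\<mu> - \<delta>)))"
    by (rule local_inverse[OF pot_derivative cont, of "\<mu> - \<delta>"]) (use pb w(1) BC in auto)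
  obtain gc where gc: "gc (pot pm (\<mu> + \<delta>)) = \<mu> + \<delta>" "\<forall>\<^sub>F y in nhds (pot pm (\<mu> + \<delta>)). pot pm (gc y) = y"
    "(gc has_real_derivative inverse (pressure (\<mu> + \<delta>) - pm)) (at (pot pm (\<mu> + \<delta>)))"
    by (rule local_inverse[OF pot_derivative cont, of "\<mu> + \<delta>"]) (use pc w(1) BC in auto)
  note gb = gb[folded E0_def, unfolded pb] and gc = gc[unfolded t(1), folded E0_def, unfolded pc]
  define m h where "m E = (gb E + gc E) / 2" and "h E = (gc E - gb E) / 2" for E
  have m0: "m E0 = \<mu>" and h0: "h E0 = \<delta>" by (simp_all add: m_def h_def gb(1) gc(1))
  have dm: "(m has_real_derivative 4 * \<mu> / (B * C)) (at E0)"
  proof -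
    have "(m has_real_derivative (inverse (- (\<delta> * B)) + inverse (\<delta> * C)) / 2) (at E0)"
      unfolding m_def[abs_def] by (intro DERIV_cdivide DERIV_add gb gc)
    moreover have "(inverse (- (\<delta> * B)) + inverse (\<delta> * C)) / 2 = (B - C) / (2 * \<delta> * (B * C))"
      using w(1) BC by (simp add: field_simps)
    moreover have "B - C = 8 * \<mu> * \<delta>" by (simp add: B_def C_def power2_eq_square algebra_simps)
    ultimately show ?thesis using w(1) BC by (simp add: field_simps)
  qed
  have dh: "(h has_real_derivative (\<rho>\<^sup>2 - 4 * \<mu>\<^sup>2 - \<delta>\<^sup>2) / (\<delta> * (B * C))) (at E0)"
  proof -
    have "(h has_real_derivative (inverse (\<delta> * C) - inverse (- (\<delta> * B))) / 2) (at E0)"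
      unfolding h_def[abs_def] by (intro DERIV_cdivide DERIV_diff gb gc)
    moreover have "(inverse (\<delta> * C) - inverse (- (\<delta> * B))) / 2 = ((B + C) / 2) / (\<delta> * (B * C))"
      using w(1) BC by (simp add: field_simps)
    moreover have "(B + C) / 2 = \<rho>\<^sup>2 - 4 * \<mu>\<^sup>2 - \<delta>\<^sup>2"
    proof -
      have "B + C = 2 * (\<rho>\<^sup>2 - 4 * \<mu>\<^sup>2 - \<delta>\<^sup>2)"
        by (simp add: B_def C_def power2_eq_square algebra_simps)
      moreover have "x / 2 = y" if "x = 2 * y" for x y :: real using that by simp
      ultimately show ?thesis by blast
    qed
    ultimately show ?thesis by (simp only:)
  qed
  have per: "\<exists>T'>0. ((\<lambda>E. orbit_period e (m E) (h E)) has_real_derivative T') (at E0)" if "e > 0" for e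
  proof (rule orbit_period_increasing[OF that, where Q = "B * C"])
    show "well pm (m E0) (h E0)" using W by (simp add: m0 h0)
    show "B * C > 0" using BC by simp
  qed (use dm dh in \<open>simp_all add: m0 h0 \<rho>_def\<close>)
  have cm: "isCont m E0" and ch: "isCont h E0" by (rule DERIV_isCont[OF dm], rule DERIV_isCont[OF dh])
  have lim: "(m \<longlongrightarrow> \<mu>) (nhds E0)" "(h \<longlongrightarrow> \<delta>) (nhds E0)"
    using cm[unfolded isCont_def tendsto_at_iff_tendsto_nhds]
      ch[unfolded isCont_def tendsto_at_iff_tendsto_nhds] by (simp_all add: m0 h0)
  have "\<forall>\<^sub>F E in nhds E0. h E > 0" using order_tendstoD(1)[OF lim(2)] w(1) by blast
  moreover have "\<forall>\<^sub>F E in nhds E0. outer_root (m E) (h E) - (h E + 2 * \<bar>m E\<bar>) > 0"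
  proof (rule order_tendstoD(1))
    show "((\<lambda>E. outer_root (m E) (h E) - (h E + 2 * \<bar>m E\<bar>)) \<longlongrightarrow> outer_root \<mu> \<delta> - (\<delta> + 2 * \<bar>\<mu>\<bar>)) (nhds E0)"
      unfolding outer_root_def by (intro tendsto_intros lim)
  qed (use w(2) in simp)
  ultimately have "\<forall>\<^sub>F E in nhds E0. well pm (m E) (h E) \<and> pot pm (m E - h E) = E"
    using gb(2) gc(2)
  proof eventually_elim
    case (elim E)
    have mh: "m E - h E = gb E" "m E + h E = gc E" by (simp_all add: m_def h_def field_simps)
    have "pm = 2 * m E * (1 - (m E)\<^sup>2 - (h E)\<^sup>2)"
      by (rule pot_equal_turning_points) (use elim mh in auto)
    then show ?case using elim mh by (simp add: well_def)
  qed
  then show ?thesis using that[of m h] m0 h0 per cm ch unfolding E0_def by blast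
qed

text \<open>The amplitude acts only through the energy: the period is an increasing function of the
  energy, and the energy has derivative \<open>r \<gamma>\<close> along the curve. The outward
  direction is needed for the sign of \<open>\<gamma>\<close>.\<close>

theorem period_increasing:
  assumes e: "e1 > 0" "e2 > 0" and w: "stationary_solution e1 e2 (vm, um) w" and np: "nonconstant_periodic w"
    and c: "amplitude_curve w c a0"
  shows "period_increasing_at e1 e2 (vm, um) c a0"
proof -
  let ?Um = "(vm, um)"
  let ?En = "energy e1 e2 ?Um"
  define pm where "pm = pressure vm"
  obtain \<mu> \<delta> where W: "well pm \<mu> \<delta>" and rw: "range w = oval e1 e2 ?Um \<mu> \<delta>"
    unfolding pm_def by (rule periodic_orbit_is_oval[OF e w np])
  note wd = wellD[OF W]
  define E0 where "E0 = pot pm (\<mu> - \<delta>)"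
  obtain x n r where n: "outward_unit_normal w x n" and ca: "c a0 = w x" and r: "r > 0"
    and dc: "(c has_vector_derivative r *\<^sub>R n) (at a0)"
    using c unfolding amplitude_curve_def by blast
  obtain n1 n2 where n12: "n = (n1, n2)" by (metis prod.exhaust)
  define v u where "v = fst (w x)" and "u = snd (w x)"
  define \<alpha> \<beta> where "\<alpha> = pressure v - pm" and "\<beta> = e2 / e1 * (u - um)"
  have wx: "w x \<in> oval e1 e2 ?Um \<mu> \<delta>" using rw by blast
  then have v: "\<mu> - \<delta> \<le> v" "v \<le> \<mu> + \<delta>" and Ewx: "?En (w x) = E0"
    by (auto simp: oval_def v_def E0_def pm_def)
  have vr: "\<bar>v + \<mu>\<bar> < outer_root \<mu> \<delta>" using v wd(2) by linarith
  have bd: "\<bar>fst (w y)\<bar> \<le> \<bar>\<mu>\<bar> + \<delta>" for y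
  proof -
    have "w y \<in> oval e1 e2 ?Um \<mu> \<delta>" using rw by blast
    then show ?thesis by (auto simp: oval_def)
  qed
  have dw: "vector_derivative w (at x) = (- (u - um) / e1, \<alpha> / e2)"
  proof (rule vector_derivative_at)
    have "stationary_field e1 e2 ?Um (w x) = (- (u - um) / e1, \<alpha> / e2)"
      unfolding v_def u_def \<alpha>_def pm_def by (metis prod.collapse stationary_field.simps)
    then show "(w has_vector_derivative (- (u - um) / e1, \<alpha> / e2)) (at x)"
      using w unfolding stationary_solution_def by metis
  qed
  have norm1: "n1\<^sup>2 + n2\<^sup>2 = 1"
    using n unfolding outward_unit_normal_def n12 by (simp add: norm_Pair)
  \<comment> \<open>The flow is tangent to the level sets of the energy, so a vector orthogonal to
    the velocity is parallel to the gradient \<open>(\<alpha>, \<beta>)\<close>. Hence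
    \<open>\<gamma>\<close> vanishes only if the gradient does, that is, only at a rest
    point.\<close>
  have orth: "n2 * \<alpha> = n1 * \<beta>"
  proof -
    have "n1 * (- (u - um) / e1) + n2 * (\<alpha> / e2) = 0"
      using n unfolding outward_unit_normal_def dw n12 by simp
    then show ?thesis using e by (simp add: \<beta>_def field_simps)
  qed
  define \<gamma> where "\<gamma> = n1 * \<alpha> + n2 * \<beta>"
  have dE: "((\<lambda>t. ?En (f t)) has_real_derivative s * \<gamma>) (at t0)"
    if f: "(f has_vector_derivative s *\<^sub>R n) (at t0)" "f t0 = w x" for f s t0
  proof -
    have f1: "((\<lambda>t. fst (f t)) has_real_derivative s * n1) (at t0)"
      and f2: "((\<lambda>t. snd (f t)) has_real_derivative s * n2) (at t0)"
      using bounded_linear.has_vector_derivative[OF bounded_linear_fst f(1)]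
        bounded_linear.has_vector_derivative[OF bounded_linear_snd f(1)]
      by (simp_all add: has_real_derivative_iff_has_vector_derivative n12)
    have f2': "((\<lambda>t. snd (f t) - um) has_real_derivative s * n2) (at t0)"
      using DERIV_diff[OF f2 DERIV_const[of um]] by simp
    have "((\<lambda>t. pot pm (fst (f t)) + e2 / (2 * e1) * ((snd (f t) - um) * (snd (f t) - um))) has_real_derivative
      (pressure (fst (f t0)) - pm) * (s * n1) +
      e2 / (2 * e1) * (s * n2 * (snd (f t0) - um) + s * n2 * (snd (f t0) - um))) (at t0)"
      by (intro DERIV_add DERIV_cmult DERIV_mult DERIV_chain2[OF pot_derivative f1] f2')
    moreover have "(pressure (fst (f t0)) - pm) * (s * n1) +
      e2 / (2 * e1) * (s * n2 * (snd (f t0) - um) + s * n2 * (snd (f t0) - um)) = s * \<gamma>"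
      using e by (simp add: \<gamma>_def \<alpha>_def \<beta>_def f(2) v_def u_def field_simps)
    ultimately show ?thesis by (simp add: energy_def pm_def power2_eq_square)
  qed
  have "\<gamma> \<noteq> 0"
  proof
    assume 0: "\<gamma> = 0"
    have "\<alpha> = (n1\<^sup>2 + n2\<^sup>2) * \<alpha>" using norm1 by simp
    also have "\<dots> = n1 * \<gamma> + n2 * (n2 * \<alpha> - n1 * \<beta>)"
      by (simp add: \<gamma>_def algebra_simps power2_eq_square)
    finally have "\<alpha> = 0" using 0 orth by simp
    have "\<beta> = (n1\<^sup>2 + n2\<^sup>2) * \<beta>" using norm1 by simp
    also have "\<dots> = n2 * \<gamma> - n1 * (n2 * \<alpha> - n1 * \<beta>)"
      by (simp add: \<gamma>_def algebra_simps power2_eq_square)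
    finally have "\<beta> = 0" using 0 orth by simp
    then have "snd (w x) = um" using e by (simp add: \<beta>_def u_def)
    moreover have "pressure (fst (w x)) = pressure vm" using \<open>\<alpha> = 0\<close> by (simp add: \<alpha>_def v_def pm_def)
    ultimately have "w constant_on UNIV" using rest_point_constant[OF e w bd] by blast
    then show False using np unfolding nonconstant_periodic_def by blast
  qed
  \<comment> \<open>If the energy decreased along \<open>n\<close>, points just off the orbit in
    that direction would lie in the region enclosed by the oval, contrary to the membership in
    \<open>outside\<close>.\<close>
  moreover have "\<not> \<gamma> < 0"
  proof
    assume neg: "\<gamma> < 0"
    define f where "f t = w x + t *\<^sub>R n" for t
    have df: "(f has_vector_derivative 1 *\<^sub>R n) (at 0)"
      unfolding f_def by (auto intro!: derivative_eq_intros)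
    have "1 * \<gamma> < 0" using neg by simp
    from DERIV_neg_dec_right[OF dE[OF df] this]
    obtain d where d: "d > 0" "\<And>t. 0 < t \<Longrightarrow> t < d \<Longrightarrow> ?En (f (0 + t)) < ?En (f 0)"
      by (auto simp: f_def)
    have "\<forall>\<^sub>F t in at_right 0. ?En (f t) < E0"
      unfolding eventually_at_right_field using d Ewx by (intro exI[of _ d]) (auto simp: f_def)
    moreover have "\<forall>\<^sub>F t in at_right 0. \<bar>fst (f t) + \<mu>\<bar> < outer_root \<mu> \<delta>"
    proof (rule order_tendstoD(2))
      show "((\<lambda>t. \<bar>fst (f t) + \<mu>\<bar>) \<longlongrightarrow> \<bar>fst (w x + 0 *\<^sub>R n) + \<mu>\<bar>) (at_right 0)"
        unfolding f_def by (intro tendsto_intros)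
    qed (use vr in \<open>simp add: v_def\<close>)
    moreover have "\<forall>\<^sub>F t in at_right 0. f t \<in> outside (range w)"
      using n unfolding outward_unit_normal_def f_def by blast
    ultimately have "\<forall>\<^sub>F t in at_right (0::real). False"
    proof eventually_elim
      case (elim t)
      have b: "\<mu> - \<delta> \<le> fst (f t)" "fst (f t) \<le> \<mu> + \<delta>"
        by (rule oval_criterion[OF e, of ?Um]; use elim W in \<open>simp add: pm_def E0_def\<close>)+
      have "f t \<notin> outside (oval e1 e2 ?Um \<mu> \<delta>)"
        by (rule oval_interior_not_outside[OF e b])
          (use elim well_turning_points(1)[OF W] in \<open>simp_all add: E0_def pm_def\<close>)
      then show False using elim rw by simp
    qed
    then show False by (simp add: eventually_False)
  qed
  ultimately have \<gamma>: "\<gamma> > 0" by simp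
  obtain m h where mh0: "m E0 = \<mu>" "h E0 = \<delta>"
    and ev: "\<forall>\<^sub>F E in nhds E0. well pm (m E) (h E) \<and> pot pm (m E - h E) = E"
    and per: "\<And>e. e > 0 \<Longrightarrow> \<exists>T'>0. ((\<lambda>E. orbit_period e (m E) (h E)) has_real_derivative T') (at E0)"
    and cont: "isCont m E0" "isCont h E0"
    by (rule well_family[OF W, folded E0_def]) (rule that)
  obtain T' where T': "T' > 0" "((\<lambda>E. orbit_period (e1 * e2) (m E) (h E)) has_real_derivative T') (at E0)"
    using per[of "e1 * e2"] e by auto
  define En where "En a = ?En (c a)" for a
  have En0: "En a0 = E0" by (simp add: En_def ca Ewx)
  have dEn: "(En has_real_derivative r * \<gamma>) (at a0)"
    unfolding En_def[abs_def] by (rule dE[OF dc ca])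
  have limE: "(En \<longlongrightarrow> E0) (nhds a0)"
    using DERIV_isCont[OF dEn, unfolded isCont_def tendsto_at_iff_tendsto_nhds] by (simp add: En0)
  have limc: "(c \<longlongrightarrow> w x) (nhds a0)"
    using has_vector_derivative_continuous[OF dc, unfolded isCont_def tendsto_at_iff_tendsto_nhds] by (simp add: ca)
  have limm: "((\<lambda>a. m (En a)) \<longlongrightarrow> \<mu>) (nhds a0)" and limh: "((\<lambda>a. h (En a)) \<longlongrightarrow> \<delta>) (nhds a0)"
    using isCont_tendsto_compose[OF cont(1) limE] isCont_tendsto_compose[OF cont(2) limE] mh0 by simp_all
  have "\<forall>\<^sub>F a in nhds a0. outer_root (m (En a)) (h (En a)) - \<bar>fst (c a) + m (En a)\<bar> > 0"
  proof (rule order_tendstoD(1))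
    show "((\<lambda>a. outer_root (m (En a)) (h (En a)) - \<bar>fst (c a) + m (En a)\<bar>) \<longlongrightarrow>
        outer_root \<mu> \<delta> - \<bar>fst (w x) + \<mu>\<bar>) (nhds a0)"
      unfolding outer_root_def by (intro tendsto_intros limm limh limc)
  qed (use vr in \<open>simp add: v_def\<close>)
  moreover have "\<forall>\<^sub>F a in nhds a0. well pm (m (En a)) (h (En a)) \<and> pot pm (m (En a) - h (En a)) = En a"
    using eventually_compose_filterlim[OF ev limE] .
  ultimately have orbit: "\<forall>\<^sub>F a in nhds a0. periodic_orbit_through e1 e2 ?Um (c a)
      (orbit_period (e1 * e2) (m (En a)) (h (En a)))"
  proof eventually_elim
    case (elim a)
    let ?m = "m (En a)" and ?h = "h (En a)"
    have Wa: "well (pressure vm) ?m ?h" using elim by (simp add: pm_def)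
    have b: "?m - ?h \<le> fst (c a)" "fst (c a) \<le> ?m + ?h"
      by (rule oval_criterion[OF e, of ?Um]; use elim in \<open>simp add: pm_def En_def\<close>)+
    obtain w' where w': "stationary_solution e1 e2 ?Um w'" "nonconstant_periodic w'"
      "fundamental_period w' (orbit_period (e1 * e2) ?m ?h)"
      "range w' = {z. ?m - ?h \<le> fst z \<and> fst z \<le> ?m + ?h \<and> ?En z = pot (pressure vm) (?m - ?h)}"
      by (rule explicit_orbit[OF e Wa])
    have "c a \<in> range w'" unfolding w'(4) using b elim by (simp add: En_def pm_def)
    then show ?case unfolding periodic_orbit_through_def using w' by blast
  qed
  moreover have "((\<lambda>a. orbit_period (e1 * e2) (m (En a)) (h (En a))) has_real_derivative T' * (r * \<gamma>)) (at a0)"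
    by (rule DERIV_chain2[of "\<lambda>E. orbit_period (e1 * e2) (m E) (h E)" T' En a0]) (use T'(2) En0 dEn in simp_all)
  moreover have "T' * (r * \<gamma>) > 0" using T' r \<gamma> by simp
  ultimately show ?thesis unfolding period_increasing_at_def
    by (intro exI[of _ "\<lambda>a. orbit_period (e1 * e2) (m (En a)) (h (En a))"] exI[of _ "T' * (r * \<gamma>)"] conjI)
qed

theorem mainTheorem7:
  fixes \<epsilon>1 \<epsilon>2 :: real
  assumes "\<epsilon>1 > 0" and "\<epsilon>2 > 0"
  shows "(\<forall>Um w c a0.
           stationary_solution \<epsilon>1 \<epsilon>2 Um w \<and> nonconstant_periodic w \<and> amplitude_curve w c a0
           \<longrightarrow> period_increasing_at \<epsilon>1 \<epsilon>2 Um c a0) \<and>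
         (\<forall>s U. periodic_traveling_wave \<epsilon>1 \<epsilon>2 s U
           \<longrightarrow> s = 0 \<and> (\<forall>p \<ge> 1. spectrally_unstable p \<epsilon>1 \<epsilon>2 U))"
proof (intro conjI allI impI)
  fix Um w c a0
  assume "stationary_solution \<epsilon>1 \<epsilon>2 Um w \<and> nonconstant_periodic w \<and> amplitude_curve w c a0"
  then show "period_increasing_at \<epsilon>1 \<epsilon>2 Um c a0"
    using period_increasing[OF assms] by (cases Um) blast
next
  fix s U
  assume U: "periodic_traveling_wave \<epsilon>1 \<epsilon>2 s U"
  then show "s = 0"
    using periodic_traveling_wave_stationary[OF assms] by blast
next
  fix s U and p :: ennreal
  assume U: "periodic_traveling_wave \<epsilon>1 \<epsilon>2 s U" and "1 \<le> p"
  obtain vm um where "stationary_solution \<epsilon>1 \<epsilon>2 (vm, um) U"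
    using periodic_traveling_wave_stationary[OF assms U] by blast
  then show "spectrally_unstable p \<epsilon>1 \<epsilon>2 U"
    using stationary_periodic_unstable[OF assms] U \<open>1 \<le> p\<close> by (simp add: periodic_traveling_wave_def)
qed

end
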